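(* Let $n\in\mathbb{N}\cup\{\infty\}$ and let $f\colon(L,\ell)\to(L',\ell')$ be a weak $L_\infty$-morphism between finite type Lie $n$-algebras. Then $f$ can be factored in the category $\mathsf{Lie}_n\mathsf{Alg}^{\mathrm{fin}}$ as $$(L,\ell)\xrightarrow{\ \jmath\ }(\tilde L,\tilde\ell)\xrightarrow{\ p_f\ }(L',\ell'),$$ where $\jmath$ is a weak equivalence and $p_f$ is a fibration in $\mathsf{Lie}_n\mathsf{Alg}$.
   Context: Conventions: $\Bbbk$ is a field of characteristic zero and gradings are homological. For a $\mathbb{Z}$-graded vector space $V$, $\mathbf{s}V$ denotes the suspension, $(\mathbf{s}V)_i = V_{i-1}$, and $\bar S(V)=\bigoplus_{k\ge 1}S^k(V)$ is the reduced symmetric coalgebra, with $\bar\Delta(v_1\vee\cdots\vee v_m)=\sum_{p=1}^{m-1}\sum_{\sigma}\epsilon(\sigma)(v_{\sigma(1)}\vee\cdots\vee v_{\sigma(p)})\otimes(v_{\sigma(p+1)}\vee\cdots\vee v_{\sigma(m)})$, the inner sum over $(p,m-p)$-shuffles and $\epsilon(\sigma)$ the Koszul sign. Coderivations of, and coalgebra morphisms between, such coalgebras are uniquely determined by their components $\bar S(V)\to V$, resp. $\bar S(V)\to V'$. An $L_\infty$-algebra $(L,\ell)$ is a $\mathbb{Z}$-graded vector space $L$ with graded skew-symmetric maps $\ell_k\colon \Lambda^kL\to L$ of degree $k-2$ ($k\ge 1$) such that the degree $-1$ coderivation $\delta$ of $\bar S(\mathbf{s}L)$ with components $\delta^1_k=(-1)^{k(k-1)/2}\,\mathbf{s}\circ\ell_k\circ(\mathbf{s}^{-1})^{\otimes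 k}$ satisfies $\delta^2=0$. A (weak) $L_\infty$-morphism $f\colon(L,\ell)\to(L',\ell')$ is a collection of graded skew-symmetric maps $f_k\colon\Lambda^kL\to L'$ of degree $k-1$ ($k\ge1$) such that the coalgebra morphism $F\colon\bar S(\mathbf{s}L)\to\bar S(\mathbf{s}L')$ with components $F^1_k=(-1)^{k(k-1)/2}\,\mathbf{s}\circ f_k\circ(\mathbf{s}^{-1})^{\otimes k}$ satisfies $F\delta=\delta'F$. Composition is composition of coalgebra morphisms; $f_1$ is always a chain map $(L,\ell_1)\to(L',\ell'_1)$. A Lie $n$-algebra is an $L_\infty$-algebra concentrated in degrees $0,1,\dots,n-1$ (in all degrees $\geq 0$ if $n=\infty$); it is of finite type if each $L_i$ is finite-dimensional. $\mathsf{Lie}_n\mathsf{Alg}$ is the category of Lie $n$-algebras and weak $L_\infty$-morphisms and $\mathsf{Lie}_n\mathsf{Alg}^{\mathrm{fin}}$ its full subcategory of finite type objects. A morphism $f$ is a weak equivalence if $f_1$ is a quasi-isomorphism, and a fibration if $f_1$ is surjective in all positive degrees. *)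

theory Defs
  imports
    "HOL-Library.Poly_Mapping"
    "HOL-Library.Product_Plus"
    "HOL-Library.Extended_Nat"
    "HOL-Combinatorics.Permutations"
begin

section \<open>Graded vector spaces\<close>

text \<open>
  A \<open>\<int>\<close>-graded vector space is a family of subspaces of one ambient vector space.  The family is
  not assumed to be independent: the graded space meant is the external direct sum of its members,
  so that every family of vector spaces is of this form up to isomorphism.  Accordingly a
  homogeneous element is a pair \<open>(i, x)\<close> with \<open>x\<close> in component \<open>i\<close>.
\<close>

record ('k, 'v) gvs =
  gscale :: "'k \<Rightarrow> 'v \<Rightarrow> 'v"
  gcomp :: "int \<Rightarrow> 'v set"

definition is_gvs :: "('k::field, 'v::ab_group_add) gvs \<Rightarrow> bool" where
  "is_gvs V \<longleftrightarrow> vector_space (gscale V) \<and> (\<forall>i. module.subspace (gscale V) (gcomp V i))"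

definition susp :: "('k, 'v) gvs \<Rightarrow> ('k, 'v) gvs" where
  "susp V = V\<lparr>gcomp := (\<lambda>i. gcomp V (i - 1))\<rparr>"

definition words :: "('k, 'v) gvs \<Rightarrow> (int \<times> 'v) list set" where
  "words V = {xs. xs \<noteq> [] \<and> (\<forall>(i, x)\<in>set xs. x \<in> gcomp V i)}"

definition wdeg :: "(int \<times> 'v) list \<Rightarrow> int" where
  "wdeg xs = sum_list (map fst xs)"

definition sgn_pow :: "int \<Rightarrow> 'k::field" where
  "sgn_pow n = (- 1) powi n"


section \<open>Free vector spaces\<close>

definition fscale :: "'k::field \<Rightarrow> ('a \<Rightarrow>\<^sub>0 'k) \<Rightarrow> ('a \<Rightarrow>\<^sub>0 'k)" where
  "fscale c x = Poly_Mapping.map (\<lambda>b. c * b) x"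

lemma lookup_fscale [simp]: "Poly_Mapping.lookup (fscale c x) a = c * Poly_Mapping.lookup x a"
  by (simp add: fscale_def Poly_Mapping.map.rep_eq when_def)

lemma vector_space_fscale: "vector_space (fscale :: 'k::field \<Rightarrow> ('a \<Rightarrow>\<^sub>0 'k) \<Rightarrow> ('a \<Rightarrow>\<^sub>0 'k))"
  by unfold_locales (auto intro!: poly_mapping_eqI simp: Poly_Mapping.lookup_add algebra_simps)

abbreviation fspan :: "('a \<Rightarrow>\<^sub>0 'k::field) set \<Rightarrow> ('a \<Rightarrow>\<^sub>0 'k) set" where
  "fspan \<equiv> module.span fscale"

definition gen :: "'a \<Rightarrow> ('a \<Rightarrow>\<^sub>0 'k::field)" where
  "gen a = Poly_Mapping.single a 1"

definition lin_ext :: "('a \<Rightarrow> ('b \<Rightarrow>\<^sub>0 'k::field)) \<Rightarrow> ('a \<Rightarrow>\<^sub>0 'k) \<Rightarrow> ('b \<Rightarrow>\<^sub>0 'k)" where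
  "lin_ext g x = (\<Sum>a\<in>Poly_Mapping.keys x. fscale (Poly_Mapping.lookup x a) (g a))"

definition tens :: "('a \<Rightarrow>\<^sub>0 'k::field) \<Rightarrow> ('b \<Rightarrow>\<^sub>0 'k) \<Rightarrow> ('a \<times> 'b \<Rightarrow>\<^sub>0 'k)" where
  "tens x y = lin_ext (\<lambda>a. lin_ext (\<lambda>b. gen (a, b)) y) x"


section \<open>The reduced symmetric coalgebra\<close>

text \<open>
  The reduced symmetric coalgebra of \<open>V\<close> is the quotient of \<open>sym_free V\<close>, the free vector space on
  the nonempty words in homogeneous elements of \<open>V\<close>, by \<open>sym_null V\<close>, which is spanned by the
  relations of multilinearity and graded symmetry; the class of \<open>gen [v1, ..., vm]\<close> is
  \<open>v1 \<or> ... \<or> vm\<close>.  Quotients are not formed: a linear map between them is given by a linear map of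
  the free spaces that respects the relations (any linear map of the quotients lifts to such a
  map), and equations between elements are read modulo the relations.
\<close>

definition sym_free :: "('k::field, 'v) gvs \<Rightarrow> ((int \<times> 'v) list \<Rightarrow>\<^sub>0 'k) set" where
  "sym_free V = fspan (gen ` words V)"

definition sym_null :: "('k::field, 'v::ab_group_add) gvs \<Rightarrow> ((int \<times> 'v) list \<Rightarrow>\<^sub>0 'k) set" where
  "sym_null V = fspan (
     {gen (xs @ (i, x + y) # ys) - gen (xs @ (i, x) # ys) - gen (xs @ (i, y) # ys) | xs i x y ys.
        xs @ (i, x) # ys \<in> words V \<and> y \<in> gcomp V i} \<union>
     {gen (xs @ (i, gscale V c x) # ys) - fscale c (gen (xs @ (i, x) # ys)) | xs i c x ys.
        xs @ (i, x) # ys \<in> words V} \<union>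
     {gen (xs @ (i, x) # (j, y) # ys)
        - fscale (sgn_pow (i * j)) (gen (xs @ (j, y) # (i, x) # ys)) | xs i x j y ys.
        xs @ (i, x) # (j, y) # ys \<in> words V})"

text \<open>The relations that present the tensor square of the reduced symmetric coalgebra.\<close>

definition sym_null2 ::
  "('k::field, 'v::ab_group_add) gvs \<Rightarrow> ((int \<times> 'v) list \<times> (int \<times> 'v) list \<Rightarrow>\<^sub>0 'k) set" where
  "sym_null2 V = fspan (
     {tens x y | x y. x \<in> sym_null V \<and> y \<in> sym_free V} \<union>
     {tens x y | x y. x \<in> sym_free V \<and> y \<in> sym_null V})"

text \<open>Words are indexed from 0, so that a shuffle permutes \<open>{..<m}\<close>.\<close>

definition shuffles_of :: "nat \<Rightarrow> nat \<Rightarrow> (nat \<Rightarrow> nat) set" where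
  "shuffles_of p m =
     {\<sigma>. \<sigma> permutes {..<m} \<and> strict_mono_on {..<p} \<sigma> \<and> strict_mono_on {p..<m} \<sigma>}"

definition koszul :: "(nat \<Rightarrow> nat) \<Rightarrow> (int \<times> 'v) list \<Rightarrow> 'k::field" where
  "koszul \<sigma> xs =
     (\<Prod>(a, b)\<in>{(a, b). a < b \<and> b < length xs \<and> \<sigma> b < \<sigma> a}.
        sgn_pow (fst (xs ! \<sigma> a) * fst (xs ! \<sigma> b)))"

definition sym_diag ::
  "((int \<times> 'v) list \<Rightarrow>\<^sub>0 'k::field) \<Rightarrow> ((int \<times> 'v) list \<times> (int \<times> 'v) list \<Rightarrow>\<^sub>0 'k)" where
  "sym_diag = lin_ext (\<lambda>xs.
     \<Sum>p\<in>{1..<length xs}. \<Sum>\<sigma>\<in>shuffles_of p (length xs).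
       fscale (koszul \<sigma> xs) (gen (take p (permute_list \<sigma> xs), drop p (permute_list \<sigma> xs))))"

definition sym_hom ::
  "int \<Rightarrow> ('k::field, 'v::ab_group_add) gvs \<Rightarrow> ('k, 'w::ab_group_add) gvs \<Rightarrow>
   (((int \<times> 'v) list \<Rightarrow>\<^sub>0 'k) \<Rightarrow> ((int \<times> 'w) list \<Rightarrow>\<^sub>0 'k)) \<Rightarrow> bool" where
  "sym_hom e V W \<Phi> \<longleftrightarrow>
     module_hom fscale fscale \<Phi> \<and>
     (\<forall>xs\<in>words V. \<Phi> (gen xs) \<in> fspan (gen ` {ys \<in> words W. wdeg ys = wdeg xs + e})) \<and>
     (\<forall>x\<in>sym_null V. \<Phi> x \<in> sym_null W)"

definition coalgebra_hom ::
  "('k::field, 'v::ab_group_add) gvs \<Rightarrow> ('k, 'w::ab_group_add) gvs \<Rightarrow>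
   (((int \<times> 'v) list \<Rightarrow>\<^sub>0 'k) \<Rightarrow> ((int \<times> 'w) list \<Rightarrow>\<^sub>0 'k)) \<Rightarrow> bool" where
  "coalgebra_hom V W F \<longleftrightarrow>
     sym_hom 0 V W F \<and>
     (\<forall>x\<in>sym_free V.
        sym_diag (F x) - lin_ext (\<lambda>(xs, ys). tens (F (gen xs)) (F (gen ys))) (sym_diag x)
          \<in> sym_null2 W)"

definition coderivation ::
  "int \<Rightarrow> ('k::field, 'v::ab_group_add) gvs \<Rightarrow>
   (((int \<times> 'v) list \<Rightarrow>\<^sub>0 'k) \<Rightarrow> ((int \<times> 'v) list \<Rightarrow>\<^sub>0 'k)) \<Rightarrow> bool" where
  "coderivation e V D \<longleftrightarrow>
     sym_hom e V V D \<and>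
     (\<forall>x\<in>sym_free V.
        sym_diag (D x)
          - lin_ext (\<lambda>(xs, ys). tens (D (gen xs)) (gen ys)
              + fscale (sgn_pow (e * wdeg xs)) (tens (gen xs) (D (gen ys)))) (sym_diag x)
          \<in> sym_null2 V)"

text \<open>The degree \<open>i\<close> part of the projection of the reduced symmetric coalgebra onto \<open>V\<close>.\<close>

definition sym_proj ::
  "('k::field, 'v::ab_group_add) gvs \<Rightarrow> int \<Rightarrow> ((int \<times> 'v) list \<Rightarrow>\<^sub>0 'k) \<Rightarrow> 'v" where
  "sym_proj V i x =
     (\<Sum>ws\<in>Poly_Mapping.keys x.
        if length ws = 1 \<and> wdeg ws = i
        then gscale V (Poly_Mapping.lookup x ws) (snd (hd ws)) else 0)"

definition has_components ::
  "int \<Rightarrow> ('k::field, 'v::ab_group_add) gvs \<Rightarrow> ('k, 'w::ab_group_add) gvs \<Rightarrow>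
   (((int \<times> 'v) list \<Rightarrow>\<^sub>0 'k) \<Rightarrow> ((int \<times> 'w) list \<Rightarrow>\<^sub>0 'k)) \<Rightarrow> ((int \<times> 'v) list \<Rightarrow> 'w) \<Rightarrow> bool" where
  "has_components e V W \<Phi> c \<longleftrightarrow>
     (\<forall>xs\<in>words V. \<forall>i. sym_proj W i (\<Phi> (gen xs)) = (if i = wdeg xs + e then c xs else 0))"


section \<open>\<open>L\<^sub>\<infinity>\<close>-algebras and weak morphisms\<close>

text \<open>
  A family of maps \<open>g\<^sub>k\<close> on the exterior powers of \<open>V\<close>, of degree \<open>d k\<close>, is a function \<open>g\<close> on words
  that is multilinear and graded skew-symmetric; \<open>g\<^sub>k\<close> is its restriction to words of length \<open>k\<close>.
  Values outside \<open>words V\<close> are irrelevant.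
\<close>

definition skew_family ::
  "('k::field, 'v::ab_group_add) gvs \<Rightarrow> ('k, 'w::ab_group_add) gvs \<Rightarrow> (nat \<Rightarrow> int) \<Rightarrow>
   ((int \<times> 'v) list \<Rightarrow> 'w) \<Rightarrow> bool" where
  "skew_family V W d g \<longleftrightarrow>
     (\<forall>xs\<in>words V. g xs \<in> gcomp W (wdeg xs + d (length xs))) \<and>
     (\<forall>xs i x y ys. xs @ (i, x) # ys \<in> words V \<longrightarrow> y \<in> gcomp V i \<longrightarrow>
        g (xs @ (i, x + y) # ys) = g (xs @ (i, x) # ys) + g (xs @ (i, y) # ys)) \<and>
     (\<forall>xs i c x ys. xs @ (i, x) # ys \<in> words V \<longrightarrow>
        g (xs @ (i, gscale V c x) # ys) = gscale W c (g (xs @ (i, x) # ys))) \<and>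
     (\<forall>xs i x j y ys. xs @ (i, x) # (j, y) # ys \<in> words V \<longrightarrow>
        g (xs @ (i, x) # (j, y) # ys) =
        gscale W (- sgn_pow (i * j)) (g (xs @ (j, y) # (i, x) # ys)))"

text \<open>
  \<open>(-1)\<^bsup>k(k-1)/2\<^esup> s \<circ> g\<^sub>k \<circ> (s\<^sup>-\<^sup>1)\<^bsup>\<otimes>k\<^esup>\<close> as a function on words in the suspension of the source.  The Koszul
  rule for the degree \<open>-1\<close> map \<open>s\<^sup>-\<^sup>1\<close> gives
  \<open>(s\<^sup>-\<^sup>1)\<^bsup>\<otimes>k\<^esup> (x\<^sub>1 \<otimes> ... \<otimes> x\<^sub>k) = (-1)\<^bsup>\<Sum>(k-j)|x\<^sub>j|\<^esup> s\<^sup>-\<^sup>1 x\<^sub>1 \<otimes> ... \<otimes> s\<^sup>-\<^sup>1 x\<^sub>k\<close> (here \<open>j\<close> runs from 1; below from 0).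
\<close>

definition susp_components ::
  "('k::field, 'w) gvs \<Rightarrow> ((int \<times> 'v) list \<Rightarrow> 'w) \<Rightarrow> (int \<times> 'v) list \<Rightarrow> 'w" where
  "susp_components W g xs =
     (let k = length xs in
      gscale W
        (sgn_pow (int (k * (k - 1) div 2)) * sgn_pow (\<Sum>j<k. int (k - 1 - j) * fst (xs ! j)))
        (g (map (\<lambda>(i, x). (i - 1, x)) xs)))"

record ('k, 'v) linf =
  underlying :: "('k, 'v) gvs"
  bracket :: "(int \<times> 'v) list \<Rightarrow> 'v"

abbreviation suspL :: "('k, 'v) linf \<Rightarrow> ('k, 'v) gvs" where
  "suspL L \<equiv> susp (underlying L)"

text \<open>
  For brackets, resp. maps, that form a skew family, there is exactly one such \<open>D\<close>, resp. \<open>F\<close>, up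
  to equality modulo the relations: coderivations and coalgebra morphisms are determined by their
  components.
\<close>

definition induced_coderivation ::
  "('k::field, 'v::ab_group_add) linf \<Rightarrow>
   (((int \<times> 'v) list \<Rightarrow>\<^sub>0 'k) \<Rightarrow> ((int \<times> 'v) list \<Rightarrow>\<^sub>0 'k)) \<Rightarrow> bool" where
  "induced_coderivation L D \<longleftrightarrow>
     coderivation (- 1) (suspL L) D \<and>
     has_components (- 1) (suspL L) (suspL L) D (susp_components (underlying L) (bracket L))"

definition induced_coalgebra_hom ::
  "('k::field, 'v::ab_group_add) linf \<Rightarrow> ('k, 'w::ab_group_add) linf \<Rightarrow> ((int \<times> 'v) list \<Rightarrow> 'w) \<Rightarrow>
   (((int \<times> 'v) list \<Rightarrow>\<^sub>0 'k) \<Rightarrow> ((int \<times> 'w) list \<Rightarrow>\<^sub>0 'k)) \<Rightarrow> bool" where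
  "induced_coalgebra_hom L M f F \<longleftrightarrow>
     coalgebra_hom (suspL L) (suspL M) F \<and>
     has_components 0 (suspL L) (suspL M) F (susp_components (underlying M) f)"

definition linf_algebra :: "('k::field, 'v::ab_group_add) linf \<Rightarrow> bool" where
  "linf_algebra L \<longleftrightarrow>
     is_gvs (underlying L) \<and>
     skew_family (underlying L) (underlying L) (\<lambda>k. int k - 2) (bracket L) \<and>
     (\<exists>D. induced_coderivation L D \<and> (\<forall>x\<in>sym_free (suspL L). D (D x) \<in> sym_null (suspL L)))"

definition linf_morphism ::
  "('k::field, 'v::ab_group_add) linf \<Rightarrow> ('k, 'w::ab_group_add) linf \<Rightarrow> ((int \<times> 'v) list \<Rightarrow> 'w) \<Rightarrow> bool"
  where
  "linf_morphism L M f \<longleftrightarrow>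
     skew_family (underlying L) (underlying M) (\<lambda>k. int k - 1) f \<and>
     (\<exists>F D D'. induced_coalgebra_hom L M f F \<and> induced_coderivation L D \<and> induced_coderivation M D' \<and>
        (\<forall>x\<in>sym_free (suspL L). F (D x) - D' (F x) \<in> sym_null (suspL M)))"

text \<open>\<open>linf_comp L M N g f h\<close>: the morphism \<open>h\<close> from \<open>L\<close> to \<open>N\<close> is the composite \<open>g \<circ> f\<close>.\<close>

definition linf_comp ::
  "('k::field, 'v::ab_group_add) linf \<Rightarrow> ('k, 'u::ab_group_add) linf \<Rightarrow> ('k, 'w::ab_group_add) linf \<Rightarrow>
   ((int \<times> 'u) list \<Rightarrow> 'w) \<Rightarrow> ((int \<times> 'v) list \<Rightarrow> 'u) \<Rightarrow> ((int \<times> 'v) list \<Rightarrow> 'w) \<Rightarrow> bool" where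
  "linf_comp L M N g f h \<longleftrightarrow>
     (\<exists>F G. induced_coalgebra_hom L M f F \<and> induced_coalgebra_hom M N g G \<and>
        induced_coalgebra_hom L N h (G \<circ> F))"


section \<open>Lie \<open>n\<close>-algebras, weak equivalences and fibrations\<close>

definition lie_n_algebra :: "enat \<Rightarrow> ('k::field, 'v::ab_group_add) linf \<Rightarrow> bool" where
  "lie_n_algebra n L \<longleftrightarrow>
     linf_algebra L \<and>
     (\<forall>i. \<not> (0 \<le> i \<and> enat (nat i) < n) \<longrightarrow> gcomp (underlying L) i = {0})"

definition finite_type :: "('k::field, 'v::ab_group_add) linf \<Rightarrow> bool" where
  "finite_type L \<longleftrightarrow>
     (\<forall>i. \<exists>B. finite B \<and> gcomp (underlying L) i = module.span (gscale (underlying L)) B)"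

definition cycles :: "('k, 'v::ab_group_add) linf \<Rightarrow> int \<Rightarrow> 'v set" where
  "cycles L i = {x \<in> gcomp (underlying L) i. bracket L [(i, x)] = 0}"

definition boundaries :: "('k, 'v) linf \<Rightarrow> int \<Rightarrow> 'v set" where
  "boundaries L i = (\<lambda>y. bracket L [(i + 1, y)]) ` gcomp (underlying L) (i + 1)"

definition homologous :: "('k, 'v::ab_group_add) linf \<Rightarrow> int \<Rightarrow> ('v \<times> 'v) set" where
  "homologous L i = {(x, y). x \<in> cycles L i \<and> y \<in> cycles L i \<and> x - y \<in> boundaries L i}"

definition homology :: "('k, 'v::ab_group_add) linf \<Rightarrow> int \<Rightarrow> 'v set set" where
  "homology L i = cycles L i // homologous L i"

definition weak_equivalence ::
  "('k, 'v::ab_group_add) linf \<Rightarrow> ('k, 'w::ab_group_add) linf \<Rightarrow> ((int \<times> 'v) list \<Rightarrow> 'w) \<Rightarrow> bool" where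
  "weak_equivalence L M f \<longleftrightarrow>
     (\<forall>i. bij_betw (\<lambda>X. homologous M i `` ((\<lambda>x. f [(i, x)]) ` X)) (homology L i) (homology M i))"

definition fibration ::
  "('k, 'v) linf \<Rightarrow> ('k, 'w) linf \<Rightarrow> ((int \<times> 'v) list \<Rightarrow> 'w) \<Rightarrow> bool" where
  "fibration L M f \<longleftrightarrow>
     (\<forall>i>0. (\<lambda>x. f [(i, x)]) ` gcomp (underlying L) i = gcomp (underlying M) i)"

end

theory Submission
  imports Defs
begin

text \<open>
  Let \<open>A\<close> be the cone on the truncation of \<open>L'\<close> to positive degrees: it has a generator \<open>e\<close> in degree
  \<open>i\<close> and a generator \<open>b = d e\<close> in degree \<open>i - 1\<close> for \<open>e \<in> L'\<^sub>i\<close>, \<open>i \<ge> 1\<close>.  It is acyclic, so the strict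
  inclusion of \<open>L\<close> into the product \<open>L \<times> A\<close>, with \<open>A\<close> abelian, is a weak equivalence.  To extend \<open>f\<close> to
  \<open>L \<times> A\<close>, let \<open>A\<close> act on the unital symmetric coalgebra of \<open>s L'\<close> by coderivations: \<open>e\<close> by
  multiplication \<open>m\<^sub>e\<close>, and \<open>b = d e\<close> by the graded commutator of the codifferential with \<open>m\<^sub>e\<close>.  This
  action commutes with the differentials.  The symmetrised product of the actions of
  \<open>a\<^sub>1, \<dots>, a\<^sub>k\<close>, applied to \<open>F x\<close>, is then the value of a morphism of differential coalgebras at
  \<open>a\<^sub>1 \<or> \<dots> \<or> a\<^sub>k \<or> x\<close>, because the symmetrisation map from the symmetric coalgebra to an enveloping
  algebra is one of coalgebras.  Its linear part sends \<open>e\<close> to \<open>e\<close>, hence is onto in positive degrees.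
\<close>

section \<open>Linear maps on free vector spaces\<close>

text \<open>The obstacle is the bracket of \<open>L'\<close>: it is not abelian, so adding the
  linear map \<open>e -> e\<close> to \<open>f\<close> in general violates the morphism equation,
  and corrections of all orders are needed. The operators of the action need not commute with each
  other either; the enveloping algebra meant is that of the free graded Lie algebra, and averaging
  over all orders of action restores symmetry at the price of dividing by factorials. The unit
  matters twice: multiplication by a letter is a coderivation only when \<open>1\<close> is present,
  and \<open>m_e 1 = e\<close> is what makes the linear part onto. The truncation is forced from two
  sides: \<open>b\<close> lies one degree below \<open>e\<close> and must stay in degrees at least
  0, while a fibration asks for nothing in degree 0. The definitions only assert that suitable
  coderivations exist; uniqueness, which inverts \<open>2 ^ m - 2\<close>, replaces them by an
  explicit formula. Co-Leibniz rules hold exactly on words, whereas \<open>d d = 0\<close> and the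
  identities for \<open>F\<close> hold only modulo the relations.\<close>

interpretation fs: vector_space fscale
  by (rule vector_space_fscale)

text \<open>\<open>lin_ext\<close> has free spaces as targets only; components and the projection to
  the generators take values in \<open>V\<close> itself, whose scalar multiplication is data of the
  record and is therefore passed as \<open>s\<close>.\<close>

definition glin :: "('k::field \<Rightarrow> 'b::ab_group_add \<Rightarrow> 'b) \<Rightarrow> ('a \<Rightarrow> 'b) \<Rightarrow> ('a \<Rightarrow>\<^sub>0 'k) \<Rightarrow> 'b" where
  "glin s g x = (\<Sum>a\<in>Poly_Mapping.keys x. s (Poly_Mapping.lookup x a) (g a))"

context vector_space
begin

lemma glin_superset:
  assumes "finite S" "Poly_Mapping.keys x \<subseteq> S"
  shows "glin scale g x = (\<Sum>a\<in>S. scale (Poly_Mapping.lookup x a) (g a))"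
  unfolding glin_def
  by (rule sum.mono_neutral_left) (use assms in \<open>auto simp: in_keys_iff\<close>)

lemma glin_add: "glin scale g (x + y) = glin scale g x + glin scale g y"
proof -
  let ?S = "Poly_Mapping.keys x \<union> Poly_Mapping.keys y"
  have "glin scale g z = (\<Sum>a\<in>?S. scale (Poly_Mapping.lookup z a) (g a))"
    if "z \<in> {x + y, x, y}" for z
    using that Poly_Mapping.keys_add[of x y] by (intro glin_superset) auto
  then show ?thesis
    by (simp add: Poly_Mapping.lookup_add scale_left_distrib sum.distrib)
qed

lemma glin_fscale: "glin scale g (fscale c x) = scale c (glin scale g x)"
proof -
  have "glin scale g (fscale c x) =
      (\<Sum>a\<in>Poly_Mapping.keys x. scale (Poly_Mapping.lookup (fscale c x) a) (g a))"
    by (intro glin_superset) (auto simp: in_keys_iff)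
  then show ?thesis by (simp add: glin_def scale_sum_right)
qed

lemma module_hom_glin: "module_hom fscale scale (glin scale g)"
  by unfold_locales (auto simp: glin_add glin_fscale fs.scale_right_distrib fs.scale_left_distrib
      scale_right_distrib scale_left_distrib)

lemma glin_zero [simp]: "glin scale g 0 = 0"
  by (simp add: glin_def)

lemma glin_gen [simp]: "glin scale g (gen a) = g a"
  by (simp add: glin_def gen_def)

lemma glin_diff: "glin scale g (x - y) = glin scale g x - glin scale g y"
  by (metis add_diff_cancel_right' diff_add_cancel glin_add)

lemma glin_minus: "glin scale g (- x) = - glin scale g x"
  using glin_diff[of g 0 x] by simp

lemma glin_sum: "glin scale g (sum h S) = (\<Sum>i\<in>S. glin scale g (h i))"
  by (induction S rule: infinite_finite_induct) (auto simp: glin_add)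

end

lemma lin_ext_eq_glin: "lin_ext g = glin fscale g"
  by (simp add: lin_ext_def glin_def fun_eq_iff)

lemma lin_ext_gen [simp]: "lin_ext g (gen a) = g a"
  and lin_ext_zero [simp]: "lin_ext g 0 = 0"
  and lin_ext_add: "lin_ext g (x + y) = lin_ext g x + lin_ext g y"
  and lin_ext_diff: "lin_ext g (x - y) = lin_ext g x - lin_ext g y"
  and lin_ext_minus: "lin_ext g (- x) = - lin_ext g x"
  and lin_ext_fscale: "lin_ext g (fscale c x) = fscale c (lin_ext g x)"
  and lin_ext_sum: "lin_ext g (sum h S) = (\<Sum>i\<in>S. lin_ext g (h i))"
  and module_hom_lin_ext: "module_hom fscale fscale (lin_ext g)"
  unfolding lin_ext_eq_glin
  by (auto simp: fs.glin_add fs.glin_diff fs.glin_minus fs.glin_fscale fs.glin_sum fs.module_hom_glin)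

lemma free_expand: "x = (\<Sum>a\<in>Poly_Mapping.keys x. fscale (Poly_Mapping.lookup x a) (gen a))"
  by (rule poly_mapping_eqI)
    (auto simp: Poly_Mapping.lookup_sum gen_def lookup_single when_def if_distrib in_keys_iff
      cong: if_cong)

lemma mem_fspan_gen: "x \<in> fspan (gen ` A) \<longleftrightarrow> Poly_Mapping.keys x \<subseteq> A"
proof
  assume "x \<in> fspan (gen ` A)"
  then show "Poly_Mapping.keys x \<subseteq> A"
  proof (induction rule: fs.span_induct_alt)
    case (step c x y)
    then obtain a where "a \<in> A" "x = gen a" by auto
    moreover have "Poly_Mapping.keys (fscale c x) \<subseteq> Poly_Mapping.keys x"
      by (auto simp: in_keys_iff)
    ultimately show ?case
      using step.IH Poly_Mapping.keys_add[of "fscale c x" y] by (auto simp: gen_def)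
  qed simp
next
  assume "Poly_Mapping.keys x \<subseteq> A"
  then show "x \<in> fspan (gen ` A)"
    by (subst free_expand)
      (intro fs.span_sum fs.span_scale fs.span_base, auto)
qed

lemma fspan_gen_induct [consumes 1, case_names zero gen add scale]:
  assumes "x \<in> fspan (gen ` A)"
    and "P 0" and "\<And>a. a \<in> A \<Longrightarrow> P (gen a)"
    and "\<And>x y. P x \<Longrightarrow> P y \<Longrightarrow> P (x + y)" and "\<And>c x. P x \<Longrightarrow> P (fscale c x)"
  shows "P x"
  using assms(1)
  by (induction rule: fs.span_induct_alt) (use assms(2-) in auto)

lemma free_eq_fspan: "x \<in> fspan (range gen)"
  by (simp add: mem_fspan_gen)

lemma free_induct [case_names zero gen add scale]:
  assumes "P 0" and "\<And>a. P (gen a)"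
    and "\<And>x y. P x \<Longrightarrow> P y \<Longrightarrow> P (x + y)" and "\<And>c x. P x \<Longrightarrow> P (fscale c x)"
  shows "P x"
  using free_eq_fspan[of x] by (induction rule: fspan_gen_induct) (use assms in auto)

lemma lin_ext_comp: "lin_ext g (lin_ext h x) = lin_ext (\<lambda>a. lin_ext g (h a)) x"
  by (induction x rule: free_induct) (auto simp: lin_ext_add lin_ext_fscale)

lemma lin_ext_cong:
  assumes "\<And>a. a \<in> Poly_Mapping.keys x \<Longrightarrow> g a = h a"
  shows "lin_ext g x = lin_ext h x"
  using assms by (simp add: lin_ext_def)

lemma lin_ext_fun_add: "lin_ext (\<lambda>a. g a + h a) x = lin_ext g x + lin_ext h x"
  and lin_ext_fun_diff: "lin_ext (\<lambda>a. g a - h a) x = lin_ext g x - lin_ext h x"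
  and lin_ext_fun_fscale: "lin_ext (\<lambda>a. fscale c (g a)) x = fscale c (lin_ext g x)"
  and lin_ext_fun_zero [simp]: "lin_ext (\<lambda>a. 0) x = 0"
  by (simp_all add: lin_ext_def fs.scale_right_distrib fs.scale_right_diff_distrib sum.distrib
      sum_subtractf fs.scale_sum_right mult.commute)

lemma tens_add_left: "tens (x + x') y = tens x y + tens x' y"
  and tens_diff_left: "tens (x - x') y = tens x y - tens x' y"
  and tens_scale_left: "tens (fscale c x) y = fscale c (tens x y)"
  and tens_minus_left: "tens (- x) y = - tens x y"
  and tens_sum_left: "tens (sum f S) y = (\<Sum>i\<in>S. tens (f i) y)"
  and tens_zero_left [simp]: "tens 0 y = 0"
  by (simp_all add: tens_def lin_ext_add lin_ext_fscale lin_ext_diff lin_ext_minus lin_ext_sum)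

lemma tens_add_right: "tens x (y + y') = tens x y + tens x y'"
  and tens_diff_right: "tens x (y - y') = tens x y - tens x y'"
  and tens_scale_right: "tens x (fscale c y) = fscale c (tens x y)"
  and tens_zero_right [simp]: "tens x 0 = 0"
  by (simp_all add: tens_def lin_ext_add lin_ext_fscale lin_ext_diff lin_ext_fun_add
      lin_ext_fun_fscale lin_ext_fun_diff)

lemma tens_minus_right: "tens x (- y) = - tens x y"
  using tens_diff_right[of x 0 y] by simp

lemma tens_sum_right: "tens x (sum f S) = (\<Sum>i\<in>S. tens x (f i))"
  by (induction S rule: infinite_finite_induct) (auto simp: tens_add_right)

lemma tens_gen [simp]: "tens (gen a) (gen b) = gen (a, b)"
  by (simp add: tens_def)

lemma lin_ext_tens:
  "lin_ext h (tens x y) = lin_ext (\<lambda>a. lin_ext (\<lambda>b. h (a, b)) y) x"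
  by (simp add: tens_def lin_ext_comp)

lemma lin_ext_tens_tens:
  "lin_ext (\<lambda>(a, b). tens (g a) (h b)) (tens x y) = tens (lin_ext g x) (lin_ext h y)"
proof (induction x rule: free_induct)
  case (gen a)
  show ?case
    by (induction y rule: free_induct)
      (auto simp: tens_add_right tens_scale_right lin_ext_add lin_ext_fscale)
qed (auto simp: tens_add_left tens_scale_left lin_ext_add lin_ext_fscale)

section \<open>Signs\<close>

type_synonym 'v word = "(int \<times> 'v) list"

text \<open>Signs act on abelian groups instead of being scalars, so that a sign identity becomes a
  statement about the parity of integers and is the same in every space.\<close>

definition sg :: "int \<Rightarrow> 'a::ab_group_add \<Rightarrow> 'a" where
  "sg n x = (if even n then x else - x)"

lemma sg_0 [simp]: "sg 0 x = x"
  and sg_zero [simp]: "sg n 0 = 0"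
  and sg_add: "sg n (x + y) = sg n x + sg n y"
  and sg_diff: "sg n (x - y) = sg n x - sg n y"
  and sg_self [simp]: "sg n (sg n x) = x"
  and sg_sg: "sg m (sg n x) = sg (m + n) x"
  by (auto simp: sg_def)

lemma sg_eqI: "(even m \<longleftrightarrow> even n) \<Longrightarrow> x = y \<Longrightarrow> sg m x = sg n y"
  by (simp add: sg_def)

lemma sgn_pow_eq: "sgn_pow n = (if even n then 1 else - 1 :: 'k::field)"
  by (simp add: sgn_pow_def power_int_minus_left)

lemma (in vector_space) scale_sgn_pow: "scale (sgn_pow n) x = sg n x"
  by (simp add: sgn_pow_eq sg_def)

lemma (in vector_space) scale_sg: "scale c (sg n x) = sg n (scale c x)"
  by (simp add: sg_def)

lemma lin_ext_sg: "lin_ext g (sg n x) = sg n (lin_ext g x)"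
  by (simp add: sg_def lin_ext_minus)

lemma tens_sg_left: "tens (sg n x) y = sg n (tens x y)"
  by (simp add: sg_def tens_minus_left)

lemma (in module) subspace_sg: "subspace N \<Longrightarrow> x \<in> N \<Longrightarrow> sg n x \<in> N"
  by (simp add: sg_def subspace_neg)

section \<open>Unshuffles\<close>

text \<open>The signed sum of \<open>g a b\<close> over all unshuffles of \<open>w\<close> into two possibly empty words.\<close>

fun cosum :: "'v word \<Rightarrow> ('v word \<Rightarrow> 'v word \<Rightarrow> 'x::ab_group_add) \<Rightarrow> 'x"
  where
  "cosum [] g = g [] []"
| "cosum (z # w) g = cosum w (\<lambda>a b. g (z # a) b + sg (fst z * wdeg a) (g a (z # b)))"

lemma wdeg_simps [simp]:
  "wdeg [] = 0" "wdeg (z # w) = fst z + wdeg w" "wdeg (a @ b) = wdeg a + wdeg b"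
  by (simp_all add: wdeg_def)

text \<open>An unshuffle preserves total degree, total length and the set of letters. Nothing else
  about the two halves is used later: degrees settle signs, lengths drive inductions, letters give
  membership in the graded pieces.\<close>

lemma cosum_cong:
  assumes "\<And>a b. wdeg a + wdeg b = wdeg w \<Longrightarrow> length a + length b = length w \<Longrightarrow>
    set a \<union> set b = set w \<Longrightarrow> g a b = h a b"
  shows "cosum w g = cosum w h"
  using assms
proof (induction w arbitrary: g h)
  case (Cons z w)
  show ?case
    unfolding cosum.simps
  proof (rule Cons.IH)
    fix a b assume ab: "wdeg a + wdeg b = wdeg w" "length a + length b = length w"
      "set a \<union> set b = set w"
    have "g (z # a) b = h (z # a) b" by (rule Cons.prems) (use ab in auto)
    moreover have "g a (z # b) = h a (z # b)" by (rule Cons.prems) (use ab in auto)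
    ultimately show "g (z # a) b + sg (fst z * wdeg a) (g a (z # b)) =
        h (z # a) b + sg (fst z * wdeg a) (h a (z # b))" by simp
  qed
qed simp

lemma cosum_hom:
  assumes "\<And>x y. \<Phi> (x + y) = \<Phi> x + \<Phi> y"
  shows "\<Phi> (cosum w g) = cosum w (\<lambda>a b. \<Phi> (g a b))"
proof -
  have "\<Phi> 0 = 0" using assms[of 0 0] by simp
  then have "\<Phi> (- x) = - \<Phi> x" for x using assms[of x "- x"] by (simp add: eq_neg_iff_add_eq_0 add.commute)
  then have "\<Phi> (sg n x) = sg n (\<Phi> x)" for n x by (simp add: sg_def)
  then show ?thesis by (induction w arbitrary: g) (simp_all add: assms)
qed

lemma cosum_add: "cosum w (\<lambda>a b. g a b + h a b) = cosum w g + cosum w h"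
proof (induction w arbitrary: g h)
  case (Cons z w)
  have "cosum (z # w) (\<lambda>a b. g a b + h a b) = cosum w (\<lambda>a b. (g (z # a) b + sg (fst z * wdeg a) (g a (z # b)))
      + (h (z # a) b + sg (fst z * wdeg a) (h a (z # b))))"
    by (simp add: sg_add algebra_simps)
  then show ?case by (simp only: Cons.IH cosum.simps)
qed simp

lemma cosum_zero [simp]: "cosum w (\<lambda>a b. 0) = 0"
  by (induction w) auto

lemma cosum_minus: "cosum w (\<lambda>a b. - g a b) = - cosum w g"
  by (simp add: cosum_hom[of uminus])

lemma cosum_diff: "cosum w (\<lambda>a b. g a b - h a b) = cosum w g - cosum w h"
  using cosum_add[of w g "\<lambda>a b. - h a b"] by (simp add: cosum_minus)

lemma cosum_sg: "cosum w (\<lambda>a b. sg n (g a b)) = sg n (cosum w g)"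
  by (simp add: cosum_hom[of "sg n"] sg_add)

lemma cosum_sum: "cosum w (\<lambda>a b. \<Sum>i\<in>S. g i a b) = (\<Sum>i\<in>S. cosum w (g i))"
  by (induction S rule: infinite_finite_induct) (auto simp: cosum_add)

lemma (in module) cosum_mem:
  assumes "subspace N"
    and "\<And>a b. wdeg a + wdeg b = wdeg w \<Longrightarrow> length a + length b = length w \<Longrightarrow>
      set a \<union> set b = set w \<Longrightarrow> g a b \<in> N"
  shows "cosum w g \<in> N"
  using assms(2)
proof (induction w arbitrary: g)
  case (Cons z w)
  show ?case
    unfolding cosum.simps
  proof (rule Cons.IH)
    fix a b assume ab: "wdeg a + wdeg b = wdeg w" "length a + length b = length w"
      "set a \<union> set b = set w"
    have "g (z # a) b \<in> N" by (rule Cons.prems) (use ab in auto)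
    moreover have "g a (z # b) \<in> N" by (rule Cons.prems) (use ab in auto)
    ultimately show "g (z # a) b + sg (fst z * wdeg a) (g a (z # b)) \<in> N"
      using assms(1) by (simp add: subspace_add subspace_sg)
  qed
qed simp

lemma (in module) cosum_cong_mod:
  assumes "subspace N"
    and "\<And>a b. wdeg a + wdeg b = wdeg w \<Longrightarrow> length a + length b = length w \<Longrightarrow>
      set a \<union> set b = set w \<Longrightarrow> g a b - h a b \<in> N"
  shows "cosum w g - cosum w h \<in> N"
  unfolding cosum_diff[symmetric] using assms by (rule cosum_mem)

lemma cosum_map:
  assumes "\<And>z. fst (\<phi> z) = fst z"
  shows "cosum (map \<phi> w) g = cosum w (\<lambda>a b. g (map \<phi> a) (map \<phi> b))"
proof (induction w arbitrary: g)
  case (Cons z w)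
  have "wdeg (map \<phi> a) = wdeg a" for a by (simp add: wdeg_def comp_def assms)
  then show ?case by (simp add: Cons.IH assms)
qed simp

text \<open>Both sides sum over unshuffles into three words. In the induction the leading letter
  goes to one of three places; \<open>?g\<close> collects these placements with their signs, and it
  is the same expression for either bracketing.\<close>

lemma cosum_coassoc:
  fixes w :: "'v word"
  shows
  "cosum w (\<lambda>a b. cosum a (\<lambda>c d. g c d b)) = cosum w (\<lambda>a b. cosum b (\<lambda>c d. g a c d))"
proof (induction w arbitrary: g)
  case (Cons z w)
  let ?g = "\<lambda>c d b. g (z # c) d b + sg (fst z * wdeg c) (g c (z # d) b)
     + sg (fst z * (wdeg c + wdeg d)) (g c d (z # b))"
  have "cosum (z # w) (\<lambda>a b. cosum a (\<lambda>c d. g c d b)) = cosum w (\<lambda>a b. cosum a (\<lambda>c d. ?g c d b))"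
    unfolding cosum.simps
  proof (rule cosum_cong)
    fix a b :: "'v word"
    have "sg (fst z * wdeg a) (cosum a (\<lambda>c d. g c d (z # b))) =
        cosum a (\<lambda>c d. sg (fst z * (wdeg c + wdeg d)) (g c d (z # b)))"
      unfolding cosum_sg[symmetric] by (rule cosum_cong) simp
    then show "cosum a (\<lambda>aa ba. g (z # aa) ba b + sg (fst z * wdeg aa) (g aa (z # ba) b)) +
       sg (fst z * wdeg a) (cosum a (\<lambda>c d. g c d (z # b))) = cosum a (\<lambda>c d. ?g c d b)"
      by (simp add: cosum_add)
  qed
  also have "\<dots> = cosum w (\<lambda>a b. cosum b (\<lambda>c d. ?g a c d))"
    by (rule Cons.IH)
  also have "\<dots> = cosum (z # w) (\<lambda>a b. cosum b (\<lambda>c d. g a c d))"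
    unfolding cosum.simps
    by (rule cosum_cong)
       (simp flip: cosum_add cosum_sg add: sg_sg sg_add algebra_simps)
  finally show ?case .
qed simp

text \<open>Exchanging the halves exchanges the two places of the leading letter; the sign for
  moving it past the left half is absorbed by the change in \<open>wdeg a * wdeg b\<close>.\<close>

lemma cosum_cocomm: "cosum w (\<lambda>a b. sg (wdeg a * wdeg b) (g b a)) = cosum w g"
proof (induction w arbitrary: g)
  case (Cons z w)
  have "cosum (z # w) (\<lambda>a b. sg (wdeg a * wdeg b) (g b a)) =
     cosum w (\<lambda>a b. sg (wdeg a * wdeg b) (sg (fst z * wdeg b) (g b (z # a)) + g (z # b) a))"
    unfolding cosum.simps
    by (intro cosum_cong) (auto simp: sg_add sg_sg algebra_simps intro!: arg_cong2[where f="(+)"] sg_eqI)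
  also have "\<dots> = cosum w (\<lambda>a b. sg (fst z * wdeg a) (g a (z # b)) + g (z # a) b)"
    by (rule Cons.IH)
  finally show ?case by (simp add: add.commute)
qed simp

lemma cosum_counit_right:
  "cosum w (\<lambda>a b. if b = [] then h a else 0) = h w"
  by (induction w arbitrary: h) auto

lemma cosum_counit_left:
  "cosum w (\<lambda>a b. if a = [] then h b else 0) = h w"
proof (induction w arbitrary: h)
  case (Cons z w)
  have "cosum (z # w) (\<lambda>a b. if a = [] then h b else 0)
     = cosum w (\<lambda>a b. if a = [] then h (z # b) else 0)"
    unfolding cosum.simps by (rule cosum_cong) simp
  then show ?case by (simp add: Cons.IH)
qed simp

section \<open>Multilinear graded symmetric functions modulo a subspace\<close>

definition awords :: "('k, 'v) gvs \<Rightarrow> 'v word set" where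
  "awords V = {xs. \<forall>(i, x)\<in>set xs. x \<in> gcomp V i}"

abbreviation aspan :: "('k::field, 'v) gvs \<Rightarrow> ('v word \<Rightarrow>\<^sub>0 'k) set" where
  "aspan V \<equiv> fspan (gen ` awords V)"

lemma awords_Nil [simp]: "[] \<in> awords V"
  and awords_Cons [simp]: "z # xs \<in> awords V \<longleftrightarrow> snd z \<in> gcomp V (fst z) \<and> xs \<in> awords V"
  and awords_append [simp]: "xs @ ys \<in> awords V \<longleftrightarrow> xs \<in> awords V \<and> ys \<in> awords V"
  by (auto simp: awords_def)

lemma words_iff: "xs \<in> words V \<longleftrightarrow> xs \<noteq> [] \<and> xs \<in> awords V"
  by (auto simp: words_def awords_def)

lemma is_gvsD:
  assumes "is_gvs V"
  shows "vector_space (gscale V)" "0 \<in> gcomp V i"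
    "x \<in> gcomp V i \<Longrightarrow> y \<in> gcomp V i \<Longrightarrow> x + y \<in> gcomp V i"
    "x \<in> gcomp V i \<Longrightarrow> gscale V c x \<in> gcomp V i"
    "module.subspace (gscale V) (gcomp V i)"
proof -
  show vs: "vector_space (gscale V)" using assms by (simp add: is_gvs_def)
  interpret vector_space "gscale V" by (fact vs)
  have "subspace (gcomp V i)" using assms by (simp add: is_gvs_def)
  then show "subspace (gcomp V i)" "0 \<in> gcomp V i"
    "x \<in> gcomp V i \<Longrightarrow> y \<in> gcomp V i \<Longrightarrow> x + y \<in> gcomp V i"
    "x \<in> gcomp V i \<Longrightarrow> gscale V c x \<in> gcomp V i"
    by (auto simp: subspace_def)
qed

text \<open>This is the condition under which the linear extension of \<open>g\<close> descends to
  the symmetric coalgebra, with target taken modulo \<open>N\<close>. Typical choices are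
  \<open>N = sym_null W\<close> for maps of coalgebras and \<open>N = {0}\<close> for
  components.\<close>

definition sym_mod ::
  "('k::field, 'v::ab_group_add) gvs \<Rightarrow> ('k \<Rightarrow> 'x::ab_group_add \<Rightarrow> 'x) \<Rightarrow> 'x set \<Rightarrow>
   ('v word \<Rightarrow> 'x) \<Rightarrow> bool" where
  "sym_mod V s N g \<longleftrightarrow>
     (\<forall>xs i x y ys. xs @ (i, x) # ys \<in> awords V \<longrightarrow> y \<in> gcomp V i \<longrightarrow>
        g (xs @ (i, x + y) # ys) - g (xs @ (i, x) # ys) - g (xs @ (i, y) # ys) \<in> N) \<and>
     (\<forall>xs i c x ys. xs @ (i, x) # ys \<in> awords V \<longrightarrow>
        g (xs @ (i, gscale V c x) # ys) - s c (g (xs @ (i, x) # ys)) \<in> N) \<and>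
     (\<forall>xs i x j y ys. xs @ (i, x) # (j, y) # ys \<in> awords V \<longrightarrow>
        g (xs @ (i, x) # (j, y) # ys) - sg (i * j) (g (xs @ (j, y) # (i, x) # ys)) \<in> N)"

lemma sym_modI:
  assumes "\<And>xs i x y ys. xs \<in> awords V \<Longrightarrow> ys \<in> awords V \<Longrightarrow> x \<in> gcomp V i \<Longrightarrow> y \<in> gcomp V i \<Longrightarrow>
      g (xs @ (i, x + y) # ys) - g (xs @ (i, x) # ys) - g (xs @ (i, y) # ys) \<in> N"
    and "\<And>xs i c x ys. xs \<in> awords V \<Longrightarrow> ys \<in> awords V \<Longrightarrow> x \<in> gcomp V i \<Longrightarrow>
      g (xs @ (i, gscale V c x) # ys) - s c (g (xs @ (i, x) # ys)) \<in> N"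
    and "\<And>xs i x j y ys. xs \<in> awords V \<Longrightarrow> ys \<in> awords V \<Longrightarrow> x \<in> gcomp V i \<Longrightarrow> y \<in> gcomp V j \<Longrightarrow>
      g (xs @ (i, x) # (j, y) # ys) - sg (i * j) (g (xs @ (j, y) # (i, x) # ys)) \<in> N"
  shows "sym_mod V s N g"
  using assms by (auto simp: sym_mod_def)

lemma sym_modD:
  assumes "sym_mod V s N g" "xs \<in> awords V" "ys \<in> awords V" "x \<in> gcomp V i"
  shows "y \<in> gcomp V i \<Longrightarrow>
      g (xs @ (i, x + y) # ys) - g (xs @ (i, x) # ys) - g (xs @ (i, y) # ys) \<in> N"
    and "g (xs @ (i, gscale V c x) # ys) - s c (g (xs @ (i, x) # ys)) \<in> N"
    and "y \<in> gcomp V j \<Longrightarrow>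
      g (xs @ (i, x) # (j, y) # ys) - sg (i * j) (g (xs @ (j, y) # (i, x) # ys)) \<in> N"
  using assms by (auto simp: sym_mod_def)

lemma sym_mod_gen: "sym_mod V fscale (sym_null V) gen"
  unfolding sym_null_def
  apply (rule sym_modI; rule fs.span_base)
  subgoal by (rule UnI1, rule UnI1) (simp add: words_iff, blast)
  subgoal by (rule UnI1, rule UnI2) (simp add: words_iff, blast)
  subgoal by (rule UnI2) (simp add: words_iff fs.scale_sgn_pow[symmetric], blast)
  done

lemma subspace_sym_null [simp]: "fs.subspace (sym_null V)"
  by (simp add: sym_null_def fs.subspace_span)

lemma sym_mod_Cons:
  assumes "sym_mod V s N g" "snd z \<in> gcomp V (fst z)"
  shows "sym_mod V s N (\<lambda>w. g (z # w))"
proof (rule sym_modI, goal_cases)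
  case (1 xs) then show ?case using sym_modD(1)[OF assms(1), of "z # xs"] assms(2) by simp
next
  case (2 xs) then show ?case using sym_modD(2)[OF assms(1), of "z # xs"] assms(2) by simp
next
  case (3 xs) then show ?case using sym_modD(3)[OF assms(1), of "z # xs"] assms(2) by simp
qed

lemma sym_mod_comp:
  assumes g: "sym_mod V s N g" and "module_hom s s' \<Phi>" and N: "\<And>x. x \<in> N \<Longrightarrow> \<Phi> x \<in> N'"
  shows "sym_mod V s' N' (\<lambda>w. \<Phi> (g w))"
proof -
  interpret \<Phi>: module_hom s s' \<Phi> by fact
  have sg: "\<Phi> (sg n x) = sg n (\<Phi> x)" for n x by (simp add: sg_def \<Phi>.neg)
  show ?thesis
    by (rule sym_modI)
      (simp_all flip: \<Phi>.diff \<Phi>.scale sg add: N sym_modD[OF g])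
qed

text \<open>Each relation compares words of one and the same length, so \<open>g\<close> may depend
  on that length in an arbitrary way.\<close>

lemma sym_mod_by_length:
  assumes "\<And>n. sym_mod V s N (g n)"
  shows "sym_mod V s N (\<lambda>w. g (length w) w)"
  by (rule sym_modI) (simp_all add: sym_modD[OF assms])

lemma sym_mod_by_wdeg:
  assumes "\<And>n. sym_mod V s N (g n)"
  shows "sym_mod V s N (\<lambda>w. g (wdeg w) w)"
  by (rule sym_modI) (simp_all add: sym_modD[OF assms] add.left_commute)

context vector_space
begin

lemma sym_mod_zero: "subspace N \<Longrightarrow> sym_mod V scale N (\<lambda>w. 0)"
  by (rule sym_modI) (auto simp: subspace_0)

lemma sym_mod_add:
  assumes N: "subspace N" and g: "sym_mod V scale N g" and h: "sym_mod V scale N h"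
  shows "sym_mod V scale N (\<lambda>w. g w + h w)"
proof (rule sym_modI, goal_cases)
  case 1
  from subspace_add[OF N sym_modD(1)[OF g 1] sym_modD(1)[OF h 1]] show ?case
    by (simp add: algebra_simps)
next
  case (2 xs i c x ys)
  from subspace_add[OF N sym_modD(2)[OF g 2, of c] sym_modD(2)[OF h 2, of c]] show ?case
    by (simp add: algebra_simps)
next
  case 3
  from subspace_add[OF N sym_modD(3)[OF g 3] sym_modD(3)[OF h 3]] show ?case
    by (simp add: algebra_simps sg_add)
qed

lemma sym_mod_scale:
  assumes N: "subspace N" and g: "sym_mod V scale N g"
  shows "sym_mod V scale N (\<lambda>w. scale c (g w))"
  by (rule sym_mod_comp[OF g])
    (unfold_locales, auto simp: scale_right_distrib scale_left_distrib subspace_scale[OF N] mult.commute)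

lemma sym_mod_sum:
  assumes N: "subspace N" and g: "\<And>i. i \<in> S \<Longrightarrow> sym_mod V scale N (g i)"
  shows "sym_mod V scale N (\<lambda>w. \<Sum>i\<in>S. g i w)"
  using g by (induction S rule: infinite_finite_induct) (auto simp: sym_mod_zero N sym_mod_add)

lemma sym_mod_sg_wdeg:
  assumes "subspace N" "sym_mod V scale N g"
  shows "sym_mod V scale N (\<lambda>w. sg (k * wdeg w) (g w))"
proof (rule sym_mod_by_wdeg)
  show "sym_mod V scale N (\<lambda>w. sg (k * n) (g w))" for n
    using sym_mod_scale[OF assms, of "sgn_pow (k * n)"] by (simp add: scale_sgn_pow)
qed

lemma sym_mod_length_scale:
  "subspace N \<Longrightarrow> sym_mod V scale N g \<Longrightarrow> sym_mod V scale N (\<lambda>w. scale (f (length w)) (g w))"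
  using sym_mod_by_length[of V scale N "\<lambda>n w. scale (f n) (g w)"] sym_mod_scale by blast

text \<open>This is well-definedness of the coproduct on the quotient: symmetry in each half
  separately yields symmetry in the whole word.\<close>

lemma sym_mod_cosum:
  assumes N: "subspace N"
    and left: "\<And>b. b \<in> awords V \<Longrightarrow> sym_mod V scale N (\<lambda>a. g a b)"
    and right: "\<And>a. a \<in> awords V \<Longrightarrow> sym_mod V scale N (g a)"
  shows "sym_mod V scale N (\<lambda>w. cosum w g)"
proof -
  \<comment> \<open>Distributing a leading letter preserves the hypotheses on \<open>g\<close>. An
    induction on the prefix \<open>xs\<close> thus reduces every relation to one at the front of the
    word.\<close>
  have step: "(\<forall>b\<in>awords V. sym_mod V scale N (\<lambda>a. g' (z # a) b + sg (fst z * wdeg a) (g' a (z # b)))) \<and>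
      (\<forall>a\<in>awords V. sym_mod V scale N (\<lambda>b. g' (z # a) b + sg (fst z * wdeg a) (g' a (z # b))))"
    if "\<And>b. b \<in> awords V \<Longrightarrow> sym_mod V scale N (\<lambda>a. g' a b)"
      "\<And>a. a \<in> awords V \<Longrightarrow> sym_mod V scale N (g' a)" "snd z \<in> gcomp V (fst z)"
    for g' :: "'c word \<Rightarrow> 'c word \<Rightarrow> 'b" and z
  proof (intro conjI ballI)
    fix b assume b: "b \<in> awords V"
    show "sym_mod V scale N (\<lambda>a. g' (z # a) b + sg (fst z * wdeg a) (g' a (z # b)))"
      by (intro sym_mod_add N sym_mod_sg_wdeg sym_mod_Cons[where g="\<lambda>w. g' w b"] that(1))
        (use b that(3) in auto)
  next
    fix a assume a: "a \<in> awords V"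
    have 1: "sym_mod V scale N (g' (z # a))"
      by (rule that(2)) (use a that(3) in simp)
    have 2: "sym_mod V scale N (\<lambda>b. g' a (z # b))"
      by (rule sym_mod_Cons[OF that(2)[OF a] that(3)])
    have "sym_mod V scale N (\<lambda>b. scale (sgn_pow (fst z * wdeg a)) (g' a (z # b)))"
      by (rule sym_mod_scale[OF N 2])
    then show "sym_mod V scale N (\<lambda>b. g' (z # a) b + sg (fst z * wdeg a) (g' a (z # b)))"
      unfolding scale_sgn_pow by (rule sym_mod_add[OF N 1])
  qed
  let ?bi = "\<lambda>g. (\<forall>b\<in>awords V. sym_mod V scale N (\<lambda>a. g a b)) \<and> (\<forall>a\<in>awords V. sym_mod V scale N (g a))"
  show ?thesis
  proof (rule sym_modI)
    fix xs i x y ys assume *: "xs \<in> awords V" "ys \<in> awords V" "x \<in> gcomp V i" "y \<in> gcomp V i"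
    have "?bi g" using left right by blast
    with *(1) show "cosum (xs @ (i, x + y) # ys) g - cosum (xs @ (i, x) # ys) g - cosum (xs @ (i, y) # ys) g \<in> N"
    proof (induction xs arbitrary: g)
      case Nil
      have "cosum ys (\<lambda>a b. (g ((i, x + y) # a) b - g ((i, x) # a) b - g ((i, y) # a) b)
          + sg (i * wdeg a) (g a ((i, x + y) # b) - g a ((i, x) # b) - g a ((i, y) # b))) \<in> N"
      proof (rule cosum_mem[OF N], intro subspace_add subspace_sg N)
        fix a b assume "set a \<union> set b = set ys"
        then have ab: "a \<in> awords V" "b \<in> awords V" using *(2) by (auto simp: awords_def)
        have "sym_mod V scale N (\<lambda>a. g a b)" "sym_mod V scale N (g a)" using Nil(2) ab by auto
        from sym_modD(1)[OF this(1) awords_Nil ab(1) *(3,4)] sym_modD(1)[OF this(2) awords_Nil ab(2) *(3,4)]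
        show "g ((i, x + y) # a) b - g ((i, x) # a) b - g ((i, y) # a) b \<in> N"
          "g a ((i, x + y) # b) - g a ((i, x) # b) - g a ((i, y) # b) \<in> N" by auto
      qed
      also have "cosum ys (\<lambda>a b. (g ((i, x + y) # a) b - g ((i, x) # a) b - g ((i, y) # a) b)
          + sg (i * wdeg a) (g a ((i, x + y) # b) - g a ((i, x) # b) - g a ((i, y) # b))) =
        cosum ([] @ (i, x + y) # ys) g - cosum ([] @ (i, x) # ys) g - cosum ([] @ (i, y) # ys) g"
        unfolding append_Nil cosum.simps cosum_diff[symmetric]
        by (rule cosum_cong) (auto simp: sg_def)
      finally show ?case .
    next
      case (Cons z xs)
      have "xs \<in> awords V" "snd z \<in> gcomp V (fst z)" using Cons.prems(1) by auto
      with Cons.IH[OF this(1) step[of g z]] Cons.prems(2) show ?case by simp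
    qed
  next
    fix xs i x c ys assume *: "xs \<in> awords V" "ys \<in> awords V" "x \<in> gcomp V i"
    have "?bi g" using left right by blast
    with *(1) show "cosum (xs @ (i, gscale V c x) # ys) g - scale c (cosum (xs @ (i, x) # ys) g) \<in> N"
    proof (induction xs arbitrary: g)
      case Nil
      have "cosum ys (\<lambda>a b. (g ((i, gscale V c x) # a) b - scale c (g ((i, x) # a) b))
          + sg (i * wdeg a) (g a ((i, gscale V c x) # b) - scale c (g a ((i, x) # b)))) \<in> N"
      proof (rule cosum_mem[OF N], intro subspace_add subspace_sg N)
        fix a b assume "set a \<union> set b = set ys"
        then have ab: "a \<in> awords V" "b \<in> awords V" using *(2) by (auto simp: awords_def)
        have "sym_mod V scale N (\<lambda>a. g a b)" "sym_mod V scale N (g a)" using Nil(2) ab by auto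
        from sym_modD(2)[OF this(1) awords_Nil ab(1) *(3)] sym_modD(2)[OF this(2) awords_Nil ab(2) *(3)]
        show "g ((i, gscale V c x) # a) b - scale c (g ((i, x) # a) b) \<in> N"
          "g a ((i, gscale V c x) # b) - scale c (g a ((i, x) # b)) \<in> N" by auto
      qed
      also have "cosum ys (\<lambda>a b. (g ((i, gscale V c x) # a) b - scale c (g ((i, x) # a) b))
          + sg (i * wdeg a) (g a ((i, gscale V c x) # b) - scale c (g a ((i, x) # b)))) =
        cosum ([] @ (i, gscale V c x) # ys) g - scale c (cosum ([] @ (i, x) # ys) g)"
        unfolding append_Nil cosum.simps cosum_diff[symmetric]
          cosum_hom[where \<Phi>="scale c", OF scale_right_distrib]
        by (rule cosum_cong) (auto simp: sg_def scale_right_distrib)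
      finally show ?case .
    next
      case (Cons z xs)
      have "xs \<in> awords V" "snd z \<in> gcomp V (fst z)" using Cons.prems(1) by auto
      with Cons.IH[OF this(1) step[of g z]] Cons.prems(2) show ?case by simp
    qed
  next
    fix xs i x j y ys assume *: "xs \<in> awords V" "ys \<in> awords V" "x \<in> gcomp V i" "y \<in> gcomp V j"
    have "?bi g" using left right by blast
    with *(1) show "cosum (xs @ (i, x) # (j, y) # ys) g - sg (i * j) (cosum (xs @ (j, y) # (i, x) # ys) g) \<in> N"
    proof (induction xs arbitrary: g)
      case Nil
      \<comment> \<open>Only the terms with both letters in the same half need the relations of
        \<open>g\<close>; the terms that separate the two letters cancel exactly, because their
        signs differ by \<open>i * j\<close>.\<close>
      let ?l = "\<lambda>a b. g ((i, x) # (j, y) # a) b - sg (i * j) (g ((j, y) # (i, x) # a) b)"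
      let ?r = "\<lambda>a b. g a ((i, x) # (j, y) # b) - sg (i * j) (g a ((j, y) # (i, x) # b))"
      have "cosum ys (\<lambda>a b. ?l a b + sg ((i + j) * wdeg a) (?r a b)) \<in> N"
      proof (rule cosum_mem[OF N], intro subspace_add subspace_sg N)
        fix a b assume "set a \<union> set b = set ys"
        then have ab: "a \<in> awords V" "b \<in> awords V" using *(2) by (auto simp: awords_def)
        have "sym_mod V scale N (\<lambda>a. g a b)" "sym_mod V scale N (g a)" using Nil(2) ab by auto
        from sym_modD(3)[OF this(1) awords_Nil ab(1) *(3,4)] sym_modD(3)[OF this(2) awords_Nil ab(2) *(3,4)]
        show "?l a b \<in> N" "?r a b \<in> N" by auto
      qed
      also have "cosum ys (\<lambda>a b. ?l a b + sg ((i + j) * wdeg a) (?r a b)) =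
        cosum ([] @ (i, x) # (j, y) # ys) g - sg (i * j) (cosum ([] @ (j, y) # (i, x) # ys) g)"
        unfolding append_Nil cosum.simps cosum_sg[symmetric] cosum_diff[symmetric]
        by (rule cosum_cong) (auto simp: sg_def algebra_simps)
      finally show ?case .
    next
      case (Cons z xs)
      have "xs \<in> awords V" "snd z \<in> gcomp V (fst z)" using Cons.prems(1) by auto
      with Cons.IH[OF this(1) step[of g z]] Cons.prems(2) show ?case by simp
    qed
  qed
qed

text \<open>The three clauses of \<open>sym_mod\<close> match the three families of generators of
  \<open>sym_null\<close>, so it suffices to test a linear map on words.\<close>

lemma sym_null_image:
  assumes N: "subspace N" and \<Phi>: "module_hom fscale scale \<Phi>"
    and g: "sym_mod V scale N (\<lambda>w. \<Phi> (gen w))" and x: "x \<in> sym_null V"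
  shows "\<Phi> x \<in> N"
proof -
  interpret \<Phi>: module_hom fscale scale \<Phi> by fact
  have sg: "\<Phi> (sg n x) = sg n (\<Phi> x)" for n x by (simp add: sg_def \<Phi>.neg)
  from x show ?thesis
    unfolding sym_null_def
  proof (induction rule: fs.span_induct_alt)
    case base then show ?case by (simp add: \<Phi>.zero subspace_0 N)
  next
    case (step c x y)
    from step(1) have "\<Phi> x \<in> N"
      by (auto simp: words_iff \<Phi>.diff \<Phi>.scale fs.scale_sgn_pow sg sym_modD[OF g])
    then show ?case
      by (simp add: \<Phi>.add \<Phi>.scale N subspace_add subspace_scale step.IH)
  qed
qed

end

lemma sym_mod_map:
  assumes g: "sym_mod W s N g" and V: "is_gvs V"
    and deg: "\<And>z. fst (\<phi> z) = fst z"
    and mem: "\<And>i x. x \<in> gcomp V i \<Longrightarrow> snd (\<phi> (i, x)) \<in> gcomp W i"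
    and add: "\<And>i x y. snd (\<phi> (i, x + y)) = snd (\<phi> (i, x)) + snd (\<phi> (i, y))"
    and scale: "\<And>i c x. snd (\<phi> (i, gscale V c x)) = gscale W c (snd (\<phi> (i, x)))"
  shows "sym_mod V s N (\<lambda>w. g (map \<phi> w))"
proof -
  define \<psi> where "\<psi> i x = snd (\<phi> (i, x))" for i x
  have eq: "\<phi> (i, x) = (i, \<psi> i x)" for i x
    using deg[of "(i, x)"] by (simp add: \<psi>_def prod_eq_iff)
  note mem = mem[folded \<psi>_def] and add = add[folded \<psi>_def] and scale = scale[folded \<psi>_def]
  have aw: "map \<phi> w \<in> awords W" if "w \<in> awords V" for w
    using that by (induction w) (auto simp: eq mem split_paired_all)
  show ?thesis
  proof (rule sym_modI, goal_cases)
    case 1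
    from sym_modD(1)[OF g aw[OF 1(1)] aw[OF 1(2)] mem[OF 1(3)] mem[OF 1(4)]]
    show ?case by (simp add: eq add)
  next
    case (2 xs i c x ys)
    from sym_modD(2)[OF g aw[OF 2(1)] aw[OF 2(2)] mem[OF 2(3)], of c]
    show ?case by (simp add: eq scale)
  next
    case 3
    from sym_modD(3)[OF g aw[OF 3(1)] aw[OF 3(2)] mem[OF 3(3)] mem[OF 3(4)]]
    show ?case by (simp add: eq)
  qed
qed

lemma cosum_awords:
  assumes "w \<in> awords V" "set a \<union> set b = set w"
  shows "a \<in> awords V" "b \<in> awords V"
  using assms by (auto simp: awords_def)

section \<open>Components and coderivations\<close>

text \<open>The classical formula for the coderivation with components \<open>c\<close>: apply
  \<open>c\<close> to a nonempty set of letters and put the result in front of the others. The new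
  letter carries its degree explicitly, since a value of \<open>c\<close> does not determine
  it.\<close>

definition cder :: "int \<Rightarrow> ('v word \<Rightarrow> 'v) \<Rightarrow> 'v word \<Rightarrow> ('v word \<Rightarrow>\<^sub>0 'k::field)" where
  "cder e c w = cosum w (\<lambda>a b. if a = [] then 0 else gen ((wdeg a + e, c a) # b))"

lemma cder_Nil [simp]: "cder e c [] = 0"
  by (simp add: cder_def)

lemma subspace_fspan_gen: "fs.subspace (fspan (gen ` A))"
  by (simp add: fs.subspace_span)

lemma cder_length: "cder e c w \<in> fspan (gen ` {ys. length ys \<le> length w})"
  unfolding cder_def
proof (rule fs.cosum_mem[OF subspace_fspan_gen])
  fix a b :: "'a word" assume "length a + length b = length w"
  then show "(if a = [] then 0 else gen ((wdeg a + e, c a) # b)) \<in> fspan (gen ` {ys. length ys \<le> length w})"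
    by (cases a) (auto intro!: fs.span_base fs.span_zero)
qed

lemma cder_mem:
  assumes c: "\<And>xs. xs \<in> words V \<Longrightarrow> c xs \<in> gcomp V (wdeg xs + e)" and w: "w \<in> awords V"
  shows "cder e c w \<in> fspan (gen ` {ys \<in> words V. wdeg ys = wdeg w + e})"
  unfolding cder_def
proof (rule fs.cosum_mem[OF subspace_fspan_gen])
  fix a b assume *: "wdeg a + wdeg b = wdeg w" "set a \<union> set b = set w"
  note ab = cosum_awords[OF w *(2)]
  show "(if a = [] then 0 else gen ((wdeg a + e, c a) # b)) \<in> fspan (gen ` {ys \<in> words V. wdeg ys = wdeg w + e})"
    using ab *(1) c[of a] by (auto simp: words_iff fs.span_zero intro!: fs.span_base)
qed

lemma cder_deg: "cder e c w \<in> fspan (gen ` {ys. ys \<noteq> [] \<and> wdeg ys = wdeg w + e})"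
  unfolding cder_def
  by (rule fs.cosum_mem[OF subspace_fspan_gen]) (auto intro!: fs.span_base fs.span_zero)

lemma sym_mod_letter:
  assumes c: "sym_mod V (gscale V) {0} c" and b: "b \<in> awords V" and V: "is_gvs V"
    and cm: "\<And>xs. xs \<in> words V \<Longrightarrow> c xs \<in> gcomp V (wdeg xs + e)"
  shows "sym_mod V fscale (sym_null V) (\<lambda>a. if a = [] then 0 else gen ((wdeg a + e, c a) # b))"
proof (rule sym_modI, goal_cases)
  note V = is_gvsD[OF V]
  interpret V: vector_space "gscale V" by (fact V(1))
  note G = sym_modD[OF sym_mod_gen[where V=V], of "[]" b]
  {
    case (1 xs i x y ys)
    have "c (xs @ (i, x + y) # ys) = c (xs @ (i, x) # ys) + c (xs @ (i, y) # ys)"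
      using sym_modD(1)[OF c 1] by (simp add: algebra_simps)
    then show ?case
      using G(1)[of "c (xs @ (i, x) # ys)" "wdeg (xs @ (i, x) # ys) + e" "c (xs @ (i, y) # ys)"] b
        cm[of "xs @ (i, x) # ys"] cm[of "xs @ (i, y) # ys"] 1
      by (simp add: words_iff)
  next
    case (2 xs i r x ys)
    have "c (xs @ (i, gscale V r x) # ys) = gscale V r (c (xs @ (i, x) # ys))"
      using sym_modD(2)[OF c 2] by (simp add: algebra_simps)
    then show ?case
      using G(2)[of "c (xs @ (i, x) # ys)" "wdeg (xs @ (i, x) # ys) + e" r] b
        cm[of "xs @ (i, x) # ys"] 2
      by (simp add: words_iff)
  next
    case (3 xs i x j y ys)
    have "c (xs @ (i, x) # (j, y) # ys) = gscale V (sgn_pow (i * j)) (c (xs @ (j, y) # (i, x) # ys))"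
      using sym_modD(3)[OF c 3] by (simp add: V.scale_sgn_pow)
    then show ?case
      using G(2)[of "c (xs @ (j, y) # (i, x) # ys)" "wdeg (xs @ (i, x) # (j, y) # ys) + e" "sgn_pow (i * j)"] b
        cm[of "xs @ (j, y) # (i, x) # ys"] 3
      by (simp add: words_iff fs.scale_sgn_pow add.left_commute)
  }
qed

lemma sym_mod_cder:
  assumes c: "sym_mod V (gscale V) {0} c" and V: "is_gvs V"
    and cm: "\<And>xs. xs \<in> words V \<Longrightarrow> c xs \<in> gcomp V (wdeg xs + e)"
  shows "sym_mod V fscale (sym_null V) (cder e c)"
proof -
  have "sym_mod V fscale (sym_null V) (\<lambda>w. cosum w (\<lambda>a b. if a = [] then 0 else gen ((wdeg a + e, c a) # b)))"
  proof (rule fs.sym_mod_cosum[OF subspace_sym_null])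
    fix b assume "b \<in> awords V"
    then show "sym_mod V fscale (sym_null V) (\<lambda>a. if a = [] then 0 else gen ((wdeg a + e, c a) # b))"
      by (intro sym_mod_letter c V cm)
  next
    fix a assume "a \<in> awords V"
    then show "sym_mod V fscale (sym_null V) (\<lambda>b. if a = [] then 0 else gen ((wdeg a + e, c a) # b))"
      using cm[of a] sym_mod_Cons[OF sym_mod_gen, of "(wdeg a + e, c a)"]
      by (cases "a = []") (auto simp: words_iff fs.sym_mod_zero)
  qed
  then show ?thesis by (simp add: cder_def[abs_def])
qed

text \<open>Applied to \<open>cder e c w\<close> this gives the component of the square of the
  coderivation, so its vanishing is the family of generalised Jacobi identities.\<close>

definition comp_ext :: "('k::field, 'v::ab_group_add) gvs \<Rightarrow> ('v word \<Rightarrow> 'v) \<Rightarrow> ('v word \<Rightarrow>\<^sub>0 'k) \<Rightarrow> 'v" where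
  "comp_ext V c = glin (gscale V) (\<lambda>a. if a = [] then 0 else c a)"

lemma comp_ext_facts:
  assumes "is_gvs V"
  shows comp_ext_add: "comp_ext V c (x + y) = comp_ext V c x + comp_ext V c y"
    and comp_ext_zero: "comp_ext V c 0 = 0"
    and comp_ext_gen: "comp_ext V c (gen a) = (if a = [] then 0 else c a)"
    and module_hom_comp_ext: "module_hom fscale (gscale V) (comp_ext V c)"
proof -
  interpret vector_space "gscale V" using is_gvsD[OF assms] by simp
  show "comp_ext V c (x + y) = comp_ext V c x + comp_ext V c y"
    "comp_ext V c 0 = 0" "comp_ext V c (gen a) = (if a = [] then 0 else c a)"
    "module_hom fscale (gscale V) (comp_ext V c)"
    unfolding comp_ext_def by (auto simp: glin_add module_hom_glin)
qed

text \<open>Multilinearity in the first letter, iterated over a signed sum. All values share the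
  degree \<open>i\<close>, which is what allows their sum to be a letter.\<close>

lemma letter_cosum:
  assumes V: "is_gvs V" and b: "b \<in> awords V"
    and h: "\<And>a b. wdeg a + wdeg b = wdeg w \<Longrightarrow> length a + length b = length w \<Longrightarrow>
      set a \<union> set b = set w \<Longrightarrow> h a b \<in> gcomp V i"
  shows "gen ((i, cosum w h) # b) - cosum w (\<lambda>a a'. gen ((i, h a a') # b)) \<in> sym_null V"
  using h
proof (induction w arbitrary: h)
  case Nil then show ?case by (simp add: fs.subspace_0)
next
  case (Cons z w)
  note V = is_gvsD[OF V]
  interpret V: vector_space "gscale V" by (fact V(1))
  note G = sym_modD[OF sym_mod_gen[where V=V], of "[]" b, simplified, OF b]
  let ?h = "\<lambda>a a'. h (z # a) a' + sg (fst z * wdeg a) (h a (z # a'))"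
  have hm: "h (z # a) a' \<in> gcomp V i" "h a (z # a') \<in> gcomp V i"
    if "wdeg a + wdeg a' = wdeg w" "length a + length a' = length w" "set a \<union> set a' = set w" for a a'
    using that by (auto intro!: Cons.prems)
  have sgm: "sg n x \<in> gcomp V i" if "x \<in> gcomp V i" for n x
    using that V(4)[of x i "sgn_pow n"] by (simp add: V.scale_sgn_pow)
  have "gen ((i, cosum w ?h) # b) - cosum w (\<lambda>a a'. gen ((i, ?h a a') # b)) \<in> sym_null V"
    by (rule Cons.IH) (intro V(3) hm sgm)
  moreover have "cosum w (\<lambda>a a'. gen ((i, ?h a a') # b)) -
      cosum w (\<lambda>a a'. gen ((i, h (z # a) a') # b) + sg (fst z * wdeg a) (gen ((i, h a (z # a')) # b))) \<in> sym_null V"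
  proof (rule fs.cosum_cong_mod[OF subspace_sym_null])
    fix a a' assume *: "wdeg a + wdeg a' = wdeg w" "length a + length a' = length w" "set a \<union> set a' = set w"
    let ?s = "sgn_pow (fst z * wdeg a)"
    have "gen ((i, h (z # a) a' + gscale V ?s (h a (z # a'))) # b) - gen ((i, h (z # a) a') # b)
        - gen ((i, gscale V ?s (h a (z # a'))) # b) \<in> sym_null V"
      using hm[OF *] V(4) by (intro G(1))
    from fs.subspace_add[OF subspace_sym_null this G(2)[OF hm(2)[OF *], of ?s]]
    show "gen ((i, ?h a a') # b) -
        (gen ((i, h (z # a) a') # b) + sg (fst z * wdeg a) (gen ((i, h a (z # a')) # b))) \<in> sym_null V"
      by (simp add: V.scale_sgn_pow fs.scale_sgn_pow algebra_simps)
  qed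
  ultimately show ?case
    using fs.subspace_add[OF subspace_sym_null] by fastforce
qed

lemma gen_zero_letter:
  assumes V: "is_gvs V" and "xs \<in> awords V" "ys \<in> awords V"
  shows "gen (xs @ (i, 0) # ys) \<in> sym_null V"
proof -
  interpret vector_space "gscale V" using is_gvsD[OF V] by simp
  show ?thesis
    using sym_modD(2)[OF sym_mod_gen assms(2,3) is_gvsD(2)[OF V], of i 0] by simp
qed

lemma gen_swap:
  assumes "i = fst z" "j = fst z'" "snd z \<in> gcomp V i" "snd z' \<in> gcomp V j" "ys \<in> awords V"
  shows "gen (z # z' # ys) - sg (i * j) (gen (z' # z # ys)) \<in> sym_null V"
  using sym_modD(3)[OF sym_mod_gen awords_Nil assms(5,3,4)] assms(1,2) by simp

text \<open>The square of an odd coderivation is again a coderivation, hence governed by its components.\<close>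

lemma cder_square:
  fixes V :: "('k::field_char_0, 'v::ab_group_add) gvs"
  assumes V: "is_gvs V" and e: "odd e"
    and c: "sym_mod V (gscale V) {0} c"
    and cm: "\<And>xs. xs \<in> words V \<Longrightarrow> c xs \<in> gcomp V (wdeg xs + e)"
    and sq: "\<And>xs. xs \<in> words V \<Longrightarrow> comp_ext V c (cder e c xs) = 0"
    and w: "w \<in> awords V"
  shows "lin_ext (cder e c) (cder e c w) \<in> sym_null V"
proof -
  note Vm = is_gvsD[OF V]
  let ?N = "sym_null V"
  \<comment> \<open>In \<open>?A\<close> the second application of \<open>c\<close> consumes the
    letter produced by the first; in \<open>?G\<close> the two applications use disjoint sets of
    letters. The first kind is controlled by \<open>sq\<close>, the second cancels for reasons of
    sign.\<close>
  let ?A = "\<lambda>a b b'. if a = [] then 0 else gen ((wdeg a + wdeg b + 2 * e, c ((wdeg a + e, c a) # b)) # b') :: 'v word \<Rightarrow>\<^sub>0 'k"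
  let ?G = "\<lambda>b a b'. if a = [] \<or> b = [] then 0 else gen ((wdeg b + e, c b) # (wdeg a + e, c a) # b') :: 'v word \<Rightarrow>\<^sub>0 'k"
  have 1: "lin_ext (cder e c) (cder e c w) = cosum w (\<lambda>a b. if a = [] then 0 else cder e c ((wdeg a + e, c a) # b))"
    unfolding cder_def[of e c w] cosum_hom[where \<Phi>="lin_ext (cder e c)", OF lin_ext_add]
    by (intro cosum_cong) auto
  also have "\<dots> = cosum w (\<lambda>a b. cosum b (\<lambda>b b'. ?A a b b' + sg ((wdeg a + e) * wdeg b) (?G b a b')))"
    unfolding cder_def[of e c "_ # _"] cosum.simps
    by (intro cosum_cong) (auto intro!: cosum_cong simp: algebra_simps)
  also have "\<dots> = cosum w (\<lambda>u b'. cosum u (\<lambda>a b. ?A a b b'))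
     + cosum w (\<lambda>u b'. cosum u (\<lambda>a b. sg ((wdeg a + e) * wdeg b) (?G b a b')))"
    unfolding cosum_coassoc by (simp add: cosum_add)
  finally have split: "lin_ext (cder e c) (cder e c w) =
     cosum w (\<lambda>u b'. cosum u (\<lambda>a b. ?A a b b'))
     + cosum w (\<lambda>u b'. cosum u (\<lambda>a b. sg ((wdeg a + e) * wdeg b) (?G b a b')))" .
  have "cosum w (\<lambda>u b'. cosum u (\<lambda>a b. ?A a b b')) \<in> ?N"
  proof (rule fs.cosum_mem[OF subspace_sym_null])
    fix u b' assume *: "set u \<union> set b' = set w"
    note u = cosum_awords[OF w *]
    show "cosum u (\<lambda>a b. ?A a b b') \<in> ?N"
    proof (cases "u = []")
      case True then show ?thesis by (simp add: fs.subspace_0)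
    next
      case False
      let ?d = "wdeg u + 2 * e"
      let ?h = "\<lambda>a b. if a = [] then 0 else c ((wdeg a + e, c a) # b)"
      have hm: "?h a b \<in> gcomp V ?d"
        if "wdeg a + wdeg b = wdeg u" "set a \<union> set b = set u" for a b
        using cosum_awords[OF u(1) that(2)] cm[of a] cm[of "(wdeg a + e, c a) # b"] that(1) Vm(2)
        by (auto simp: words_iff algebra_simps)
      have "comp_ext V c (cder e c u) = cosum u ?h"
        unfolding cder_def cosum_hom[where \<Phi>="comp_ext V c", OF comp_ext_add[OF V]]
        by (intro cosum_cong) (auto simp: comp_ext_zero[OF V] comp_ext_gen[OF V])
      then have h0: "cosum u ?h = 0" using sq[of u] False u by (simp add: words_iff)
      have "gen ((?d, cosum u ?h) # b') - cosum u (\<lambda>a a'. gen ((?d, ?h a a') # b')) \<in> ?N"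
        by (rule letter_cosum[OF V u(2)]) (rule hm)
      then have 2: "cosum u (\<lambda>a a'. gen ((?d, ?h a a') # b')) \<in> ?N"
        using fs.subspace_diff[OF subspace_sym_null gen_zero_letter[OF V awords_Nil u(2), of ?d]]
        unfolding h0 by fastforce
      have "cosum u (\<lambda>a a'. gen ((?d, ?h a a') # b')) - cosum u (\<lambda>a b. ?A a b b') \<in> ?N"
      proof (rule fs.cosum_cong_mod[OF subspace_sym_null])
        fix a b :: "'v word" assume "wdeg a + wdeg b = wdeg u"
        then have "wdeg a + wdeg b + 2 * e = ?d" by simp
        then show "gen ((?d, ?h a b) # b') - ?A a b b' \<in> ?N"
          using gen_zero_letter[OF V awords_Nil u(2), of ?d] by (auto simp: fs.subspace_0)
      qed
      from fs.subspace_diff[OF subspace_sym_null 2 this] show ?thesis by simp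
    qed
  qed
  moreover have "cosum w (\<lambda>u b'. cosum u (\<lambda>a b. sg ((wdeg a + e) * wdeg b) (?G b a b'))) \<in> ?N"
  proof (rule fs.cosum_mem[OF subspace_sym_null])
    fix u b' assume *: "set u \<union> set b' = set w"
    note u = cosum_awords[OF w *]
    let ?Y = "cosum u (\<lambda>b a. sg (e * wdeg b) (?G b a b'))"
    have Y1: "cosum u (\<lambda>a b. sg ((wdeg a + e) * wdeg b) (?G b a b')) = ?Y"
      unfolding cosum_cocomm[of u "\<lambda>b a. sg (e * wdeg b) (?G b a b')", symmetric] sg_sg
      by (intro cosum_cong) (simp add: algebra_simps)
    \<comment> \<open>Interchanging the two produced letters and the two halves gives
      \<open>?Y\<close> back with the sign of the odd number \<open>e\<close>. So
      \<open>?Y + ?Y\<close> is null, and characteristic zero permits halving.\<close>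
    have "?Y - cosum u (\<lambda>b a. sg (wdeg b * wdeg a) (sg (e * wdeg a + e) (?G a b b'))) \<in> ?N"
    proof (rule fs.cosum_cong_mod[OF subspace_sym_null])
      fix b a assume *: "set b \<union> set a = set u"
      note ab = cosum_awords[OF u(1) *]
      have "?G b a b' - sg ((wdeg b + e) * (wdeg a + e)) (?G a b b') \<in> ?N"
        using ab u(2) cm[of a] cm[of b] by (auto intro!: gen_swap simp: words_iff fs.subspace_0)
      from fs.subspace_sg[OF subspace_sym_null this, of "e * wdeg b"]
      show "sg (e * wdeg b) (?G b a b') - sg (wdeg b * wdeg a) (sg (e * wdeg a + e) (?G a b b')) \<in> ?N"
        unfolding sg_diff sg_sg
        by (subst (asm) sg_eqI[OF _ refl, of "e * wdeg b + (wdeg b + e) * (wdeg a + e)" "wdeg b * wdeg a + (e * wdeg a + e)"])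
          auto
    qed
    also have "cosum u (\<lambda>b a. sg (wdeg b * wdeg a) (sg (e * wdeg a + e) (?G a b b'))) =
        cosum u (\<lambda>b a. sg e (sg (e * wdeg b) (?G b a b')))"
      unfolding cosum_cocomm[of u "\<lambda>a b. sg (e * wdeg a + e) (?G a b b')"]
      by (simp only: sg_sg add.commute)
    also have "\<dots> = - ?Y" using e unfolding cosum_sg by (simp add: sg_def)
    finally have "?Y + ?Y \<in> ?N" by simp
    then have "fscale (1/2) (?Y + ?Y) \<in> ?N"
      by (rule fs.subspace_scale[OF subspace_sym_null])
    also have "fscale (1/2) (?Y + ?Y) = ?Y"
      by (simp flip: fs.scale_left_distrib add: fs.scale_right_distrib)
    finally show "cosum u (\<lambda>a b. sg ((wdeg a + e) * wdeg b) (?G b a b')) \<in> ?N"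
      unfolding Y1 .
  qed
  ultimately show ?thesis
    unfolding split by (rule fs.subspace_add[OF subspace_sym_null])
qed

section \<open>The unital coproduct\<close>

text \<open>Unlike \<open>sym_diag\<close> this keeps the terms with an empty half; discarding them
  recovers \<open>sym_diag\<close>, as shown below.\<close>

definition cop :: "('v word \<Rightarrow>\<^sub>0 'k::field) \<Rightarrow> ('v word \<times> 'v word \<Rightarrow>\<^sub>0 'k)" where
  "cop = lin_ext (\<lambda>w. cosum w (\<lambda>a b. gen (a, b)))"

lemma cop_gen [simp]: "cop (gen w) = cosum w (\<lambda>a b. gen (a, b))"
  and cop_zero [simp]: "cop 0 = 0"
  and cop_add: "cop (x + y) = cop x + cop y"
  and cop_diff: "cop (x - y) = cop x - cop y"
  and cop_fscale: "cop (fscale c x) = fscale c (cop x)"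
  and cop_sum: "cop (sum f S) = (\<Sum>i\<in>S. cop (f i))"
  and cop_sg: "cop (sg n x) = sg n (cop x)"
  by (simp_all add: cop_def lin_ext_add lin_ext_diff lin_ext_fscale lin_ext_sum lin_ext_sg)

lemma lin_ext_cosum: "lin_ext h (cosum w g) = cosum w (\<lambda>a b. lin_ext h (g a b))"
  by (rule cosum_hom) (rule lin_ext_add)

lemma cop_cosum: "cop (cosum w g) = cosum w (\<lambda>a b. cop (g a b))"
  by (rule cosum_hom) (rule cop_add)

text \<open>\<open>lder e \<Phi>\<close> is \<open>\<Phi> \<otimes> 1 + 1 \<otimes> \<Phi>\<close> for a map \<open>\<Phi>\<close> of degree \<open>e\<close>.\<close>

definition lder :: "int \<Rightarrow> (('v word \<Rightarrow>\<^sub>0 'k::field) \<Rightarrow> ('v word \<Rightarrow>\<^sub>0 'k)) \<Rightarrow>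
   ('v word \<times> 'v word \<Rightarrow>\<^sub>0 'k) \<Rightarrow> ('v word \<times> 'v word \<Rightarrow>\<^sub>0 'k)" where
  "lder e \<Phi> = lin_ext (\<lambda>(a, b). tens (\<Phi> (gen a)) (gen b) + sg (e * wdeg a) (tens (gen a) (\<Phi> (gen b))))"

text \<open>Coderivations of the unital coalgebra, with the co-Leibniz rule required on the nose
  rather than modulo relations. That no empty word occurs in a value says that the counit
  annihilates the image.\<close>

definition coder :: "int \<Rightarrow> (('v word \<Rightarrow>\<^sub>0 'k::field) \<Rightarrow> ('v word \<Rightarrow>\<^sub>0 'k)) \<Rightarrow> bool" where
  "coder e \<Phi> \<longleftrightarrow> module_hom fscale fscale \<Phi> \<and>
     (\<forall>w. \<Phi> (gen w) \<in> fspan (gen ` {ys. ys \<noteq> [] \<and> wdeg ys = wdeg w + e})) \<and>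
     (\<forall>x. cop (\<Phi> x) = lder e \<Phi> (cop x))"

lemma coderI:
  assumes "module_hom fscale fscale \<Phi>"
    and "\<And>w. \<Phi> (gen w) \<in> fspan (gen ` {ys. ys \<noteq> [] \<and> wdeg ys = wdeg w + e})"
    and "\<And>w. cop (\<Phi> (gen w)) =
      cosum w (\<lambda>a b. tens (\<Phi> (gen a)) (gen b) + sg (e * wdeg a) (tens (gen a) (\<Phi> (gen b))))"
  shows "coder e \<Phi>"
proof -
  interpret module_hom fscale fscale \<Phi> by fact
  have "cop (\<Phi> x) = lder e \<Phi> (cop x)" for x
    by (induction x rule: free_induct)
      (auto simp: add scale zero cop_add cop_fscale lder_def lin_ext_add lin_ext_fscale assms(3) lin_ext_cosum)
  then show ?thesis using assms by (simp add: coder_def)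
qed

text \<open>The letter produced by \<open>c\<close> ends up in the left or in the right half, and
  coassociativity regroups the resulting triple unshuffles. In the second case cocommutativity first
  moves the consumed letters past the left half, which produces the sign
  \<open>e * wdeg a\<close>.\<close>

lemma coder_cder: "coder e (lin_ext (cder e c) :: ('v word \<Rightarrow>\<^sub>0 'k::field) \<Rightarrow> _)"
proof (rule coderI[OF module_hom_lin_ext])
  fix w :: "'v word"
  let ?g = "gen :: 'v word \<times> 'v word \<Rightarrow> (_ \<Rightarrow>\<^sub>0 'k)"
  show "lin_ext (cder e c) (gen w :: _ \<Rightarrow>\<^sub>0 'k) \<in> fspan (gen ` {ys. ys \<noteq> [] \<and> wdeg ys = wdeg w + e})"
    by (simp add: cder_deg)
  let ?l = "\<lambda>a. (wdeg a + e, c a)"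
  have "cop (lin_ext (cder e c) (gen w :: _ \<Rightarrow>\<^sub>0 'k)) = cosum w (\<lambda>a b. if a = [] then 0 else
      cosum (?l a # b) (\<lambda>b b'. ?g (b, b')))"
    unfolding lin_ext_gen cder_def cop_cosum by (intro cosum_cong) auto
  also have "\<dots> = cosum w (\<lambda>a b. cosum b (\<lambda>b b'. (if a = [] then 0 else ?g (?l a # b, b'))
      + sg ((wdeg a + e) * wdeg b) (if a = [] then 0 else ?g (b, ?l a # b'))))"
    by (intro cosum_cong) auto
  also have "\<dots> = cosum w (\<lambda>u b'. cosum u (\<lambda>a b. if a = [] then 0 else ?g (?l a # b, b')))
      + cosum w (\<lambda>u b'. cosum u (\<lambda>a b. sg (wdeg a * wdeg b) (sg (e * wdeg b) (if a = [] then 0 else ?g (b, ?l a # b')))))"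
    unfolding cosum_add sg_sg cosum_coassoc[symmetric] by (simp add: algebra_simps)
  also have "cosum w (\<lambda>u b'. cosum u (\<lambda>a b. sg (wdeg a * wdeg b) (sg (e * wdeg b) (if a = [] then 0 else ?g (b, ?l a # b')))))
      = cosum w (\<lambda>u b'. cosum u (\<lambda>b a. sg (e * wdeg b) (if a = [] then 0 else ?g (b, ?l a # b'))))"
    unfolding cosum_cocomm[of _ "\<lambda>b a. sg (e * wdeg b) (if a = [] then 0 else ?g (b, ?l a # _))"] ..
  also have "\<dots> = cosum w (\<lambda>b u. cosum u (\<lambda>a b'. sg (e * wdeg b) (if a = [] then 0 else ?g (b, ?l a # b'))))"
    by (rule cosum_coassoc)
  also have "\<dots> = cosum w (\<lambda>a b. sg (e * wdeg a) (tens (gen a) (cder e c b)))"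
    unfolding cosum_sg cder_def cosum_hom[where \<Phi>="tens (gen _)", OF tens_add_right]
    by (intro cosum_cong arg_cong[where f="sg _"]) auto
  also have "cosum w (\<lambda>u b'. cosum u (\<lambda>a b. if a = [] then 0 else ?g (?l a # b, b')))
     = cosum w (\<lambda>a b. tens (cder e c a) (gen b))"
    unfolding cder_def cosum_hom[where \<Phi>="\<lambda>x. tens x (gen _)", OF tens_add_left]
    by (intro cosum_cong) auto
  finally show "cop (lin_ext (cder e c) (gen w :: _ \<Rightarrow>\<^sub>0 'k)) =
    cosum w (\<lambda>a b. tens (lin_ext (cder e c) (gen a)) (gen b)
       + sg (e * wdeg a) (tens (gen a) (lin_ext (cder e c) (gen b))))"
    by (simp add: cosum_add)
qed

definition lmul :: "int \<times> 'v \<Rightarrow> ('v word \<Rightarrow>\<^sub>0 'k::field) \<Rightarrow> ('v word \<Rightarrow>\<^sub>0 'k)" where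
  "lmul z = lin_ext (\<lambda>w. gen (z # w))"

text \<open>The letter \<open>z\<close> falls into one of the two halves, and these are the two
  terms of the co-Leibniz rule. The term in which \<open>z\<close> stands alone comes from
  multiplying the unit.\<close>

lemma coder_lmul: "coder (fst z) (lmul z)"
  by (rule coderI) (auto simp: lmul_def module_hom_lin_ext intro!: fs.span_base cosum_cong)

text \<open>The Koszul sign for moving a map of degree \<open>r\<close> past the left tensor
  factor.\<close>

definition twist :: "int \<Rightarrow> ('v word \<Rightarrow>\<^sub>0 'k::field) \<Rightarrow> ('v word \<Rightarrow>\<^sub>0 'k)" where
  "twist r = lin_ext (\<lambda>w. sg (r * wdeg w) (gen w))"

lemma twist_homogeneous:
  assumes "x \<in> fspan (gen ` {ys. wdeg ys = n})"
  shows "twist r x = sg (r * n) x"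
  using assms
  by (induction rule: fspan_gen_induct)
    (auto simp: twist_def lin_ext_add lin_ext_fscale sg_add fs.scale_sg)

lemma lder_tens:
  assumes "module_hom fscale fscale \<Phi>"
  shows "lder r \<Phi> (tens x y) = tens (\<Phi> x) y + tens (twist r x) (\<Phi> y)"
proof -
  interpret \<Phi>: module_hom fscale fscale \<Phi> by fact
  have 1: "lder r \<Phi> (tens (gen a) y) = tens (\<Phi> (gen a)) y + tens (twist r (gen a)) (\<Phi> y)" for a
    by (induction y rule: free_induct)
      (auto simp: lder_def twist_def \<Phi>.zero \<Phi>.add \<Phi>.scale tens_add_right tens_scale_right lin_ext_add
        lin_ext_fscale sg_add fs.scale_right_distrib fs.scale_sg tens_sg_left)
  show ?thesis
  proof (induction x rule: free_induct)
    case (gen a) show ?case by (rule 1)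
  qed (auto simp: \<Phi>.zero \<Phi>.add \<Phi>.scale twist_def lder_def lin_ext_add lin_ext_fscale tens_add_left
      tens_scale_left fs.scale_right_distrib)
qed

text \<open>In each composite there are four terms; the two mixed ones, with one map on each factor,
  cancel in the graded commutator. This is what lets \<open>b = d e\<close> act by a
  coderivation.\<close>

lemma coder_commutator:
  fixes \<Phi> :: "('v word \<Rightarrow>\<^sub>0 'k::field) \<Rightarrow> ('v word \<Rightarrow>\<^sub>0 'k)"
  assumes "coder p \<Phi>" "coder q \<Psi>"
  shows "coder (p + q) (\<lambda>x. \<Phi> (\<Psi> x) - sg (p * q) (\<Psi> (\<Phi> x)))"
proof (rule coderI)
  let ?C = "\<lambda>x. \<Phi> (\<Psi> x) - sg (p * q) (\<Psi> (\<Phi> x))"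
  interpret \<Phi>: module_hom fscale fscale \<Phi> using assms by (simp add: coder_def)
  interpret \<Psi>: module_hom fscale fscale \<Psi> using assms by (simp add: coder_def)
  show "module_hom fscale fscale ?C"
    by unfold_locales
      (auto simp: \<Phi>.add \<Psi>.add \<Phi>.scale \<Psi>.scale sg_add fs.scale_right_diff_distrib fs.scale_sg)
  have deg: "\<Phi>' x \<in> fspan (gen ` {ys. ys \<noteq> [] \<and> wdeg ys = n + r})"
    if "coder r \<Phi>'" "x \<in> fspan (gen ` {ys. ys \<noteq> [] \<and> wdeg ys = n})" for \<Phi>' r n x
  proof -
    interpret \<Phi>': module_hom fscale fscale \<Phi>' using that by (simp add: coder_def)
    show ?thesis
      using that(2)
      by (induction rule: fspan_gen_induct)
        (use that(1) in \<open>auto simp: coder_def \<Phi>'.zero \<Phi>'.add \<Phi>'.scale fs.span_zero intro: fs.span_add fs.span_scale\<close>)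
  qed
  have deg1: "\<Phi>' (gen w) \<in> fspan (gen ` {ys. ys \<noteq> [] \<and> wdeg ys = wdeg w + r})" if "coder r \<Phi>'" for \<Phi>' r w
    using that by (simp add: coder_def)
  show "?C (gen w) \<in> fspan (gen ` {ys. ys \<noteq> [] \<and> wdeg ys = wdeg w + (p + q)})" for w
    using deg[OF assms(1) deg1[OF assms(2)]] deg[OF assms(2) deg1[OF assms(1)]]
    by (intro fs.span_diff fs.subspace_sg[OF subspace_fspan_gen]) (auto simp: algebra_simps)
  fix w :: "'v word"
  have L: "lder r \<Phi>' (tens x y) = tens (\<Phi>' x) y + sg (r * n) (tens x (\<Phi>' y))"
    if "coder r \<Phi>'" "x \<in> fspan (gen ` {ys. wdeg ys = n})" for \<Phi>' r n x y
    using that by (simp add: coder_def lder_tens twist_homogeneous tens_sg_left)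
  have hom: "\<Phi>' (gen a) \<in> fspan (gen ` {ys. wdeg ys = wdeg a + r})" if "coder r \<Phi>'" for \<Phi>' r a
    by (rule set_mp[OF fs.span_mono deg1[OF that]]) auto
  have gen_hom: "gen a \<in> fspan (gen ` {ys. wdeg ys = wdeg a})" for a
    by (rule fs.span_base) auto
  have cop: "cop (\<Phi>' x) = lder r \<Phi>' (cop x)" if "coder r \<Phi>'" for \<Phi>' r x
    using that by (simp add: coder_def)
  have cosum: "lder r \<Phi>' (cosum w g) = cosum w (\<lambda>a b. lder r \<Phi>' (g a b))" for \<Phi>' r w g
    by (simp add: lder_def lin_ext_cosum)
  have add: "lder r \<Phi>' (x + y) = lder r \<Phi>' x + lder r \<Phi>' y" "lder r \<Phi>' (sg n x) = sg n (lder r \<Phi>' x)" for r \<Phi>' x y n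
    by (simp_all add: lder_def lin_ext_add lin_ext_sg)
  have two: "cop (\<Phi>1 (\<Psi>1 (gen w))) = cosum w (\<lambda>a b. tens (\<Phi>1 (\<Psi>1 (gen a))) (gen b) + sg (r * (wdeg a + r')) (tens (\<Psi>1 (gen a)) (\<Phi>1 (gen b)))
     + sg (r' * wdeg a) (tens (\<Phi>1 (gen a)) (\<Psi>1 (gen b)) + sg (r * wdeg a) (tens (gen a) (\<Phi>1 (\<Psi>1 (gen b))))))"
    if \<Phi>1: "coder r \<Phi>1" and \<Psi>1: "coder r' \<Psi>1" for r r' \<Phi>1 \<Psi>1
    unfolding cop[OF \<Phi>1] cop[OF \<Psi>1] cop_gen cosum
  proof (intro cosum_cong)
    fix a b
    have "lder r' \<Psi>1 (gen (a, b)) = tens (\<Psi>1 (gen a)) (gen b) + sg (r' * wdeg a) (tens (gen a) (\<Psi>1 (gen b)))"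
      using L[OF \<Psi>1 gen_hom, of a "gen b"] by simp
    then show "lder r \<Phi>1 (lder r' \<Psi>1 (gen (a, b))) = tens (\<Phi>1 (\<Psi>1 (gen a))) (gen b) + sg (r * (wdeg a + r')) (tens (\<Psi>1 (gen a)) (\<Phi>1 (gen b)))
     + sg (r' * wdeg a) (tens (\<Phi>1 (gen a)) (\<Psi>1 (gen b)) + sg (r * wdeg a) (tens (gen a) (\<Phi>1 (\<Psi>1 (gen b)))))"
      by (simp add: add L[OF \<Phi>1 hom[OF \<Psi>1]] L[OF \<Phi>1 gen_hom])
  qed
  show "cop (?C (gen w)) = cosum w (\<lambda>a b. tens (?C (gen a)) (gen b) + sg ((p + q) * wdeg a) (tens (gen a) (?C (gen b))))"
    unfolding cop_diff cop_sg two[OF assms] two[OF assms(2,1)] cosum_sg[symmetric] cosum_diff[symmetric]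
    by (intro cosum_cong) (auto simp: sg_def tens_diff_left tens_diff_right tens_minus_left tens_minus_right algebra_simps)
qed

section \<open>Comparison with the shuffle formula\<close>

text \<open>The Koszul exponent for pulling the letters at the positions in \<open>I\<close> to the
  front: only pairs whose order is reversed contribute.\<close>

definition inv_sum :: "nat set \<Rightarrow> 'v word \<Rightarrow> int" where
  "inv_sum I w = (\<Sum>(i, j)\<in>{(i, j). i < j \<and> j < length w \<and> i \<notin> I \<and> j \<in> I}. fst (w ! i) * fst (w ! j))"

lemma finite_pairs: "finite {(i, j). i < j \<and> j < (n::nat) \<and> P i j}"
  by (rule finite_subset[of _ "{..<n} \<times> {..<n}"]) auto

lemma nths_eq_map_filter: "nths xs A = map ((!) xs) (filter (\<lambda>i. i \<in> A) [0..<length xs])"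
proof -
  have "zip xs [0..<length xs] = map (\<lambda>i. (xs ! i, i)) [0..<length xs]"
    by (rule nth_equalityI) auto
  then show ?thesis by (simp add: nths_def filter_map comp_def)
qed

lemma wdeg_nths: "wdeg (nths w I) = (\<Sum>j\<in>{j. j < length w \<and> j \<in> I}. fst (w ! j))"
proof -
  have "wdeg (nths w I) = sum_list (map (\<lambda>i. fst (w ! i)) (filter (\<lambda>i. i \<in> I) [0..<length w]))"
    by (simp add: wdeg_def nths_eq_map_filter comp_def)
  also have "\<dots> = sum (\<lambda>i. fst (w ! i)) (set (filter (\<lambda>i. i \<in> I) [0..<length w]))"
    by (rule sum_list_distinct_conv_sum_set) simp
  also have "set (filter (\<lambda>i. i \<in> I) [0..<length w]) = {j. j < length w \<and> j \<in> I}" by auto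
  finally show ?thesis .
qed

lemma inv_sum_Cons:
  "inv_sum I (z # w) = inv_sum {j. Suc j \<in> I} w + (if 0 \<in> I then 0 else fst z * wdeg (nths w {j. Suc j \<in> I}))"
proof -
  let ?P = "\<lambda>I w. {(i, j). i < j \<and> j < length w \<and> i \<notin> I \<and> j \<in> I}"
  let ?J = "{j. Suc j \<in> I}"
  let ?f = "\<lambda>(i, j). fst ((z # w) ! i) * fst ((z # w) ! j)"
  let ?A = "(\<lambda>(i, j). (Suc i, Suc j)) ` ?P ?J w"
  let ?B = "if 0 \<in> I then {} else (\<lambda>j. (0, Suc j)) ` {j. j < length w \<and> j \<in> ?J}"
  have "?P I (z # w) = ?A \<union> ?B"
  proof (intro equalityI subsetI)
    fix p assume "p \<in> ?P I (z # w)"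
    then obtain i j where "p = (i, j)" "i < j" "j < Suc (length w)" "i \<notin> I" "j \<in> I" by auto
    then show "p \<in> ?A \<union> ?B" by (cases i; cases j) (auto simp: image_iff)
  qed (auto split: if_splits)
  then have "inv_sum I (z # w) = sum ?f (?A \<union> ?B)" by (simp add: inv_sum_def)
  also have "\<dots> = sum ?f ?A + sum ?f ?B"
    by (rule sum.union_disjoint) (auto intro!: finite_imageI finite_pairs)
  also have "sum ?f ?A = inv_sum ?J w"
    unfolding inv_sum_def by (subst sum.reindex) (auto simp: inj_on_def comp_def intro!: sum.cong)
  also have "sum ?f ?B = (if 0 \<in> I then 0 else fst z * wdeg (nths w ?J))"
    by (auto simp: sum.reindex inj_on_def wdeg_nths sum_distrib_left)
  finally show ?thesis .
qed

lemma Pow_lessThan_Suc: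
  "Pow {..<Suc n} = (\<lambda>I. insert 0 (Suc ` I)) ` Pow {..<n} \<union> (\<lambda>I. Suc ` I) ` Pow {..<n}"
proof (intro equalityI subsetI)
  fix J assume J: "J \<in> Pow {..<Suc n}"
  have "J - {0} = Suc ` {j. Suc j \<in> J}"
    by (auto simp: image_iff) (metis not0_implies_Suc)
  then have "J = insert 0 (Suc ` {j. Suc j \<in> J}) \<or> J = Suc ` {j. Suc j \<in> J}"
    by (cases "0 \<in> J") auto
  moreover have "{j. Suc j \<in> J} \<in> Pow {..<n}" using J by auto
  ultimately show "J \<in> (\<lambda>I. insert 0 (Suc ` I)) ` Pow {..<n} \<union> (\<lambda>I. Suc ` I) ` Pow {..<n}" by blast
qed auto

text \<open>An unshuffle amounts to choosing the positions of the left half. The recursion of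
  \<open>cosum\<close> corresponds to splitting the subsets by whether they contain position
  0.\<close>

lemma cosum_eq_sum_Pow:
  "cosum w g = (\<Sum>I\<in>Pow {..<length w}. sg (inv_sum I w) (g (nths w I) (nths w (- I))))"
proof (induction w arbitrary: g)
  case Nil
  have "{(i, j). i < j \<and> j < (0::nat) \<and> i \<notin> I \<and> j \<in> I} = {}" for I by auto
  then show ?case by (simp add: inv_sum_def)
next
  case (Cons z w)
  let ?n = "length w"
  let ?t = "\<lambda>I. sg (inv_sum I (z # w)) (g (nths (z # w) I) (nths (z # w) (- I)))"
  let ?X = "(\<lambda>I. insert 0 (Suc ` I)) ` Pow {..<?n}" and ?Y = "(\<lambda>I. Suc ` I) ` Pow {..<?n}"
  have "sum ?t (Pow {..<length (z # w)}) = sum ?t ?X + sum ?t ?Y"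
    unfolding list.size(4) One_nat_def add_Suc_right add_0_right Pow_lessThan_Suc
    by (rule sum.union_disjoint) auto
  also have "sum ?t ?X = (\<Sum>I\<in>Pow {..<?n}. sg (inv_sum I w) (g (z # nths w I) (nths w (- I))))"
  proof (subst sum.reindex)
    have Suc_inj: "I = J" if "insert 0 (Suc ` I) = insert 0 (Suc ` J)" for I J
    proof (intro set_eqI)
      fix x show "x \<in> I \<longleftrightarrow> x \<in> J"
        using arg_cong[OF that, of "\<lambda>S. Suc x \<in> S"] by auto
    qed
    show "inj_on (\<lambda>I. insert 0 (Suc ` I)) (Pow {..<?n})"
      using Suc_inj by (auto intro!: inj_onI)
    have "{j. Suc j \<in> insert 0 (Suc ` I)} = I" "{j. Suc j \<notin> insert 0 (Suc ` I)} = - I" for I by auto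
    then show "sum (?t \<circ> (\<lambda>I. insert 0 (Suc ` I))) (Pow {..<?n}) =
        (\<Sum>I\<in>Pow {..<?n}. sg (inv_sum I w) (g (z # nths w I) (nths w (- I))))"
      by (intro sum.cong refl) (simp add: inv_sum_Cons nths_Cons Compl_eq)
  qed
  also have "sum ?t ?Y = (\<Sum>I\<in>Pow {..<?n}. sg (inv_sum I w) (sg (fst z * wdeg (nths w I)) (g (nths w I) (z # nths w (- I)))))"
  proof (subst sum.reindex)
    show "inj_on (\<lambda>I. Suc ` I) (Pow {..<?n})"
      by (auto intro!: inj_onI simp: inj_image_eq_iff)
    have "{j. Suc j \<in> Suc ` I} = I" "{j. Suc j \<notin> Suc ` I} = - I" for I by auto
    then show "sum (?t \<circ> (\<lambda>I. Suc ` I)) (Pow {..<?n}) = (\<Sum>I\<in>Pow {..<?n}. sg (inv_sum I w) (sg (fst z * wdeg (nths w I)) (g (nths w I) (z # nths w (- I)))))"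
      by (intro sum.cong refl) (simp add: inv_sum_Cons nths_Cons Compl_eq sg_sg)
  qed
  finally show ?case by (simp add: Cons.IH sum.distrib sg_add)
qed

text \<open>A strictly increasing list is determined by its set of entries.\<close>

lemma map_upt_eq_filter:
  assumes "strict_mono_on {a..<b} \<sigma>" "\<sigma> ` {a..<b} = J" "J \<subseteq> {..<m}"
  shows "map \<sigma> [a..<b] = filter (\<lambda>i. i \<in> J) [0..<m]"
proof (rule sorted_distinct_set_unique)
  show "sorted (map \<sigma> [a..<b])"
    by (auto simp: sorted_iff_nth_mono_less intro!: less_imp_le[OF strict_mono_onD[OF assms(1)]])
  show "distinct (map \<sigma> [a..<b])"
    using strict_mono_on_imp_inj_on[OF assms(1)] by (simp add: distinct_map)
qed (use assms in \<open>auto simp: sorted_wrt_filter\<close>)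

lemma shuffle_facts:
  assumes "\<sigma> \<in> shuffles_of p m" "p \<le> m"
  defines "I \<equiv> \<sigma> ` {..<p}"
  shows "I \<subseteq> {..<m}" "card I = p"
    and "map \<sigma> [0..<p] = filter (\<lambda>i. i \<in> I) [0..<m]"
    and "map \<sigma> [p..<m] = filter (\<lambda>i. i \<in> - I) [0..<m]"
    and "\<sigma> ` {p..<m} = {..<m} - I"
proof -
  have \<sigma>: "\<sigma> permutes {..<m}" "strict_mono_on {..<p} \<sigma>" "strict_mono_on {p..<m} \<sigma>"
    using assms(1) by (auto simp: shuffles_of_def)
  show I: "I \<subseteq> {..<m}"
    using permutes_in_image[OF \<sigma>(1)] assms(2) by (force simp: I_def)
  show "card I = p"
    unfolding I_def using strict_mono_on_imp_inj_on[OF \<sigma>(2)] by (simp add: card_image)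
  have "{p..<m} = {..<m} - {..<p}" by auto
  then have "\<sigma> ` {p..<m} = \<sigma> ` {..<m} - \<sigma> ` {..<p}"
    by (metis image_set_diff permutes_inj[OF \<sigma>(1)])
  then show *: "\<sigma> ` {p..<m} = {..<m} - I"
    using permutes_image[OF \<sigma>(1)] by (simp add: I_def)
  show "map \<sigma> [0..<p] = filter (\<lambda>i. i \<in> I) [0..<m]"
    by (rule map_upt_eq_filter) (use \<sigma> I in \<open>auto simp: I_def atLeast0LessThan\<close>)
  have "map \<sigma> [p..<m] = filter (\<lambda>i. i \<in> {..<m} - I) [0..<m]"
    by (rule map_upt_eq_filter) (use \<sigma> * in auto)
  also have "\<dots> = filter (\<lambda>i. i \<in> - I) [0..<m]" by (rule filter_cong) auto
  finally show "map \<sigma> [p..<m] = filter (\<lambda>i. i \<in> - I) [0..<m]" .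
qed

lemma shuffle_exists:
  assumes "I \<subseteq> {..<m}"
  shows "\<exists>\<sigma>\<in>shuffles_of (card I) m. \<sigma> ` {..<card I} = I"
proof -
  define p where "p = card I"
  define l where "l = filter (\<lambda>i. i \<in> I) [0..<m]"
  define r where "r = filter (\<lambda>i. i \<in> - I) [0..<m]"
  \<comment> \<open>The shuffle enumerates \<open>I\<close> in increasing order and then its
    complement in increasing order; outside \<open>{..<m}\<close> it has to be the identity to count
    as a permutation of that set.\<close>
  define \<sigma> where "\<sigma> i = (if i < m then (l @ r) ! i else i)" for i
  have l: "set l = I" "distinct l" "sorted l" "length l = p"
  proof -
    show "set l = I" using assms by (auto simp: l_def)
    show "distinct l" by (simp add: l_def)
    show "sorted l" by (simp add: l_def sorted_wrt_filter)
    from \<open>set l = I\<close> \<open>distinct l\<close> show "length l = p" by (metis distinct_card p_def)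
  qed
  have r: "set r = {..<m} - I" "distinct r" "sorted r" by (auto simp: r_def sorted_wrt_filter)
  have len: "length (l @ r) = m"
    unfolding l_def r_def length_append
    using sum_length_filter_compl[of "\<lambda>i. i \<in> I" "[0..<m]"] by simp
  have lr: "distinct (l @ r)" "set (l @ r) = {..<m}" using l r assms by auto
  have "bij_betw (\<lambda>i. (l @ r) ! i) {..<m} {..<m}"
    by (rule bij_betw_nth[OF lr(1)]) (simp_all only: len lr(2))
  then have "bij_betw \<sigma> {..<m} {..<m}"
    by (rule bij_betw_cong[THEN iffD1, rotated]) (simp add: \<sigma>_def)
  then have perm: "\<sigma> permutes {..<m}"
    by (rule bij_imp_permutes) (simp add: \<sigma>_def)
  have pm: "p \<le> m" using len l by simp
  have nth_less: "xs ! i < xs ! j" if "distinct xs" "sorted xs" "i < j" "j < length xs" for xs :: "nat list" and i j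
  proof -
    have "sorted_wrt (<) xs" using that by (simp add: strict_sorted_iff)
    then show ?thesis using sorted_wrt_nth_less that by blast
  qed
  have m1: "strict_mono_on {..<p} \<sigma>"
  proof (rule strict_mono_onI)
    fix i j assume "i \<in> {..<p}" "j \<in> {..<p}" "i < j"
    then show "\<sigma> i < \<sigma> j"
      using nth_less[OF l(2,3), of i j] l(4) pm by (simp add: \<sigma>_def nth_append)
  qed
  have m2: "strict_mono_on {p..<m} \<sigma>"
  proof (rule strict_mono_onI)
    fix i j assume *: "i \<in> {p..<m}" "j \<in> {p..<m}" "i < j"
    have "r ! (i - p) < r ! (j - p)"
      by (rule nth_less[OF r(2,3)]) (use * len l(4) in auto)
    with * show "\<sigma> i < \<sigma> j"
      using l(4) by (simp add: \<sigma>_def nth_append)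
  qed
  have "\<sigma> ` {..<p} = (!) l ` {..<p}"
    using pm l by (intro image_cong) (auto simp: \<sigma>_def nth_append)
  also have "\<dots> = I" using l by (metis lessThan_atLeast0 nth_image order_refl take_all)
  finally show ?thesis using perm m1 m2 by (auto simp: shuffles_of_def p_def)
qed

text \<open>The image of the first block determines everything: its cardinality is \<open>p\<close>,
  and both blocks are increasing enumerations. The bounds on \<open>p\<close> exclude exactly the
  empty and the full set.\<close>

lemma bij_betw_shuffles:
  "bij_betw (\<lambda>(p, \<sigma>). \<sigma> ` {..<p}) (Sigma {1..<m} (\<lambda>p. shuffles_of p m)) (Pow {..<m} - {{}, {..<m}})"
proof (rule bij_betw_imageI)
  show "inj_on (\<lambda>(p, \<sigma>). \<sigma> ` {..<p}) (Sigma {1..<m} (\<lambda>p. shuffles_of p m))"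
  proof (rule inj_onI, clarsimp)
    fix p \<sigma> q \<tau> assume *: "Suc 0 \<le> p" "p < m" "Suc 0 \<le> q" "q < m" "\<sigma> \<in> shuffles_of p m" "\<tau> \<in> shuffles_of q m"
      and eq: "\<sigma> ` {..<p} = \<tau> ` {..<q}"
    note S = shuffle_facts[OF *(5) less_imp_le[OF *(2)]] and T = shuffle_facts[OF *(6) less_imp_le[OF *(4)]]
    have pq: "p = q" using S(2) T(2) eq by simp
    have "map \<sigma> ([0..<p] @ [p..<m]) = map \<tau> ([0..<p] @ [p..<m])"
      using S(3,4) T(3,4) eq pq by simp
    also have "[0..<p] @ [p..<m] = [0..<m]"
      using *(2) upt_add_eq_append[of 0 p "m - p"] by simp
    finally have "\<sigma> i = \<tau> i" if "i < m" for i using that by auto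
    moreover have "\<sigma> i = \<tau> i" if "\<not> i < m" for i
      using that *(5,6) by (auto simp: shuffles_of_def permutes_def)
    ultimately show "p = q \<and> \<sigma> = \<tau>" using pq by blast
  qed
  show "(\<lambda>(p, \<sigma>). \<sigma> ` {..<p}) ` Sigma {1..<m} (\<lambda>p. shuffles_of p m) = Pow {..<m} - {{}, {..<m}}"
  proof (intro equalityI subsetI)
    fix J assume "J \<in> (\<lambda>(p, \<sigma>). \<sigma> ` {..<p}) ` Sigma {1..<m} (\<lambda>p. shuffles_of p m)"
    then obtain p \<sigma> where *: "1 \<le> p" "p < m" "\<sigma> \<in> shuffles_of p m" "J = \<sigma> ` {..<p}" by auto
    from shuffle_facts(1,2)[OF *(3) less_imp_le[OF *(2)]] *
    show "J \<in> Pow {..<m} - {{}, {..<m}}" by auto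
  next
    fix J assume J: "J \<in> Pow {..<m} - {{}, {..<m}}"
    then have fin: "finite J" "J \<subset> {..<m}" using finite_subset[of J "{..<m}"] by auto
    have "1 \<le> card J" "card J < m"
      using J fin psubset_card_mono[OF _ fin(2)] by (auto simp: Suc_le_eq card_gt_0_iff)
    with shuffle_exists[of J m] fin
    show "J \<in> (\<lambda>(p, \<sigma>). \<sigma> ` {..<p}) ` Sigma {1..<m} (\<lambda>p. shuffles_of p m)"
      by (force simp: image_iff)
  qed
qed

lemma sgn_pow_add: "sgn_pow (m + n) = (sgn_pow m * sgn_pow n :: 'k::field)"
  by (simp add: sgn_pow_eq)

lemma prod_sgn_pow: "(\<Prod>i\<in>S. sgn_pow (f i)) = (sgn_pow (\<Sum>i\<in>S. f i) :: 'k::field)"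
proof -
  have "sgn_pow 0 = (1 :: 'k)" by (simp add: sgn_pow_eq)
  then show ?thesis by (induction S rule: infinite_finite_induct) (auto simp: sgn_pow_add)
qed

lemma koszul_shuffle:
  assumes "\<sigma> \<in> shuffles_of p (length w)" "p \<le> length w"
  shows "koszul \<sigma> w = (sgn_pow (inv_sum (\<sigma> ` {..<p}) w) :: 'k::field)"
proof -
  let ?m = "length w" and ?I = "\<sigma> ` {..<p}"
  let ?P = "{(a, b). a < b \<and> b < ?m \<and> \<sigma> b < \<sigma> a}"
  have \<sigma>: "\<sigma> permutes {..<?m}" "strict_mono_on {..<p} \<sigma>" "strict_mono_on {p..<?m} \<sigma>"
    using assms(1) by (auto simp: shuffles_of_def)
  note S = shuffle_facts[OF assms]
  note inj = permutes_inj[OF \<sigma>(1)]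
  \<comment> \<open>A shuffle is increasing on each block, so an inversion has one position in
    either block. Sending \<open>(a, b)\<close> to the pair of values therefore matches the
    inversions with the index set of \<open>inv_sum\<close>.\<close>
  have crossing: "a < p \<and> p \<le> b" if "a < b" "b < ?m" "\<sigma> b < \<sigma> a" for a b
  proof (rule ccontr)
    assume "\<not> (a < p \<and> p \<le> b)"
    then have "\<sigma> a < \<sigma> b"
      using that strict_mono_onD[OF \<sigma>(2), of a b] strict_mono_onD[OF \<sigma>(3), of a b]
      by (cases "b < p") auto
    with that show False by simp
  qed
  have img: "(\<lambda>(a, b). (\<sigma> b, \<sigma> a)) ` ?P = {(i, j). i < j \<and> j < ?m \<and> i \<notin> ?I \<and> j \<in> ?I}" (is "_ = ?Q")
  proof (intro equalityI subsetI)
    fix x assume "x \<in> (\<lambda>(a, b). (\<sigma> b, \<sigma> a)) ` ?P"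
    then obtain a b where x: "x = (\<sigma> b, \<sigma> a)" and ab: "a < b" "b < ?m" "\<sigma> b < \<sigma> a" by auto
    note c = crossing[OF ab]
    have "\<sigma> b \<notin> ?I" using c inj by (auto simp: inj_eq)
    moreover have "\<sigma> a < ?m" using permutes_in_image[OF \<sigma>(1), of a] ab by simp
    ultimately show "x \<in> ?Q" using x ab c by auto
  next
    fix x assume "x \<in> ?Q"
    then obtain i a where x: "x = (i, \<sigma> a)" "i < \<sigma> a" "\<sigma> a < ?m" "i \<notin> ?I" "a < p" by auto
    then have "i \<in> \<sigma> ` {p..<?m}" using S(5) by auto
    then obtain b where "i = \<sigma> b" "p \<le> b" "b < ?m" by auto
    with x show "x \<in> (\<lambda>(a, b). (\<sigma> b, \<sigma> a)) ` ?P" by (auto intro!: image_eqI[of _ _ "(a, b)"])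
  qed
  have "inv_sum ?I w = (\<Sum>(i, j)\<in>(\<lambda>(a, b). (\<sigma> b, \<sigma> a)) ` ?P. fst (w ! i) * fst (w ! j))"
    unfolding inv_sum_def img ..
  also have "\<dots> = (\<Sum>(a, b)\<in>?P. fst (w ! \<sigma> a) * fst (w ! \<sigma> b))"
  proof (subst sum.reindex)
    show "inj_on (\<lambda>(a, b). (\<sigma> b, \<sigma> a)) ?P"
      by (auto simp: inj_on_def dest: injD[OF inj])
  qed (auto simp: mult.commute intro!: sum.cong)
  finally show ?thesis
    unfolding koszul_def by (simp add: prod_sgn_pow[symmetric] case_prod_beta)
qed

definition both_ne :: "('a list \<times> 'b list \<Rightarrow>\<^sub>0 'k::field) \<Rightarrow> ('a list \<times> 'b list \<Rightarrow>\<^sub>0 'k)" where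
  "both_ne = lin_ext (\<lambda>(a, b). if a = [] \<or> b = [] then 0 else gen (a, b))"

lemma sym_diag_gen_eq_sum:
  fixes w :: "'v word"
  shows "sym_diag (gen w :: _ \<Rightarrow>\<^sub>0 'k::field) =
     (\<Sum>I\<in>Pow {..<length w} - {{}, {..<length w}}. sg (inv_sum I w) (gen (nths w I, nths w (- I))))"
proof -
  let ?m = "length w"
  let ?t = "\<lambda>I. sg (inv_sum I w) (gen (nths w I, nths w (- I))) :: _ \<Rightarrow>\<^sub>0 'k"
  have "sym_diag (gen w :: _ \<Rightarrow>\<^sub>0 'k) = (\<Sum>(p, \<sigma>)\<in>Sigma {1..<?m} (\<lambda>p. shuffles_of p ?m).
      fscale (koszul \<sigma> w) (gen (take p (permute_list \<sigma> w), drop p (permute_list \<sigma> w))))"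
    unfolding sym_diag_def lin_ext_gen
    by (rule sum.Sigma) (auto simp: shuffles_of_def intro: finite_subset[OF _ finite_permutations[of "{..<?m}"]])
  also have "\<dots> = (\<Sum>x\<in>Sigma {1..<?m} (\<lambda>p. shuffles_of p ?m). ?t ((\<lambda>(p, \<sigma>). \<sigma> ` {..<p}) x))"
  proof (rule sum.cong, rule refl, clarsimp)
    fix p \<sigma> assume *: "Suc 0 \<le> p" "p < ?m" "\<sigma> \<in> shuffles_of p ?m"
    note S = shuffle_facts[OF *(3) less_imp_le[OF *(2)]]
    have pl: "permute_list \<sigma> w = map ((!) w) (map \<sigma> [0..<?m])"
      by (simp add: permute_list_def)
    have "take p (permute_list \<sigma> w) = map ((!) w) (map \<sigma> [0..<p])"
      using *(2) unfolding pl by (simp add: take_map)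
    moreover have "drop p (permute_list \<sigma> w) = map ((!) w) (map \<sigma> [p..<?m])"
      using *(2) unfolding pl by (simp add: drop_map)
    ultimately show "fscale (koszul \<sigma> w) (gen (take p (permute_list \<sigma> w), drop p (permute_list \<sigma> w))) = ?t (\<sigma> ` {..<p})"
      unfolding S(3,4) koszul_shuffle[OF *(3) less_imp_le[OF *(2)]] fs.scale_sgn_pow nths_eq_map_filter
      by simp
  qed
  also have "\<dots> = sum ?t (Pow {..<?m} - {{}, {..<?m}})"
    by (rule sum.reindex_bij_betw[OF bij_betw_shuffles])
  finally show ?thesis .
qed

lemma nths_eq_Nil_iff:
  assumes "I \<subseteq> {..<length w}"
  shows "nths w I = [] \<longleftrightarrow> I = {}" "nths w (- I) = [] \<longleftrightarrow> I = {..<length w}"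
  using assms unfolding nths_eq_map_filter by (auto simp: filter_empty_conv)

text \<open>The bridge between the diagonal as defined by shuffles of positions and the recursive
  coproduct; afterwards permutations no longer occur.\<close>

lemma sym_diag_eq:
  fixes x :: "'v word \<Rightarrow>\<^sub>0 'k::field"
  shows "sym_diag x = both_ne (cop x)"
proof (induction x rule: free_induct)
  case (gen w)
  let ?m = "length w"
  let ?t = "\<lambda>I. sg (inv_sum I w) (both_ne (gen (nths w I, nths w (- I))))"
  have "both_ne (cop (gen w :: _ \<Rightarrow>\<^sub>0 'k)) = (\<Sum>I\<in>Pow {..<?m}. ?t I)"
    by (simp add: cosum_eq_sum_Pow both_ne_def lin_ext_sum lin_ext_sg del: cosum.simps)
  also have "\<dots> = (\<Sum>I\<in>Pow {..<?m} - {{}, {..<?m}}. ?t I)"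
  proof (rule sum.mono_neutral_right)
    show "\<forall>I\<in>Pow {..<?m} - (Pow {..<?m} - {{}, {..<?m}}). ?t I = 0"
    proof
      fix I assume "I \<in> Pow {..<?m} - (Pow {..<?m} - {{}, {..<?m}})"
      then have "nths w I = [] \<or> nths w (- I) = []" using nths_eq_Nil_iff[of I w] by blast
      then show "?t I = 0" by (auto simp: both_ne_def)
    qed
  qed auto
  also have "\<dots> = (\<Sum>I\<in>Pow {..<?m} - {{}, {..<?m}}. sg (inv_sum I w) (gen (nths w I, nths w (- I))))"
    by (rule sum.cong) (auto simp: both_ne_def nths_eq_Nil_iff)
  finally show ?case by (simp add: sym_diag_gen_eq_sum)
qed (auto simp: sym_diag_def both_ne_def lin_ext_add lin_ext_fscale cop_add cop_fscale)

section \<open>Passing between the unital and the reduced coalgebra\<close>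

lemma cosum_split:
  assumes "w \<noteq> []"
  shows "cosum w h = cosum w (\<lambda>a b. if a = [] \<or> b = [] then 0 else h a b) + h w [] + h [] w"
proof -
  have "cosum w h = cosum w (\<lambda>a b. (if a = [] \<or> b = [] then 0 else h a b)
      + (if b = [] then h a [] else 0) + (if a = [] then h [] b else 0))"
    by (rule cosum_cong) (use assms in auto)
  then show ?thesis by (simp add: cosum_add cosum_counit_left cosum_counit_right[where h="\<lambda>a. h a []"])
qed

text \<open>The analogue of \<open>sym_null2\<close> for the tensor square of the unital coalgebra:
  the factor that carries no relation may contain the empty word.\<close>

definition anull2 ::
  "('k::field, 'v::ab_group_add) gvs \<Rightarrow> ('v word \<times> 'v word \<Rightarrow>\<^sub>0 'k) set" where
  "anull2 V = fspan (
     {tens x y | x y. x \<in> sym_null V \<and> y \<in> aspan V} \<union>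
     {tens x y | x y. x \<in> aspan V \<and> y \<in> sym_null V})"

lemma subspace_anull2 [simp]: "fs.subspace (anull2 V)"
  and subspace_sym_null2 [simp]: "fs.subspace (sym_null2 V)"
  by (simp_all add: anull2_def sym_null2_def fs.subspace_span)

lemma sym_free_subset_aspan: "sym_free V \<subseteq> aspan V"
  unfolding sym_free_def by (rule fs.span_mono) (auto simp: words_iff)

lemma sym_null2_subset: "sym_null2 V \<subseteq> anull2 V"
  unfolding sym_null2_def anull2_def
  by (rule fs.span_mono) (use sym_free_subset_aspan in blast)

definition ne_part :: "('a list \<Rightarrow>\<^sub>0 'k::field) \<Rightarrow> ('a list \<Rightarrow>\<^sub>0 'k)" where
  "ne_part = lin_ext (\<lambda>a. if a = [] then 0 else gen a)"

lemma both_ne_eq: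
  "both_ne = lin_ext (\<lambda>(a, b). tens (if a = [] then 0 else gen a) (if b = [] then 0 else gen b))"
  unfolding both_ne_def by (rule arg_cong[where f=lin_ext]) (auto simp: fun_eq_iff)

lemma both_ne_tens: "both_ne (tens x y) = tens (ne_part x) (ne_part y)"
  unfolding both_ne_eq ne_part_def by (rule lin_ext_tens_tens)

lemma both_ne_add: "both_ne (x + y) = both_ne x + both_ne y"
  and both_ne_sg: "both_ne (sg n x) = sg n (both_ne x)"
  by (simp_all add: both_ne_def lin_ext_add lin_ext_sg)

lemma ne_part_id: "x \<in> fspan (gen ` {ys. ys \<noteq> []}) \<Longrightarrow> ne_part x = x"
  by (induction rule: fspan_gen_induct) (auto simp: ne_part_def lin_ext_add lin_ext_fscale)

lemma fspan_words_ne: "x \<in> fspan (gen ` {ys \<in> words W. P ys}) \<Longrightarrow> x \<in> fspan (gen ` {ys. ys \<noteq> []})"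
  by (auto simp: mem_fspan_gen words_iff)

text \<open>No relation involves the empty word, so removing it does nothing to a combination of
  relations.\<close>

lemma ne_part_null:
  assumes "x \<in> sym_null V"
  shows "ne_part x = x"
proof -
  have "ne_part x - x \<in> {0}"
  proof (rule fs.sym_null_image[OF fs.subspace_single_0 _ _ assms])
    show "module_hom fscale fscale (\<lambda>x. ne_part x - x)"
      by unfold_locales (auto simp: ne_part_def lin_ext_add lin_ext_fscale fs.scale_right_diff_distrib
          fs.scale_right_distrib fs.scale_left_distrib)
    show "sym_mod V fscale {0} (\<lambda>w. ne_part (gen w) - gen w)"
      by (rule sym_modI) (auto simp: ne_part_def)
  qed
  then show ?thesis by simp
qed

lemma ne_part_aspan:
  assumes "x \<in> aspan V"
  shows "ne_part x \<in> sym_free V"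
  using assms
  by (induction rule: fspan_gen_induct)
    (auto simp: ne_part_def lin_ext_add lin_ext_fscale sym_free_def words_iff fs.span_zero
      intro: fs.span_add fs.span_scale fs.span_base)

lemma both_ne_anull2:
  assumes "x \<in> anull2 V"
  shows "both_ne x \<in> sym_null2 V"
  using assms unfolding anull2_def
proof (induction rule: fs.span_induct_alt)
  case base
  then show ?case by (simp add: both_ne_def fs.subspace_0)
next
  case (step c x y)
  from step(1) have "both_ne x \<in> sym_null2 V"
    unfolding sym_null2_def
    by (auto simp: both_ne_tens ne_part_null intro!: fs.span_base ne_part_aspan) (metis ne_part_aspan)+
  then show ?case
    using step(2) by (simp add: both_ne_def lin_ext_add lin_ext_fscale fs.subspace_add fs.subspace_scale)
qed

lemma both_ne_cosum: "both_ne (cosum w g) = cosum w (\<lambda>a b. both_ne (g a b))"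
  by (simp add: both_ne_def lin_ext_cosum)

lemma sym_diag_gen:
  "sym_diag (gen w) = cosum w (\<lambda>a b. if a = [] \<or> b = [] then 0 else gen (a, b))"
  by (simp add: sym_diag_eq both_ne_cosum) (simp add: both_ne_def)

text \<open>Compatibility is checked with the unital coproduct, where the recursion is simple;
  deleting the terms with an empty half then gives the reduced statement. This uses that
  \<open>g\<close> sends the unit to the unit and nonempty words to combinations of nonempty
  words.\<close>

lemma coalgebra_homI:
  assumes nil: "g [] = gen []"
    and deg: "\<And>w. w \<in> words V \<Longrightarrow> g w \<in> fspan (gen ` {ys \<in> words W. wdeg ys = wdeg w})"
    and sym: "sym_mod V fscale (sym_null W) g"
    and cop: "\<And>w. w \<in> words V \<Longrightarrow> cop (g w) - cosum w (\<lambda>a b. tens (g a) (g b)) \<in> anull2 W"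
  shows "coalgebra_hom V W (lin_ext g)"
  unfolding coalgebra_hom_def sym_hom_def
proof (intro conjI ballI)
  let ?G = "lin_ext g"
  show "module_hom fscale fscale ?G" by (rule module_hom_lin_ext)
  show "?G (gen xs) \<in> fspan (gen ` {ys \<in> words W. wdeg ys = wdeg xs + 0})" if "xs \<in> words V" for xs
    using deg[OF that] by simp
  show "?G x \<in> sym_null W" if "x \<in> sym_null V" for x
    by (rule fs.sym_null_image[OF _ module_hom_lin_ext _ that]) (auto simp: sym)
  let ?h = "\<lambda>(xs, ys). tens (?G (gen xs)) (?G (gen ys))"
  fix x assume "x \<in> sym_free V"
  then show "sym_diag (?G x) - lin_ext ?h (sym_diag x) \<in> sym_null2 W"
    unfolding sym_free_def
  proof (induction rule: fspan_gen_induct)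
    case zero
    then show ?case by (simp add: sym_diag_def fs.subspace_0)
  next
    case (gen w)
    then have w: "w \<in> awords V" by (simp add: words_iff)
    have ne: "ne_part (g a) = (if a = [] then 0 else g a)" if "a \<in> awords V" for a
      using that nil ne_part_id[OF fspan_words_ne[OF deg]] by (auto simp: words_iff) (simp add: ne_part_def)
    have "both_ne (cosum w (\<lambda>a b. tens (g a) (g b))) = lin_ext ?h (sym_diag (gen w))"
      unfolding both_ne_cosum sym_diag_gen lin_ext_cosum both_ne_tens
      by (rule cosum_cong) (use cosum_awords[OF w] ne in auto)
    with both_ne_anull2[OF cop[OF gen]] show ?case
      by (simp add: sym_diag_eq both_ne_def lin_ext_diff)
  next
    case (add x y)
    from fs.subspace_add[OF subspace_sym_null2 this] show ?case
      by (simp add: lin_ext_add sym_diag_def algebra_simps)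
  next
    case (scale c x)
    from fs.subspace_scale[OF subspace_sym_null2 this] show ?case
      by (simp add: lin_ext_fscale sym_diag_def fs.scale_right_diff_distrib)
  qed
qed

definition unital :: "(('v word \<Rightarrow>\<^sub>0 'k::field) \<Rightarrow> ('w word \<Rightarrow>\<^sub>0 'k)) \<Rightarrow> 'v word \<Rightarrow> ('w word \<Rightarrow>\<^sub>0 'k)" where
  "unital F w = (if w = [] then gen [] else F (gen w))"

text \<open>The converse passage to \<open>coalgebra_homI\<close>: on the unital side each coproduct
  gains the two terms with an empty half, and these agree because \<open>unital F\<close> preserves
  the unit.\<close>

lemma coalgebra_homD:
  fixes F :: "((int \<times> 'v::ab_group_add) list \<Rightarrow>\<^sub>0 'k::field) \<Rightarrow> ((int \<times> 'w::ab_group_add) list \<Rightarrow>\<^sub>0 'k)"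
  assumes F: "coalgebra_hom V W F" and w: "w \<in> awords V"
  shows "unital F w \<in> fspan (gen ` {ys \<in> awords W. wdeg ys = wdeg w})"
    and "w \<noteq> [] \<Longrightarrow> unital F w \<in> fspan (gen ` {ys \<in> words W. wdeg ys = wdeg w})"
    and "cop (unital F w) - cosum w (\<lambda>a b. tens (unital F a) (unital F b)) \<in> anull2 W"
proof -
  have deg: "F (gen w) \<in> fspan (gen ` {ys \<in> words W. wdeg ys = wdeg w})" if "w \<noteq> []"
    using F w that by (auto simp: coalgebra_hom_def sym_hom_def words_iff)
  then show "w \<noteq> [] \<Longrightarrow> unital F w \<in> fspan (gen ` {ys \<in> words W. wdeg ys = wdeg w})"
    by (simp add: unital_def)
  then show "unital F w \<in> fspan (gen ` {ys \<in> awords W. wdeg ys = wdeg w})"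
  proof (cases "w = []")
    case True then show ?thesis by (auto simp: unital_def intro!: fs.span_base)
  next
    case False
    from deg[OF this] show ?thesis
      using False by (auto simp: unital_def mem_fspan_gen words_iff)
  qed
  show "cop (unital F w) - cosum w (\<lambda>a b. tens (unital F a) (unital F b)) \<in> anull2 W"
  proof (cases "w = []")
    case True then show ?thesis by (simp add: unital_def fs.subspace_0)
  next
    case False
    let ?y = "F (gen w)"
    have "?y \<in> fspan (gen ` {ys. ys \<noteq> []})" by (rule fspan_words_ne[OF deg[OF False]])
    then have 1: "cop ?y = sym_diag ?y + tens ?y (gen []) + tens (gen []) ?y"
    proof (induction rule: fspan_gen_induct)
      case (gen a)
      then show ?case
        using cosum_split[of a "\<lambda>a b. gen (a, b) :: _ \<Rightarrow>\<^sub>0 'k"] by (simp add: sym_diag_gen)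
    qed (simp_all add: sym_diag_def cop_add cop_fscale lin_ext_add lin_ext_fscale tens_add_left
        tens_add_right tens_scale_left tens_scale_right fs.scale_right_distrib)
    have 2: "cosum w (\<lambda>a b. tens (unital F a) (unital F b)) =
        lin_ext (\<lambda>(xs, ys). tens (F (gen xs)) (F (gen ys))) (sym_diag (gen w)) + tens ?y (gen []) + tens (gen []) ?y"
      unfolding cosum_split[OF False, of "\<lambda>a b. tens (unital F a) (unital F b)"] sym_diag_gen lin_ext_cosum
      using False by (auto simp: unital_def intro!: cosum_cong)
    have "gen w \<in> sym_free V"
      using w False by (auto simp: sym_free_def words_iff intro!: fs.span_base)
    then have "sym_diag ?y - lin_ext (\<lambda>(xs, ys). tens (F (gen xs)) (F (gen ys))) (sym_diag (gen w)) \<in> sym_null2 W"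
      using F by (simp add: coalgebra_hom_def)
    then have "cop ?y - cosum w (\<lambda>a b. tens (unital F a) (unital F b)) \<in> sym_null2 W"
      unfolding 1 2 by simp
    then show ?thesis using sym_null2_subset[of W] False by (auto simp: unital_def)
  qed
qed

lemma sym_mod_unital:
  assumes F: "coalgebra_hom V W F"
  shows "sym_mod V fscale (sym_null W) (unital F)"
proof -
  have "module_hom fscale fscale F" "\<And>x. x \<in> sym_null V \<Longrightarrow> F x \<in> sym_null W"
    using F by (auto simp: coalgebra_hom_def sym_hom_def)
  from sym_mod_comp[OF sym_mod_gen this]
  have F': "sym_mod V fscale (sym_null W) (\<lambda>w. F (gen w))" .
  show ?thesis
    by (rule sym_modI) (auto simp: unital_def sym_modD[OF F'])
qed

lemma coderivation_cder:
  fixes V :: "('k::field, 'v::ab_group_add) gvs"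
  assumes V: "is_gvs V"
    and c: "sym_mod V (gscale V) {0} c"
    and cm: "\<And>xs. xs \<in> words V \<Longrightarrow> c xs \<in> gcomp V (wdeg xs + e)"
  shows "coderivation e V (lin_ext (cder e c))"
  unfolding coderivation_def sym_hom_def
proof (intro conjI ballI)
  let ?D = "lin_ext (cder e c) :: _ \<Rightarrow> (_ \<Rightarrow>\<^sub>0 'k)"
  show "module_hom fscale fscale ?D" by (rule module_hom_lin_ext)
  show "?D (gen xs) \<in> fspan (gen ` {ys \<in> words V. wdeg ys = wdeg xs + e})" if "xs \<in> words V" for xs
    using cder_mem[of V c e xs] cm that by (simp add: words_iff)
  show "?D x \<in> sym_null V" if "x \<in> sym_null V" for x
    by (rule fs.sym_null_image[OF _ module_hom_lin_ext _ that]) (auto intro!: sym_mod_cder c V cm)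
  let ?h = "\<lambda>(xs, ys). tens (?D (gen xs)) (gen ys) + fscale (sgn_pow (e * wdeg xs)) (tens (gen xs) (?D (gen ys)))"
  fix x :: "'v word \<Rightarrow>\<^sub>0 'k"
  have "sym_diag (?D x) = lin_ext ?h (sym_diag x)"
  proof (induction x rule: free_induct)
    case (gen w)
    have "(cder e c u :: _ \<Rightarrow>\<^sub>0 'k) \<in> fspan (gen ` {ys. ys \<noteq> []})" for u
      by (rule set_mp[OF fs.span_mono cder_deg]) auto
    note ne = ne_part_id[OF this]
    have co: "coder e ?D" by (rule coder_cder)
    have "sym_diag (?D (gen w)) = both_ne (cop (?D (gen w)))" by (rule sym_diag_eq)
    also have "cop (?D (gen w)) = lder e ?D (cop (gen w))" using co unfolding coder_def by blast
    also have "both_ne \<dots> = cosum w (\<lambda>a b. tens (cder e c a) (ne_part (gen b)) + sg (e * wdeg a) (tens (ne_part (gen a)) (cder e c b)))"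
      unfolding cop_gen lder_def lin_ext_cosum both_ne_cosum
      by (rule cosum_cong) (simp add: both_ne_add both_ne_sg both_ne_tens ne)
    also have "\<dots> = lin_ext ?h (sym_diag (gen w))"
      unfolding sym_diag_gen lin_ext_cosum
      by (rule cosum_cong) (auto simp: ne_part_def fs.scale_sgn_pow)
    finally show ?case .
  qed (simp_all add: sym_diag_def lin_ext_add lin_ext_fscale)
  then show "sym_diag (?D x) - lin_ext ?h (sym_diag x) \<in> sym_null2 V"
    by (simp add: fs.subspace_0)
qed

section \<open>Projection onto the generators\<close>

lemma sym_proj_eq: "is_gvs V \<Longrightarrow> sym_proj V i = glin (gscale V) (\<lambda>ws. if length ws = 1 \<and> wdeg ws = i then snd (hd ws) else 0)"
proof -
  assume "is_gvs V"
  then interpret vector_space "gscale V" by (simp add: is_gvs_def)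
  show ?thesis unfolding sym_proj_def[abs_def] glin_def by (auto intro!: sum.cong ext)
qed

lemma sym_proj_facts:
  assumes "is_gvs V"
  shows sym_proj_add: "sym_proj V i (x + y) = sym_proj V i x + sym_proj V i y"
    and sym_proj_diff: "sym_proj V i (x - y) = sym_proj V i x - sym_proj V i y"
    and sym_proj_fscale: "sym_proj V i (fscale c x) = gscale V c (sym_proj V i x)"
    and sym_proj_zero: "sym_proj V i 0 = 0"
    and sym_proj_gen: "sym_proj V i (gen ws) = (if length ws = 1 \<and> wdeg ws = i then snd (hd ws) else 0)"
    and module_hom_sym_proj: "module_hom fscale (gscale V) (sym_proj V i)"
proof -
  interpret vector_space "gscale V" using assms by (simp add: is_gvs_def)
  show "sym_proj V i (x + y) = sym_proj V i x + sym_proj V i y"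
    "sym_proj V i (x - y) = sym_proj V i x - sym_proj V i y"
    "sym_proj V i (fscale c x) = gscale V c (sym_proj V i x)"
    "sym_proj V i 0 = 0"
    "sym_proj V i (gen ws) = (if length ws = 1 \<and> wdeg ws = i then snd (hd ws) else 0)"
    "module_hom fscale (gscale V) (sym_proj V i)"
    unfolding sym_proj_eq[OF assms]
    by (simp_all add: glin_add glin_diff glin_fscale module_hom_glin)
qed

lemma sym_proj_null:
  assumes V: "is_gvs V" and "x \<in> sym_null V"
  shows "sym_proj V i x = 0"
proof -
  interpret vector_space "gscale V" using V by (simp add: is_gvs_def)
  have "sym_proj V i x \<in> {0}"
    by (rule sym_null_image[OF subspace_single_0 module_hom_sym_proj[OF V] _ assms(2)])
      (rule sym_modI; auto simp: sym_proj_gen[OF V] append_eq_Cons_conv)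
  then show ?thesis by simp
qed

lemma sym_proj_mem:
  assumes V: "is_gvs V" and "x \<in> aspan V"
  shows "sym_proj V i x \<in> gcomp V i"
  using assms(2)
proof (induction rule: fspan_gen_induct)
  case (gen ws)
  then show ?case
    using is_gvsD(2)[OF V] by (cases ws) (auto simp: sym_proj_gen[OF V] wdeg_def)
qed (use V is_gvsD[OF V] in \<open>auto simp: sym_proj_zero sym_proj_add sym_proj_fscale\<close>)

lemma sym_proj_deg:
  assumes V: "is_gvs V" and "x \<in> fspan (gen ` {ws. wdeg ws = j})" and "i \<noteq> j"
  shows "sym_proj V i x = 0"
  using assms(2)
proof (induction rule: fspan_gen_induct)
  case (gen ws) then show ?case using assms(3) by (simp add: sym_proj_gen[OF V])
next
  case (scale c x)
  interpret vector_space "gscale V" using V by (simp add: is_gvs_def)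
  from scale show ?case by (simp add: sym_proj_fscale[OF V])
qed (use V in \<open>auto simp: sym_proj_zero sym_proj_add sym_proj_fscale\<close>)

text \<open>Only the term in which \<open>c\<close> consumes the whole word has length 1.\<close>

lemma has_components_cder:
  assumes V: "is_gvs V"
  shows "has_components e V V (lin_ext (cder e c)) c"
  unfolding has_components_def
proof (intro ballI allI)
  fix xs i assume xs: "xs \<in> words V"
  have "sym_proj V i (lin_ext (cder e c) (gen xs)) =
      cosum xs (\<lambda>a b. if b = [] then if i = wdeg a + e \<and> a \<noteq> [] then c a else 0 else 0)"
    unfolding lin_ext_gen cder_def cosum_hom[where \<Phi>="sym_proj V i", OF sym_proj_add[OF V]]
    by (rule cosum_cong) (auto simp: sym_proj_zero[OF V] sym_proj_gen[OF V])
  then show "sym_proj V i (lin_ext (cder e c) (gen xs)) = (if i = wdeg xs + e then c xs else 0)"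
    using xs by (simp add: cosum_counit_right words_iff)
qed

section \<open>Uniqueness of coderivations\<close>

lemma lmul_gen [simp]: "lmul z (gen w) = gen (z # w)"
  and lmul_add: "lmul z (x + y) = lmul z x + lmul z y"
  and lmul_diff: "lmul z (x - y) = lmul z x - lmul z y"
  and lmul_fscale: "lmul z (fscale c x) = fscale c (lmul z x)"
  and lmul_zero [simp]: "lmul z 0 = 0"
  and lmul_sg: "lmul z (sg n x) = sg n (lmul z x)"
  and module_hom_lmul: "module_hom fscale fscale (lmul z)"
  by (simp_all add: lmul_def lin_ext_add lin_ext_diff lin_ext_fscale lin_ext_sg module_hom_lin_ext)

lemma lmul_null:
  assumes "x \<in> sym_null V" "snd z \<in> gcomp V (fst z)"
  shows "lmul z x \<in> sym_null V"
  by (rule fs.sym_null_image[OF subspace_sym_null module_hom_lmul _ assms(1)])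
    (use assms(2) in \<open>auto intro: sym_mod_Cons[OF sym_mod_gen]\<close>)

lemma sym_mod_gen_append_left: "a \<in> awords V \<Longrightarrow> sym_mod V fscale (sym_null V) (\<lambda>w. gen (a @ w))"
proof (induction a)
  case Nil then show ?case by (simp add: sym_mod_gen)
next
  case (Cons z a)
  then have IH: "sym_mod V fscale (sym_null V) (\<lambda>w. gen (a @ w))" and z: "snd z \<in> gcomp V (fst z)"
    by auto
  from sym_mod_comp[OF IH module_hom_lmul lmul_null[OF _ z]] show ?case by simp
qed

lemma sym_mod_gen_append_right:
  assumes "b \<in> awords V"
  shows "sym_mod V fscale (sym_null V) (\<lambda>w. gen (w @ b))"
proof (rule sym_modI, goal_cases)
  case (1 xs i x y ys)
  then show ?case using sym_modD(1)[OF sym_mod_gen 1(1) _ 1(3,4), of "ys @ b"] assms by simp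
next
  case (2 xs i c x ys)
  then show ?case using sym_modD(2)[OF sym_mod_gen 2(1) _ 2(3), of "ys @ b"] assms by simp
next
  case (3 xs i x j y ys)
  then show ?case using sym_modD(3)[OF sym_mod_gen 3(1) _ 3(3,4), of "ys @ b"] assms by simp
qed

text \<open>Reordering modulo the relations costs exactly the Koszul sign that the unshuffle
  introduced, so the two signs cancel.\<close>

lemma gen_move_front:
  assumes "a \<in> awords V" "b \<in> awords V" "snd z \<in> gcomp V (fst z)"
  shows "sg (fst z * wdeg a) (gen (a @ z # b)) - gen (z # a @ b) \<in> sym_null V"
  using assms(1)
proof (induction a)
  case Nil then show ?case by (simp add: fs.subspace_0)
next
  case (Cons y a)
  have 1: "lmul y (sg (fst z * wdeg a) (gen (a @ z # b)) - gen (z # a @ b)) \<in> sym_null V"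
    using Cons by (intro lmul_null) auto
  have 2: "gen (y # z # a @ b) - sg (fst y * fst z) (gen (z # y # a @ b)) \<in> sym_null V"
    using Cons.prems assms by (intro gen_swap) auto
  from fs.subspace_sg[OF subspace_sym_null fs.subspace_add[OF subspace_sym_null 1 2], of "fst z * fst y"]
  show ?case
    by (simp add: lmul_diff lmul_sg sg_sg sg_diff algebra_simps)
qed

definition concat_map :: "('a list \<times> 'a list \<Rightarrow>\<^sub>0 'k::field) \<Rightarrow> ('a list \<Rightarrow>\<^sub>0 'k)" where
  "concat_map = lin_ext (\<lambda>(a, b). gen (a @ b))"

text \<open>Each of the \<open>2 ^ length w\<close> unshuffles, glued together again, is the
  original word modulo the relations; the leading letter doubles the count because both of its
  placements give the same class.\<close>

lemma concat_unshuffles: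
  fixes V :: "('k::field, 'v::ab_group_add) gvs"
  assumes "w \<in> awords V"
  shows "cosum w (\<lambda>a b. gen (a @ b)) - fscale (2 ^ length w) (gen w) \<in> sym_null V"
  using assms
proof (induction w)
  case Nil then show ?case by (simp add: fs.subspace_0)
next
  case (Cons z w)
  let ?N = "sym_null V"
  let ?X = "cosum w (\<lambda>a b. gen (a @ b)) :: _ \<Rightarrow>\<^sub>0 'k"
  have lc: "lmul z ?X = cosum w (\<lambda>a b. gen (z # a @ b))"
    unfolding cosum_hom[where \<Phi>="lmul z", OF lmul_add] by simp
  have "cosum w (\<lambda>a b. gen (z # a @ b) + sg (fst z * wdeg a) (gen (a @ z # b)))
     - cosum w (\<lambda>a b. gen (z # a @ b) + gen (z # a @ b)) \<in> ?N"
  proof (rule fs.cosum_cong_mod[OF subspace_sym_null])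
    fix a b assume *: "set a \<union> set b = set w"
    have ab: "a \<in> awords V" "b \<in> awords V"
      using Cons.prems by (auto intro: cosum_awords[OF _ *])
    show "gen (z # a @ b) + sg (fst z * wdeg a) (gen (a @ z # b)) - (gen (z # a @ b) + gen (z # a @ b)) \<in> ?N"
      using gen_move_front[OF ab, of z] Cons.prems by simp
  qed
  then have 1: "cosum (z # w) (\<lambda>a b. gen (a @ b)) - (lmul z ?X + lmul z ?X) \<in> ?N"
    by (simp add: cosum_add lc)
  have 2: "lmul z (?X - fscale (2 ^ length w) (gen w)) \<in> ?N"
    using Cons by (intro lmul_null) auto
  have "fscale (2 ^ length (z # w) :: 'k) (gen (z # w)) =
     fscale (2 ^ length w) (gen (z # w)) + fscale (2 ^ length w) (gen (z # w))"
    by (simp flip: fs.scale_left_distrib)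
  then have eq: "cosum (z # w) (\<lambda>a b. gen (a @ b)) - fscale (2 ^ length (z # w) :: 'k) (gen (z # w)) =
    (cosum (z # w) (\<lambda>a b. gen (a @ b)) - (lmul z ?X + lmul z ?X))
     + lmul z (?X - fscale (2 ^ length w) (gen w)) + lmul z (?X - fscale (2 ^ length w) (gen w))"
    by (simp add: lmul_diff lmul_fscale)
  show ?case
    unfolding eq by (intro fs.subspace_add subspace_sym_null 1 2)
qed

text \<open>The relations form a two-sided ideal for concatenation.\<close>

lemma concat_map_null2:
  assumes "x \<in> sym_null2 V"
  shows "concat_map x \<in> sym_null V"
  using assms unfolding sym_null2_def
proof (induction rule: fs.span_induct_alt)
  case base then show ?case by (simp add: concat_map_def fs.subspace_0)
next
  case (step c x y)
  have left: "concat_map (tens u v) \<in> sym_null V" if u: "u \<in> sym_null V" and v: "v \<in> sym_free V" for u v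
    using v unfolding sym_free_def
  proof (induction rule: fspan_gen_induct)
    case (gen b)
    have "concat_map (tens u (gen b)) = lin_ext (\<lambda>a. gen (a @ b)) u"
      by (simp add: concat_map_def lin_ext_tens)
    also have "\<dots> \<in> sym_null V"
      using gen by (intro fs.sym_null_image[OF subspace_sym_null module_hom_lin_ext _ u])
        (auto simp: words_iff sym_mod_gen_append_right)
    finally show ?case .
  qed (auto simp: concat_map_def tens_add_right tens_scale_right lin_ext_add lin_ext_fscale fs.subspace_0
      fs.subspace_add fs.subspace_scale)
  have right: "concat_map (tens v u) \<in> sym_null V" if u: "u \<in> sym_null V" and v: "v \<in> sym_free V" for u v
    using v unfolding sym_free_def
  proof (induction rule: fspan_gen_induct)
    case (gen b)
    have "concat_map (tens (gen b) u) = lin_ext (\<lambda>a. gen (b @ a)) u"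
      by (simp add: concat_map_def lin_ext_tens)
    also have "\<dots> \<in> sym_null V"
      using gen by (intro fs.sym_null_image[OF subspace_sym_null module_hom_lin_ext _ u])
        (auto simp: words_iff sym_mod_gen_append_left)
    finally show ?case .
  qed (auto simp: concat_map_def tens_add_left tens_scale_left lin_ext_add lin_ext_fscale fs.subspace_0
      fs.subspace_add fs.subspace_scale)
  from step(1) have "concat_map x \<in> sym_null V" using left right by auto
  then show ?case
    using step(2) by (simp add: concat_map_def lin_ext_add lin_ext_fscale fs.subspace_add fs.subspace_scale)
qed

text \<open>Concatenating the halves of the reduced diagonal multiplies a word of length \<open>m\<close> by
  \<open>2 ^ m - 2\<close>, which is invertible for \<open>m \<ge> 2\<close> in characteristic zero.\<close>

lemma primitive_null:
  fixes V :: "('k::field_char_0, 'v::ab_group_add) gvs"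
  assumes V: "is_gvs V" and y: "y \<in> fspan (gen ` {ys \<in> words V. wdeg ys = d})"
    and diag: "sym_diag y \<in> sym_null2 V" and proj: "sym_proj V d y = 0"
  shows "y \<in> sym_null V"
proof -
  let ?N = "sym_null V"
  note N = subspace_sym_null[of V]
  \<comment> \<open>The inverse of the factor \<open>2 ^ n - 2\<close>. For words of length 1 the
    reduced diagonal vanishes and the factor is 0; there the value is set to 0 and the projection to
    the generators takes over.\<close>
  define f :: "nat \<Rightarrow> 'k" where "f n = (if n \<ge> 2 then 1 / (2 ^ n - 2) else 0)" for n
  define S :: "('v word \<Rightarrow>\<^sub>0 'k) \<Rightarrow> ('v word \<Rightarrow>\<^sub>0 'k)"
    where "S = lin_ext (\<lambda>u. fscale (f (length u)) (gen u))"
  have S_null: "S x \<in> ?N" if "x \<in> ?N" for x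
    unfolding S_def
    by (rule fs.sym_null_image[OF N module_hom_lin_ext _ that])
      (simp add: fs.sym_mod_length_scale sym_mod_gen)
  define T where "T x = S (concat_map (sym_diag x))" for x :: "'v word \<Rightarrow>\<^sub>0 'k"
  have T_lin: "T (x + x') = T x + T x'" "T (fscale c x) = fscale c (T x)" "T 0 = 0" for x x' c
    by (simp_all add: T_def S_def concat_map_def sym_diag_def lin_ext_add lin_ext_fscale)
  \<comment> \<open>An element is recovered from its reduced diagonal, through \<open>T\<close>, and
    from its linear part; \<open>?r\<close> is the error, shown to be null.\<close>
  let ?r = "\<lambda>x. x - T x - gen [(d, sym_proj V d x)]"
  note P = sym_proj_facts[OF V]
  note G = sym_modD[OF sym_mod_gen[where V=V], of "[]" "[]", simplified]
  have zero: "gen [(d, 0)] \<in> ?N" using gen_zero_letter[OF V, of "[]" "[]"] by simp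
  have mem: "sym_proj V d x \<in> gcomp V d" if "x \<in> fspan (gen ` {ys \<in> words V. wdeg ys = d})" for x
    using that sym_free_subset_aspan[of V]
    by (intro sym_proj_mem[OF V]) (auto simp: mem_fspan_gen words_iff)
  \<comment> \<open>Membership in the graded span is carried along because additivity of the letter
    \<open>sym_proj V d x\<close> is available only for elements of
    \<open>gcomp V d\<close>.\<close>
  have "?r y \<in> ?N \<and> y \<in> fspan (gen ` {ys \<in> words V. wdeg ys = d})"
    using y
  proof (induction rule: fspan_gen_induct)
    case zero
    then show ?case using \<open>gen [(d, 0)] \<in> ?N\<close> by (simp add: T_lin P fs.subspace_neg fs.span_zero)
  next
    case (gen u)
    then have u: "u \<in> awords V" "u \<noteq> []" "wdeg u = d" by (auto simp: words_iff)
    have "concat_map (sym_diag (gen u :: _ \<Rightarrow>\<^sub>0 'k)) = cosum u (\<lambda>a b. if a = [] \<or> b = [] then 0 else gen (a @ b))"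
      unfolding sym_diag_gen concat_map_def lin_ext_cosum by (intro cosum_cong) auto
    then have "concat_map (sym_diag (gen u :: _ \<Rightarrow>\<^sub>0 'k)) = cosum u (\<lambda>a b. gen (a @ b)) - gen u - gen u"
      using cosum_split[OF u(2), of "\<lambda>a b. gen (a @ b) :: _ \<Rightarrow>\<^sub>0 'k"] by simp
    then have "T (gen u) = S (cosum u (\<lambda>a b. gen (a @ b))) - S (gen u) - S (gen u)"
      by (simp only: T_def S_def lin_ext_diff)
    moreover have "fscale (f (length u) * (2 ^ length u - 2)) (gen u) = S (fscale (2 ^ length u) (gen u)) - S (gen u) - S (gen u)"
    proof -
      have eq: "f (length u) * (2 ^ length u - 2) = 2 ^ length u * f (length u) - f (length u) - f (length u)"
        by (simp add: algebra_simps)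
      show ?thesis unfolding eq by (simp only: S_def lin_ext_fscale lin_ext_gen fs.scale_left_diff_distrib fs.scale_scale)
    qed
    ultimately have "T (gen u) = S (cosum u (\<lambda>a b. gen (a @ b)) - fscale (2 ^ length u) (gen u))
        + fscale (f (length u) * (2 ^ length u - 2)) (gen u)"
      by (simp add: S_def lin_ext_diff)
    with S_null[OF concat_unshuffles[OF u(1)]]
    have Tu: "T (gen u) - fscale (f (length u) * (2 ^ length u - 2)) (gen u) \<in> ?N" by simp
    show ?case
    proof (cases "length u \<ge> 2")
      case True
      have "(2::'k) ^ length u \<noteq> 2"
      proof
        assume "(2::'k) ^ length u = 2"
        then have "of_nat (2 ^ length u) = (of_nat 2 :: 'k)" by simp
        then have "(2::nat) ^ length u = 2 ^ 1" unfolding of_nat_eq_iff by simp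
        then have "length u = 1" using power_inject_exp[of "2::nat" "length u" 1] by simp
        with True show False by simp
      qed
      then have "f (length u) * (2 ^ length u - 2) = 1" using True by (simp add: f_def)
      moreover have "sym_proj V d (gen u) = 0" using True by (simp add: P)
      ultimately show ?thesis
        using fs.subspace_diff[OF N fs.subspace_neg[OF N Tu] zero] gen
        by (auto simp: algebra_simps intro!: fs.span_base)
    next
      case False
      with u(2) have "length u = 1" using length_greater_0_conv[of u] by linarith
      then obtain z where z: "u = [z]" by (auto simp: length_Suc_conv)
      then have "gen [(d, sym_proj V d (gen u))] = (gen u :: _ \<Rightarrow>\<^sub>0 'k)" using u(3) by (cases z) (simp add: P)
      moreover have "f (length u) = 0" using z by (simp add: f_def)
      ultimately show ?thesis
        using fs.subspace_neg[OF N Tu] gen by (auto intro!: fs.span_base)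
    qed
  next
    case (add x x')
    have "gen [(d, sym_proj V d x + sym_proj V d x')] - gen [(d, sym_proj V d x)] - gen [(d, sym_proj V d x')] \<in> ?N"
      using add mem by (intro G(1)) auto
    from fs.subspace_diff[OF N fs.subspace_add[OF N add[THEN conjunct1]] this]
    show ?case using add by (auto simp: T_lin P algebra_simps intro: fs.span_add)
  next
    case (scale c x)
    have "gen [(d, gscale V c (sym_proj V d x))] - fscale c (gen [(d, sym_proj V d x)]) \<in> ?N"
      using scale mem by (intro G(2)) auto
    from fs.subspace_diff[OF N fs.subspace_scale[OF N scale[THEN conjunct1], of c] this]
    show ?case using scale by (auto simp: T_lin P fs.scale_right_diff_distrib diff_diff_eq2 intro: fs.span_scale)
  qed
  moreover have "T y \<in> ?N"
    unfolding T_def by (intro S_null concat_map_null2 diag)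
  ultimately have "y - gen [(d, sym_proj V d y)] \<in> ?N"
    using fs.subspace_add[OF N] by fastforce
  then have "y - gen [(d, 0)] \<in> ?N" by (simp add: proj)
  from fs.subspace_add[OF N this zero] show ?thesis by simp
qed

text \<open>By induction on word length: the diagonal of the difference on \<open>w\<close> involves
  the two coderivations only on proper subwords, where they agree modulo the relations. The
  difference is then primitive, and its linear part vanishes because the components agree.\<close>

lemma coderivation_unique:
  fixes V :: "('k::field_char_0, 'v::ab_group_add) gvs"
  assumes V: "is_gvs V"
    and D1: "coderivation e V D1" "has_components e V V D1 c"
    and D2: "coderivation e V D2" "has_components e V V D2 c"
    and x: "x \<in> sym_free V"
  shows "D1 x - D2 x \<in> sym_null V"
proof -
  interpret D1: module_hom fscale fscale D1 using D1 by (simp add: coderivation_def sym_hom_def)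
  interpret D2: module_hom fscale fscale D2 using D2 by (simp add: coderivation_def sym_hom_def)
  note N = subspace_sym_null[of V]
  have gen: "D1 (gen w) - D2 (gen w) \<in> sym_null V" if "w \<in> words V" for w
    using that
  proof (induction "length w" arbitrary: w rule: less_induct)
    case less
    have w: "w \<in> awords V" "gen w \<in> sym_free V"
      using less.prems by (auto simp: words_iff sym_free_def intro!: fs.span_base)
    let ?y = "D1 (gen w) - D2 (gen w)"
    let ?h = "\<lambda>D (xs, ys). tens (D (gen xs)) (gen ys) + fscale (sgn_pow (e * wdeg xs)) (tens (gen xs) (D (gen ys)))"
    show ?case
    proof (rule primitive_null[OF V])
      show "?y \<in> fspan (gen ` {ys \<in> words V. wdeg ys = wdeg w + e})"
        using D1 D2 less.prems by (auto simp: coderivation_def sym_hom_def intro!: fs.span_diff)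
      show "sym_proj V (wdeg w + e) ?y = 0"
        using D1(2) D2(2) less.prems by (simp add: has_components_def sym_proj_diff[OF V])
      have 1: "sym_diag (D1 (gen w)) - lin_ext (?h D1) (sym_diag (gen w)) \<in> sym_null2 V"
        and 2: "sym_diag (D2 (gen w)) - lin_ext (?h D2) (sym_diag (gen w)) \<in> sym_null2 V"
        using D1(1) D2(1) w by (auto simp: coderivation_def)
      have 3: "lin_ext (?h D1) (sym_diag (gen w)) - lin_ext (?h D2) (sym_diag (gen w)) \<in> sym_null2 V"
        unfolding sym_diag_gen lin_ext_cosum
      proof (rule fs.cosum_cong_mod[OF subspace_sym_null2])
        fix a b assume *: "length a + length b = length w" "set a \<union> set b = set w"
        note ab = cosum_awords[OF w(1) *(2)]
        show "lin_ext (?h D1) (if a = [] \<or> b = [] then 0 else gen (a, b))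
           - lin_ext (?h D2) (if a = [] \<or> b = [] then 0 else gen (a, b)) \<in> sym_null2 V"
        proof (cases "a = [] \<or> b = []")
          case False
          then have ab': "a \<in> words V" "b \<in> words V" "length a < length w" "length b < length w"
            using ab *(1) length_greater_0_conv[of a] length_greater_0_conv[of b]
            by (auto simp: words_iff simp del: length_greater_0_conv)
          then have fr: "gen a \<in> sym_free V" "gen b \<in> sym_free V"
            by (auto simp: sym_free_def intro!: fs.span_base)
          have "tens (D1 (gen a) - D2 (gen a)) (gen b) \<in> sym_null2 V"
            "tens (gen a) (D1 (gen b) - D2 (gen b)) \<in> sym_null2 V"
            unfolding sym_null2_def
            using less.hyps[OF ab'(3,1)] less.hyps[OF ab'(4,2)] fr by (auto intro!: fs.span_base)
          from fs.subspace_add[OF subspace_sym_null2 this(1) fs.subspace_scale[OF subspace_sym_null2 this(2), of "sgn_pow (e * wdeg a)"]]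
          show ?thesis
            using False by (simp add: tens_diff_left tens_diff_right fs.scale_right_diff_distrib algebra_simps)
        qed (auto simp: fs.subspace_0)
      qed
      have "sym_diag ?y = (sym_diag (D1 (gen w)) - lin_ext (?h D1) (sym_diag (gen w)))
          - (sym_diag (D2 (gen w)) - lin_ext (?h D2) (sym_diag (gen w)))
          + (lin_ext (?h D1) (sym_diag (gen w)) - lin_ext (?h D2) (sym_diag (gen w)))"
        by (simp add: sym_diag_def lin_ext_diff)
      then show "sym_diag ?y \<in> sym_null2 V"
        using fs.subspace_add[OF subspace_sym_null2 fs.subspace_diff[OF subspace_sym_null2 1 2] 3] by simp
    qed
  qed
  from x show ?thesis unfolding sym_free_def
  proof (induction rule: fspan_gen_induct)
    case zero then show ?case by (simp add: D1.zero D2.zero fs.subspace_0)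
  next
    case (gen a) then show ?case by (rule \<open>\<And>w. w \<in> words V \<Longrightarrow> D1 (gen w) - D2 (gen w) \<in> sym_null V\<close>)
  next
    case (add x y)
    from fs.subspace_add[OF N this] show ?case by (simp add: D1.add D2.add algebra_simps)
  next
    case (scale c x)
    from fs.subspace_scale[OF N this, of c] show ?case
      by (simp add: D1.scale D2.scale fs.scale_right_diff_distrib)
  qed
qed

section \<open>Suspension\<close>

lemma susp_simps [simp]: "gscale (susp V) = gscale V" "gcomp (susp V) i = gcomp V (i - 1)"
  by (simp_all add: susp_def)

lemma is_gvs_susp: "is_gvs V \<Longrightarrow> is_gvs (susp V)"
  by (simp add: is_gvs_def)

definition shift :: "int \<Rightarrow> 'v word \<Rightarrow> 'v word" where
  "shift n = map (\<lambda>(i, x). (i + n, x))"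

lemma shift_simps [simp]:
  "shift n [] = []" "shift n (z # xs) = (fst z + n, snd z) # shift n xs"
  "shift n (xs @ ys) = shift n xs @ shift n ys" "length (shift n xs) = length xs"
  "shift n xs = [] \<longleftrightarrow> xs = []"
  by (auto simp: shift_def split: prod.splits)

text \<open>The two signs of \<open>susp_components\<close> merged into one recursive exponent: each
  letter contributes, per later letter, 1 from \<open>k (k - 1) / 2\<close> and its degree from the
  Koszul rule for the desuspension.\<close>

fun susp_exp :: "'v word \<Rightarrow> int" where
  "susp_exp [] = 0"
| "susp_exp (z # xs) = int (length xs) * (1 + fst z) + susp_exp xs"

lemma susp_components_eq:
  assumes "vector_space (gscale W)"
  shows "susp_components W g xs = sg (susp_exp xs) (g (shift (- 1) xs))"
proof -
  interpret vector_space "gscale W" by fact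
  have tri: "int (Suc k * (Suc k - 1) div 2) = int k + int (k * (k - 1) div 2)" for k
  proof -
    have "Suc k * (Suc k - 1) = k * (k - 1) + 2 * k" by (cases k) auto
    then have "Suc k * (Suc k - 1) div 2 = (k * (k - 1) + 2 * k) div 2" by metis
    also have "\<dots> = k * (k - 1) div 2 + k" by simp
    finally show ?thesis by simp
  qed
  have "int (length xs * (length xs - 1) div 2) + (\<Sum>j<length xs. int (length xs - 1 - j) * fst (xs ! j)) = susp_exp xs"
  proof (induction xs)
    case (Cons z xs)
    have "(\<Sum>j<length (z # xs). int (length (z # xs) - 1 - j) * fst ((z # xs) ! j)) =
        int (length xs) * fst z + (\<Sum>j<length xs. int (length xs - 1 - j) * fst (xs ! j))"
      by (simp only: list.size(4) add_Suc_right add_0_right One_nat_def sum.lessThan_Suc_shift) simp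
    moreover have "int (length (z # xs) * (length (z # xs) - 1) div 2) = int (length xs) + int (length xs * (length xs - 1) div 2)"
      using tri[of "length xs"] by simp
    ultimately show ?case using Cons by (simp add: algebra_simps)
  qed simp
  then have "sgn_pow (int (length xs * (length xs - 1) div 2)) *
      sgn_pow (\<Sum>j<length xs. int (length xs - 1 - j) * fst (xs ! j)) = (sgn_pow (susp_exp xs) :: 'a)"
    by (metis sgn_pow_add)
  then show ?thesis by (simp add: susp_components_def Let_def scale_sgn_pow shift_def)
qed

lemma susp_exp_append: "susp_exp (xs @ ys) = susp_exp xs + int (length ys) * (int (length xs) + wdeg xs) + susp_exp ys"
  by (induction xs) (auto simp: algebra_simps)

lemma awords_shift: "xs \<in> awords V \<Longrightarrow> shift n xs \<in> awords W" if "\<And>i. gcomp W (i + n) = gcomp V i"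
  using that by (induction xs) (auto simp: split_paired_all)

lemma wdeg_shift: "wdeg (shift n xs) = wdeg xs + n * int (length xs)"
  by (induction xs) (auto simp: algebra_simps split: prod.splits)

lemma shift_shift [simp]: "shift n (shift m xs) = shift (m + n) xs" "shift 0 xs = xs"
  by (induction xs) (auto simp: algebra_simps)

lemma skew_familyD:
  assumes "skew_family V W d g"
  shows "xs \<in> words V \<Longrightarrow> g xs \<in> gcomp W (wdeg xs + d (length xs))"
    and "xs \<in> awords V \<Longrightarrow> ys \<in> awords V \<Longrightarrow> x \<in> gcomp V i \<Longrightarrow> y \<in> gcomp V i \<Longrightarrow>
        g (xs @ (i, x + y) # ys) = g (xs @ (i, x) # ys) + g (xs @ (i, y) # ys)"
    and "xs \<in> awords V \<Longrightarrow> ys \<in> awords V \<Longrightarrow> x \<in> gcomp V i \<Longrightarrow>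
        g (xs @ (i, gscale V c x) # ys) = gscale W c (g (xs @ (i, x) # ys))"
    and "xs \<in> awords V \<Longrightarrow> ys \<in> awords V \<Longrightarrow> x \<in> gcomp V i \<Longrightarrow> y \<in> gcomp V j \<Longrightarrow>
        g (xs @ (i, x) # (j, y) # ys) = gscale W (- sgn_pow (i * j)) (g (xs @ (j, y) # (i, x) # ys))"
proof -
  note A = assms[unfolded skew_family_def]
  have w: "xs @ (i, x) # ys \<in> words V" if "xs \<in> awords V" "ys \<in> awords V" "x \<in> gcomp V i" for xs ys i x
    using that by (simp add: words_iff)
  have w2: "xs @ (i, x) # (j, y) # ys \<in> words V"
    if "xs \<in> awords V" "ys \<in> awords V" "x \<in> gcomp V i" "y \<in> gcomp V j" for xs ys i x j y
    using that by (simp add: words_iff)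
  show "xs \<in> words V \<Longrightarrow> g xs \<in> gcomp W (wdeg xs + d (length xs))"
    by (rule A[THEN conjunct1, rule_format])
  show "xs \<in> awords V \<Longrightarrow> ys \<in> awords V \<Longrightarrow> x \<in> gcomp V i \<Longrightarrow> y \<in> gcomp V i \<Longrightarrow>
        g (xs @ (i, x + y) # ys) = g (xs @ (i, x) # ys) + g (xs @ (i, y) # ys)"
    by (rule A[THEN conjunct2, THEN conjunct1, rule_format, OF w])
  show "xs \<in> awords V \<Longrightarrow> ys \<in> awords V \<Longrightarrow> x \<in> gcomp V i \<Longrightarrow>
        g (xs @ (i, gscale V c x) # ys) = gscale W c (g (xs @ (i, x) # ys))"
    by (rule A[THEN conjunct2, THEN conjunct2, THEN conjunct1, rule_format, OF w])
  show "xs \<in> awords V \<Longrightarrow> ys \<in> awords V \<Longrightarrow> x \<in> gcomp V i \<Longrightarrow> y \<in> gcomp V j \<Longrightarrow>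
        g (xs @ (i, x) # (j, y) # ys) = gscale W (- sgn_pow (i * j)) (g (xs @ (j, y) # (i, x) # ys))"
    by (rule A[THEN conjunct2, THEN conjunct2, THEN conjunct2, rule_format, OF w2])
qed

lemma skew_familyI:
  assumes "\<And>xs. xs \<in> words V \<Longrightarrow> g xs \<in> gcomp W (wdeg xs + d (length xs))"
    and "\<And>xs i x y ys. xs \<in> awords V \<Longrightarrow> ys \<in> awords V \<Longrightarrow> x \<in> gcomp V i \<Longrightarrow> y \<in> gcomp V i \<Longrightarrow>
        g (xs @ (i, x + y) # ys) = g (xs @ (i, x) # ys) + g (xs @ (i, y) # ys)"
    and "\<And>xs i c x ys. xs \<in> awords V \<Longrightarrow> ys \<in> awords V \<Longrightarrow> x \<in> gcomp V i \<Longrightarrow>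
        g (xs @ (i, gscale V c x) # ys) = gscale W c (g (xs @ (i, x) # ys))"
    and "\<And>xs i x j y ys. xs \<in> awords V \<Longrightarrow> ys \<in> awords V \<Longrightarrow> x \<in> gcomp V i \<Longrightarrow> y \<in> gcomp V j \<Longrightarrow>
        g (xs @ (i, x) # (j, y) # ys) = gscale W (- sgn_pow (i * j)) (g (xs @ (j, y) # (i, x) # ys))"
  shows "skew_family V W d g"
  unfolding skew_family_def
proof (intro conjI allI impI ballI)
  fix xs assume "xs \<in> words V"
  then show "g xs \<in> gcomp W (wdeg xs + d (length xs))" by (rule assms(1))
next
  fix xs i x y ys assume "xs @ (i, x) # ys \<in> words V" "y \<in> gcomp V i"
  then show "g (xs @ (i, x + y) # ys) = g (xs @ (i, x) # ys) + g (xs @ (i, y) # ys)"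
    by (intro assms(2)) (auto simp: words_iff)
next
  fix xs i c x ys assume "xs @ (i, x) # ys \<in> words V"
  then show "g (xs @ (i, gscale V c x) # ys) = gscale W c (g (xs @ (i, x) # ys))"
    by (intro assms(3)) (auto simp: words_iff)
next
  fix xs i x j y ys assume "xs @ (i, x) # (j, y) # ys \<in> words V"
  then show "g (xs @ (i, x) # (j, y) # ys) = gscale W (- sgn_pow (i * j)) (g (xs @ (j, y) # (i, x) # ys))"
    by (intro assms(4)) (auto simp: words_iff)
qed

text \<open>Decalage. Transposing neighbours of suspended degrees \<open>i\<close>, \<open>j\<close>
  changes \<open>susp_exp\<close> by \<open>i + j\<close> modulo 2, which turns the skew sign
  \<open>(i - 1) * (j - 1) + 1\<close> into the symmetric sign \<open>i * j\<close>.\<close>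

lemma susp_components_sym:
  assumes W: "is_gvs W" and g: "skew_family V W d g"
  shows "sym_mod (susp V) (gscale W) {0} (susp_components W g)"
    and "xs \<in> words (susp V) \<Longrightarrow>
      susp_components W g xs \<in> gcomp W (wdeg xs - int (length xs) + d (length xs))"
proof -
  note Wm = is_gvsD[OF W]
  interpret W: vector_space "gscale W" by (fact Wm(1))
  note c = susp_components_eq[OF Wm(1), of g]
  have aw: "shift (- 1) xs \<in> awords V" if "xs \<in> awords (susp V)" for xs
    by (rule awords_shift[OF _ that]) simp
  show "susp_components W g xs \<in> gcomp W (wdeg xs - int (length xs) + d (length xs))" if "xs \<in> words (susp V)"
  proof -
    have "shift (- 1) xs \<in> words V" using that aw by (auto simp: words_iff)
    from skew_familyD(1)[OF g this] have "g (shift (- 1) xs) \<in> gcomp W (wdeg xs - int (length xs) + d (length xs))"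
      by (simp add: wdeg_shift)
    from W.subspace_sg[OF Wm(5) this] show ?thesis by (simp add: c)
  qed
  show "sym_mod (susp V) (gscale W) {0} (susp_components W g)"
  proof (rule sym_modI)
    fix xs i x y ys assume *: "xs \<in> awords (susp V)" "ys \<in> awords (susp V)" "x \<in> gcomp (susp V) i" "y \<in> gcomp (susp V) i"
    show "susp_components W g (xs @ (i, x + y) # ys) - susp_components W g (xs @ (i, x) # ys) - susp_components W g (xs @ (i, y) # ys) \<in> {0}"
      using skew_familyD(2)[OF g aw[OF *(1)] aw[OF *(2)], of x "i - 1" y] *(3,4)
      by (simp add: c susp_exp_append sg_add)
  next
    fix xs i ca x ys assume *: "xs \<in> awords (susp V)" "ys \<in> awords (susp V)" "x \<in> gcomp (susp V) i"
    show "susp_components W g (xs @ (i, gscale (susp V) ca x) # ys) - gscale W ca (susp_components W g (xs @ (i, x) # ys)) \<in> {0}"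
      using skew_familyD(3)[OF g aw[OF *(1)] aw[OF *(2)], of x "i - 1" ca] *(3)
      by (simp add: c susp_exp_append W.scale_sg)
  next
    fix xs i x j y ys assume *: "xs \<in> awords (susp V)" "ys \<in> awords (susp V)" "x \<in> gcomp (susp V) i" "y \<in> gcomp (susp V) j"
    let ?u = "g (shift (- 1) (xs @ (j, y) # (i, x) # ys))"
    have "g (shift (- 1) (xs @ (i, x) # (j, y) # ys)) = sg ((i - 1) * (j - 1) + 1) ?u"
      using skew_familyD(4)[OF g aw[OF *(1)] aw[OF *(2)], of x "i - 1" y "j - 1"] *(3,4)
      by (simp add: W.scale_sgn_pow) (simp add: sg_def)
    then show "susp_components W g (xs @ (i, x) # (j, y) # ys) - sg (i * j) (susp_components W g (xs @ (j, y) # (i, x) # ys)) \<in> {0}"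
      unfolding c susp_exp_append singleton_iff right_minus_eq
      by (simp only: sg_sg) (rule sg_eqI, auto)
  qed
qed

definition desusp :: "('v word \<Rightarrow> 'w::ab_group_add) \<Rightarrow> 'v word \<Rightarrow> 'w" where
  "desusp c ys = sg (susp_exp (shift 1 ys)) (c (shift 1 ys))"

lemma susp_components_desusp:
  assumes "vector_space (gscale W)"
  shows "susp_components W (desusp c) xs = c xs"
  by (simp add: susp_components_eq[OF assms] desusp_def)

text \<open>Decalage in the opposite direction; it yields a skew family from a morphism that is
  constructed on the coalgebra side.\<close>

lemma skew_family_desusp:
  assumes W: "is_gvs W" and c: "sym_mod (susp V) (gscale W) {0} c"
    and cm: "\<And>xs. xs \<in> words (susp V) \<Longrightarrow> c xs \<in> gcomp W (wdeg xs - int (length xs) + d (length xs))"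
  shows "skew_family V W d (desusp c)"
proof (rule skew_familyI)
  note Wm = is_gvsD[OF W]
  interpret W: vector_space "gscale W" by (fact Wm(1))
  have aw: "shift 1 xs \<in> awords (susp V)" if "xs \<in> awords V" for xs
    by (rule awords_shift[OF _ that]) simp
  show "desusp c xs \<in> gcomp W (wdeg xs + d (length xs))" if "xs \<in> words V" for xs
  proof -
    have "shift 1 xs \<in> words (susp V)" using that aw by (auto simp: words_iff)
    from cm[OF this] have "c (shift 1 xs) \<in> gcomp W (wdeg xs + d (length xs))"
      by (simp add: wdeg_shift)
    from W.subspace_sg[OF Wm(5) this] show ?thesis by (simp add: desusp_def)
  qed
  {
    fix xs i x y ys assume *: "xs \<in> awords V" "ys \<in> awords V" "x \<in> gcomp V i" "y \<in> gcomp V i"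
    have "c (shift 1 (xs @ (i, x + y) # ys)) = c (shift 1 (xs @ (i, x) # ys)) + c (shift 1 (xs @ (i, y) # ys))"
      using sym_modD(1)[OF c aw[OF *(1)] aw[OF *(2)], of x "i + 1" y] *(3,4) by (simp add: algebra_simps)
    then show "desusp c (xs @ (i, x + y) # ys) = desusp c (xs @ (i, x) # ys) + desusp c (xs @ (i, y) # ys)"
      by (simp add: desusp_def susp_exp_append sg_add)
  next
    fix xs i ca x ys assume *: "xs \<in> awords V" "ys \<in> awords V" "x \<in> gcomp V i"
    show "desusp c (xs @ (i, gscale V ca x) # ys) = gscale W ca (desusp c (xs @ (i, x) # ys))"
      using sym_modD(2)[OF c aw[OF *(1)] aw[OF *(2)], of x "i + 1" ca] *(3)
      by (simp add: desusp_def susp_exp_append W.scale_sg)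
  next
    fix xs i x j y ys assume *: "xs \<in> awords V" "ys \<in> awords V" "x \<in> gcomp V i" "y \<in> gcomp V j"
    have "c (shift 1 (xs @ (i, x) # (j, y) # ys)) = sg ((i + 1) * (j + 1)) (c (shift 1 (xs @ (j, y) # (i, x) # ys)))"
      using sym_modD(3)[OF c aw[OF *(1)] aw[OF *(2)], of x "i + 1" y "j + 1"] *(3,4) by simp
    then have "desusp c (xs @ (i, x) # (j, y) # ys) = sg (i * j + 1) (desusp c (xs @ (j, y) # (i, x) # ys))"
      unfolding desusp_def shift_simps susp_exp_append
      by (simp only: sg_sg) (rule sg_eqI, auto)
    also have "\<dots> = gscale W (- sgn_pow (i * j)) (desusp c (xs @ (j, y) # (i, x) # ys))"
      by (simp add: W.scale_sgn_pow) (simp add: sg_def)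
    finally show "desusp c (xs @ (i, x) # (j, y) # ys) = gscale W (- sgn_pow (i * j)) (desusp c (xs @ (j, y) # (i, x) # ys))" .
  }
qed

section \<open>\<open>L\<^sub>\<infinity>\<close>-structures in terms of components\<close>

abbreviation comps :: "('k::field, 'v::ab_group_add) linf \<Rightarrow> 'v word \<Rightarrow> 'v" where
  "comps L \<equiv> susp_components (underlying L) (bracket L)"

abbreviation codiff :: "('k::field, 'v::ab_group_add) linf \<Rightarrow> ('v word \<Rightarrow>\<^sub>0 'k) \<Rightarrow> ('v word \<Rightarrow>\<^sub>0 'k)" where
  "codiff L \<equiv> lin_ext (cder (- 1) (comps L))"

lemma comps_facts:
  assumes "is_gvs (underlying L)" "skew_family (underlying L) (underlying L) (\<lambda>k. int k - 2) (bracket L)"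
  shows "is_gvs (suspL L)" "sym_mod (suspL L) (gscale (suspL L)) {0} (comps L)"
    and "xs \<in> words (suspL L) \<Longrightarrow> comps L xs \<in> gcomp (suspL L) (wdeg xs + - 1)"
    and "induced_coderivation L (codiff L)"
proof -
  show V: "is_gvs (suspL L)" using assms by (simp add: is_gvs_susp)
  note S = susp_components_sym[OF assms]
  show c: "sym_mod (suspL L) (gscale (suspL L)) {0} (comps L)" using S(1) by simp
  show cm: "xs \<in> words (suspL L) \<Longrightarrow> comps L xs \<in> gcomp (suspL L) (wdeg xs + - 1)" for xs
    using S(2)[of xs] by simp
  show "induced_coderivation L (codiff L)"
    unfolding induced_coderivation_def
    using coderivation_cder[OF V c cm] has_components_cder[OF V] by blast
qed

lemma codiff_unique:
  fixes L :: "('k::field_char_0, 'v::ab_group_add) linf"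
  assumes L: "is_gvs (underlying L)" "skew_family (underlying L) (underlying L) (\<lambda>k. int k - 2) (bracket L)"
    and "induced_coderivation L D" "x \<in> sym_free (suspL L)"
  shows "D x - codiff L x \<in> sym_null (suspL L)"
  using coderivation_unique[OF comps_facts(1)[OF L]] comps_facts(4)[OF L] assms(3,4)
  unfolding induced_coderivation_def by blast

lemma coderivation_sym_free:
  assumes "coderivation e V D" "x \<in> sym_free V"
  shows "D x \<in> sym_free V"
proof -
  interpret D: module_hom fscale fscale D using assms by (simp add: coderivation_def sym_hom_def)
  show ?thesis using assms(2) unfolding sym_free_def
  proof (induction rule: fspan_gen_induct)
    case (gen a)
    then have "D (gen a) \<in> fspan (gen ` {ys \<in> words V. wdeg ys = wdeg a + e})"
      using assms(1) by (auto simp: coderivation_def sym_hom_def)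
    then show ?case by (auto simp: mem_fspan_gen)
  qed (auto simp: D.zero D.add D.scale fs.span_zero intro: fs.span_add fs.span_scale)
qed

text \<open>The definition only supplies some coderivation \<open>D\<close>. Uniqueness replaces it
  by \<open>codiff L\<close>, and projecting the vanishing square to the generators leaves the
  Jacobi identities.\<close>

lemma linf_algebraD:
  fixes L :: "('k::field_char_0, 'v::ab_group_add) linf"
  assumes "linf_algebra L"
  shows "is_gvs (underlying L)" "skew_family (underlying L) (underlying L) (\<lambda>k. int k - 2) (bracket L)"
    and "xs \<in> words (suspL L) \<Longrightarrow> comp_ext (suspL L) (comps L) (cder (- 1) (comps L) xs) = 0"
proof -
  show L: "is_gvs (underlying L)" "skew_family (underlying L) (underlying L) (\<lambda>k. int k - 2) (bracket L)"
    using assms by (auto simp: linf_algebra_def)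
  note C = comps_facts[OF L]
  obtain D where D: "induced_coderivation L D" and sq: "\<And>x. x \<in> sym_free (suspL L) \<Longrightarrow> D (D x) \<in> sym_null (suspL L)"
    using assms by (auto simp: linf_algebra_def)
  have coder: "coderivation (- 1) (suspL L) D" "coderivation (- 1) (suspL L) (codiff L)"
    using D C(4) by (auto simp: induced_coderivation_def)
  interpret D: module_hom fscale fscale D using coder by (simp add: coderivation_def sym_hom_def)
  note U = codiff_unique[OF L D]
  show "comp_ext (suspL L) (comps L) (cder (- 1) (comps L) xs) = 0" if xs: "xs \<in> words (suspL L)"
  proof -
    let ?V = "suspL L" let ?x = "gen xs :: _ \<Rightarrow>\<^sub>0 'k"
    have x: "?x \<in> sym_free ?V" using xs by (auto simp: sym_free_def intro!: fs.span_base)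
    note cx = coderivation_sym_free[OF coder(2) x]
    have "D (D ?x - codiff L ?x) \<in> sym_null ?V"
      using coder(1) U[OF x] by (auto simp: coderivation_def sym_hom_def)
    from fs.subspace_diff[OF subspace_sym_null sq[OF x] fs.subspace_add[OF subspace_sym_null this U[OF cx]]]
    have "codiff L (codiff L ?x) \<in> sym_null ?V" by (simp add: D.diff)
    from sym_proj_null[OF C(1) this]
    have 0: "sym_proj ?V (wdeg xs - 2) (codiff L (codiff L ?x)) = 0" .
    have "cder (- 1) (comps L) xs \<in> fspan (gen ` {ys \<in> words ?V. wdeg ys = wdeg xs + - 1})"
      by (rule cder_mem) (use C(3) xs in \<open>auto simp: words_iff\<close>)
    \<comment> \<open>All words in \<open>cder (- 1) (comps L) xs\<close> have degree
      \<open>wdeg xs - 1\<close>, so projecting in degree \<open>wdeg xs - 2\<close> reads off every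
      component of the second application.\<close>
    then have "sym_proj ?V (wdeg xs - 2) (codiff L y) = comp_ext ?V (comps L) y"
      if "y = cder (- 1) (comps L) xs" for y unfolding that
    proof (induction rule: fspan_gen_induct)
      case zero then show ?case by (simp add: sym_proj_zero[OF C(1)] comp_ext_zero[OF C(1)])
    next
      case (gen a)
      then have "sym_proj ?V (wdeg xs - 2) (codiff L (gen a)) = comps L a"
        using has_components_cder[OF C(1), of "- 1" "comps L"] by (simp add: has_components_def)
      then show ?case using gen by (simp add: comp_ext_gen[OF C(1)] words_iff)
    next
      case (add x y)
      then show ?case by (simp add: lin_ext_add sym_proj_add[OF C(1)] comp_ext_add[OF C(1)])
    next
      case (scale c x)
      interpret ce: module_hom fscale "gscale ?V" "comp_ext ?V (comps L)" by (rule module_hom_comp_ext[OF C(1)])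
      from scale show ?case by (simp add: lin_ext_fscale sym_proj_fscale[OF C(1)] ce.scale del: susp_simps)
    qed
    with 0 show ?thesis by simp
  qed
qed

lemma codiff_square:
  fixes L :: "('k::field_char_0, 'v::ab_group_add) linf"
  assumes L: "is_gvs (underlying L)" "skew_family (underlying L) (underlying L) (\<lambda>k. int k - 2) (bracket L)"
    and sq: "\<And>xs. xs \<in> words (suspL L) \<Longrightarrow> comp_ext (suspL L) (comps L) (cder (- 1) (comps L) xs) = 0"
    and x: "x \<in> aspan (suspL L)"
  shows "codiff L (codiff L x) \<in> sym_null (suspL L)"
  using x
proof (induction rule: fspan_gen_induct)
  case (gen w)
  show ?case
    using cder_square[OF comps_facts(1)[OF L] _ comps_facts(2)[OF L] comps_facts(3)[OF L] sq gen] by simp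
qed (simp_all add: lin_ext_add lin_ext_fscale fs.subspace_0 fs.subspace_add fs.subspace_scale)

lemma linf_algebraI:
  fixes L :: "('k::field_char_0, 'v::ab_group_add) linf"
  assumes L: "is_gvs (underlying L)" "skew_family (underlying L) (underlying L) (\<lambda>k. int k - 2) (bracket L)"
    and sq: "\<And>xs. xs \<in> words (suspL L) \<Longrightarrow> comp_ext (suspL L) (comps L) (cder (- 1) (comps L) xs) = 0"
  shows "linf_algebra L"
  unfolding linf_algebra_def
  using L comps_facts(4)[OF L] codiff_square[OF L sq] sym_free_subset_aspan by blast

text \<open>The coderivations in the definition of a morphism are unrelated to those witnessing the
  algebra structures; uniqueness on both sides brings them to the explicit form.\<close>

lemma linf_morphismD:
  fixes L :: "('k::field_char_0, 'v::ab_group_add) linf" and M :: "('k, 'w::ab_group_add) linf"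
  assumes L: "linf_algebra L" and M: "linf_algebra M" and f: "linf_morphism L M f"
  obtains F where "induced_coalgebra_hom L M f F"
    and "\<And>x. x \<in> sym_free (suspL L) \<Longrightarrow> F (codiff L x) - codiff M (F x) \<in> sym_null (suspL M)"
proof -
  obtain F D D' where F: "induced_coalgebra_hom L M f F" and D: "induced_coderivation L D"
    and D': "induced_coderivation M D'"
    and eq: "\<And>x. x \<in> sym_free (suspL L) \<Longrightarrow> F (D x) - D' (F x) \<in> sym_null (suspL M)"
    using f by (auto simp: linf_morphism_def)
  have hom: "sym_hom 0 (suspL L) (suspL M) F"
    using F by (simp add: induced_coalgebra_hom_def coalgebra_hom_def)
  then interpret F: module_hom fscale fscale F by (simp add: sym_hom_def)
  have Fx: "F x \<in> sym_free (suspL M)" if "x \<in> sym_free (suspL L)" for x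
    using that unfolding sym_free_def
  proof (induction rule: fspan_gen_induct)
    case (gen a)
    then have "F (gen a) \<in> fspan (gen ` {ys \<in> words (suspL M). wdeg ys = wdeg a + 0})"
      using hom by (auto simp: sym_hom_def)
    then show ?case by (auto simp: mem_fspan_gen)
  qed (auto simp: F.zero F.add F.scale fs.span_zero intro: fs.span_add fs.span_scale)
  have "F (codiff L x) - codiff M (F x) \<in> sym_null (suspL M)" if x: "x \<in> sym_free (suspL L)" for x
  proof -
    have "F (D x - codiff L x) \<in> sym_null (suspL M)"
      using hom codiff_unique[OF linf_algebraD(1,2)[OF L] D x] by (simp add: sym_hom_def)
    moreover have "D' (F x) - codiff M (F x) \<in> sym_null (suspL M)"
      by (rule codiff_unique[OF linf_algebraD(1,2)[OF M] D' Fx[OF x]])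
    ultimately have "(F (D x) - D' (F x)) - F (D x - codiff L x) + (D' (F x) - codiff M (F x)) \<in> sym_null (suspL M)"
      by (rule fs.subspace_add[OF subspace_sym_null fs.subspace_diff[OF subspace_sym_null eq[OF x]]])
    then show ?thesis by (simp add: F.diff)
  qed
  with F that show ?thesis by blast
qed

lemma linf_morphismI:
  assumes L: "linf_algebra L" and M: "linf_algebra M"
    and f: "skew_family (underlying L) (underlying M) (\<lambda>k. int k - 1) f"
    and F: "induced_coalgebra_hom L M f F"
    and eq: "\<And>x. x \<in> sym_free (suspL L) \<Longrightarrow> F (codiff L x) - codiff M (F x) \<in> sym_null (suspL M)"
  shows "linf_morphism L M f"
  unfolding linf_morphism_def
proof (intro conjI exI ballI)
  show "induced_coderivation L (codiff L)" "induced_coderivation M (codiff M)"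
    using L M by (auto simp: linf_algebra_def intro: comps_facts(4))
qed (use f F eq in auto)

section \<open>Extending a morphism along an action by coderivations\<close>

lemma twist_null: "x \<in> sym_null V \<Longrightarrow> twist r x \<in> sym_null V"
  unfolding twist_def
  by (rule fs.sym_null_image[OF subspace_sym_null module_hom_lin_ext])
    (simp_all add: fs.sym_mod_sg_wdeg sym_mod_gen)

lemma twist_aspan: "x \<in> aspan V \<Longrightarrow> twist r x \<in> aspan V"
  unfolding twist_def
  by (induction rule: fspan_gen_induct)
    (auto simp: lin_ext_add lin_ext_fscale fs.span_zero intro: fs.span_add fs.span_scale fs.span_base
      fs.subspace_sg[OF subspace_fspan_gen])

lemma lder_anull2:
  assumes \<Phi>: "module_hom fscale fscale \<Phi>"
    and null: "\<And>x. x \<in> sym_null V \<Longrightarrow> \<Phi> x \<in> sym_null V" and asp: "\<And>x. x \<in> aspan V \<Longrightarrow> \<Phi> x \<in> aspan V"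
    and x: "x \<in> anull2 V"
  shows "lder r \<Phi> x \<in> anull2 V"
proof -
  have T: "tens u v \<in> anull2 V" if "u \<in> sym_null V \<and> v \<in> aspan V \<or> u \<in> aspan V \<and> v \<in> sym_null V" for u v
    unfolding anull2_def using that by (intro fs.span_base) blast
  from x show ?thesis
    unfolding anull2_def
  proof (induction rule: fs.span_induct_alt)
    case base then show ?case by (simp add: lder_def fs.span_zero)
  next
    case (step c x y)
    from step(1) have "lder r \<Phi> x \<in> anull2 V"
      by (auto simp: lder_tens[OF \<Phi>] null asp twist_null twist_aspan intro!: fs.subspace_add T)
    then show ?case
      using step(2) unfolding anull2_def[symmetric]
      by (simp add: lder_def lin_ext_add lin_ext_fscale fs.subspace_add fs.subspace_scale)
  qed
qed

abbreviation hspan :: "('k::field, 'v) gvs \<Rightarrow> int \<Rightarrow> ('v word \<Rightarrow>\<^sub>0 'k) set" where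
  "hspan V d \<equiv> fspan (gen ` {ys \<in> awords V. wdeg ys = d})"

lemma hspan_aspan: "x \<in> hspan V d \<Longrightarrow> x \<in> aspan V"
  and hspan_deg: "x \<in> hspan V d \<Longrightarrow> x \<in> fspan (gen ` {ys. wdeg ys = d})"
  by (auto simp: mem_fspan_gen)

text \<open>\<open>G\<close> is the morphism to be extended and \<open>\<rho>\<close> makes each
  letter act by a coderivation. The last assumption says that letter to operator is a chain map: on
  a one-letter word it is the commutator identity, on longer words it requires the one-letter part
  of \<open>D w\<close> to act trivially.\<close>

locale coalgebra_action =
  fixes V :: "('k::field_char_0, 'u::ab_group_add) gvs"
    and W :: "('k, 'w::ab_group_add) gvs"
    and D :: "'u word \<Rightarrow> ('u word \<Rightarrow>\<^sub>0 'k)"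
    and d :: "('w word \<Rightarrow>\<^sub>0 'k) \<Rightarrow> ('w word \<Rightarrow>\<^sub>0 'k)"
    and G :: "'u word \<Rightarrow> ('w word \<Rightarrow>\<^sub>0 'k)"
    and \<rho> :: "int \<times> 'u \<Rightarrow> ('w word \<Rightarrow>\<^sub>0 'k) \<Rightarrow> ('w word \<Rightarrow>\<^sub>0 'k)"
  assumes D_coder: "coder (- 1) (lin_ext D)"
    and D_length: "\<And>w. D w \<in> fspan (gen ` {ys. length ys \<le> length w})"
    and d_linear: "module_hom fscale fscale d"
    and d_null: "\<And>x. x \<in> sym_null W \<Longrightarrow> d x \<in> sym_null W"
    and G_Nil: "G [] = gen []"
    and G_mem: "\<And>w. w \<in> awords V \<Longrightarrow> G w \<in> hspan W (wdeg w)"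
    and G_ne: "\<And>w. w \<in> words V \<Longrightarrow> G w \<in> fspan (gen ` words W)"
    and G_sym: "sym_mod V fscale (sym_null W) G"
    and G_cop: "\<And>w. w \<in> awords V \<Longrightarrow> cop (G w) - cosum w (\<lambda>a b. tens (G a) (G b)) \<in> anull2 W"
    and G_chain: "\<And>w. w \<in> awords V \<Longrightarrow> d (G w) - lin_ext G (D w) \<in> sym_null W"
    and \<rho>_coder: "\<And>z. coder (fst z) (\<rho> z)"
    and \<rho>_mem: "\<And>z w. snd z \<in> gcomp V (fst z) \<Longrightarrow> w \<in> awords W \<Longrightarrow> \<rho> z (gen w) \<in> aspan W"
    and \<rho>_null: "\<And>z x. snd z \<in> gcomp V (fst z) \<Longrightarrow> x \<in> sym_null W \<Longrightarrow> \<rho> z x \<in> sym_null W"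
    and \<rho>_add: "\<And>i u u' x. u \<in> gcomp V i \<Longrightarrow> u' \<in> gcomp V i \<Longrightarrow> x \<in> aspan W \<Longrightarrow>
        \<rho> (i, u + u') x - \<rho> (i, u) x - \<rho> (i, u') x \<in> sym_null W"
    and \<rho>_scale: "\<And>i c u x. u \<in> gcomp V i \<Longrightarrow> x \<in> aspan W \<Longrightarrow>
        \<rho> (i, gscale V c u) x - fscale c (\<rho> (i, u) x) \<in> sym_null W"
    and \<rho>_chain: "\<And>w x. w \<in> awords V \<Longrightarrow> x \<in> aspan W \<Longrightarrow>
        d (if length w = 1 then \<rho> (hd w) x else 0)
          - lin_ext (\<lambda>u. if length u = 1 then \<rho> (hd u) x else 0) (D w)
          - sg (wdeg w) (if length w = 1 then \<rho> (hd w) (d x) else 0) \<in> sym_null W"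
begin

abbreviation "N \<equiv> sym_null W"

text \<open>Extension by zero to words of other lengths makes a sum over unshuffles pick exactly one
  acting letter, so that the calculus of \<open>cosum\<close> applies.\<close>

definition \<theta> :: "'u word \<Rightarrow> ('w word \<Rightarrow>\<^sub>0 'k) \<Rightarrow> ('w word \<Rightarrow>\<^sub>0 'k)" where
  "\<theta> w x = (if length w = 1 then \<rho> (hd w) x else 0)"

text \<open>
  The part of the extended morphism in which exactly \<open>k\<close> letters act.  Symmetrisation is hidden in the
  recursion: the last letter to act is averaged over all positions, which produces the factor
  \<open>1 / (k + 1)\<close>.
\<close>

primrec q :: "nat \<Rightarrow> 'u word \<Rightarrow> ('w word \<Rightarrow>\<^sub>0 'k)" where
  "q 0 = G"
| "q (Suc k) = (\<lambda>w. fscale (1 / of_nat (Suc k)) (cosum w (\<lambda>a b. \<theta> a (q k b))))"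

lemma length1_cases: "length a = 1 \<Longrightarrow> (\<And>z. a = [z] \<Longrightarrow> P) \<Longrightarrow> P"
  by (auto simp: length_Suc_conv)

lemma \<theta>_linear: "module_hom fscale fscale (\<theta> a)"
proof (cases "length a = 1")
  case True
  then have "\<theta> a = \<rho> (hd a)" by (simp add: \<theta>_def fun_eq_iff)
  then show ?thesis using \<rho>_coder by (simp add: coder_def)
next
  case False
  then have "\<theta> a = (\<lambda>_. 0)" by (simp add: \<theta>_def fun_eq_iff)
  then show ?thesis by (simp, unfold_locales) (simp_all add: fs.scale_right_distrib fs.scale_left_distrib)
qed

lemma \<theta>_add: "\<theta> a (x + y) = \<theta> a x + \<theta> a y"
  and \<theta>_diff: "\<theta> a (x - y) = \<theta> a x - \<theta> a y"
  and \<theta>_zero: "\<theta> a 0 = 0"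
  and \<theta>_scale: "\<theta> a (fscale c x) = fscale c (\<theta> a x)"
proof -
  interpret module_hom fscale fscale "\<theta> a" by (rule \<theta>_linear)
  show "\<theta> a (x + y) = \<theta> a x + \<theta> a y" "\<theta> a (x - y) = \<theta> a x - \<theta> a y"
    "\<theta> a 0 = 0" "\<theta> a (fscale c x) = fscale c (\<theta> a x)" by (simp_all add: add diff zero scale)
qed

lemma \<theta>_hd: "a \<in> awords V \<Longrightarrow> length a = 1 \<Longrightarrow> snd (hd a) \<in> gcomp V (fst (hd a)) \<and> fst (hd a) = wdeg a"
  by (elim length1_cases) auto

lemma \<theta>_null: "a \<in> awords V \<Longrightarrow> x \<in> N \<Longrightarrow> \<theta> a x \<in> N"
  using \<rho>_null[of "hd a" x] \<theta>_hd[of a] by (auto simp: \<theta>_def fs.subspace_0)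

lemma \<theta>_mem:
  assumes a: "a \<in> awords V" and x: "x \<in> hspan W n"
  shows "\<theta> a x \<in> fspan (gen ` {ys \<in> words W. wdeg ys = wdeg a + n})"
  using x
proof (induction rule: fspan_gen_induct)
  case (gen w)
  show ?case
  proof (cases "length a = 1")
    case True
    note h = \<theta>_hd[OF a True]
    have "\<rho> (hd a) (gen w) \<in> fspan (gen ` {ys. ys \<noteq> [] \<and> wdeg ys = wdeg w + fst (hd a)})"
      using \<rho>_coder by (auto simp: coder_def)
    moreover have "\<rho> (hd a) (gen w) \<in> aspan W"
      using \<rho>_mem[of "hd a" w] gen h by auto
    ultimately show ?thesis
      using gen True h by (auto simp: \<theta>_def mem_fspan_gen words_iff)
  qed (simp add: \<theta>_def fs.span_zero)
qed (auto simp: \<theta>_zero \<theta>_add \<theta>_scale fs.span_zero intro: fs.span_add fs.span_scale)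

lemma words_span_hspan: "x \<in> fspan (gen ` {ys \<in> words W. wdeg ys = n}) \<Longrightarrow> x \<in> hspan W n"
  by (auto simp: mem_fspan_gen words_iff)

lemma \<theta>_aspan:
  assumes "a \<in> awords V" "x \<in> aspan W"
  shows "\<theta> a x \<in> aspan W"
  using assms(2)
proof (induction rule: fspan_gen_induct)
  case (gen w)
  then have "gen w \<in> hspan W (wdeg w)" by (auto intro!: fs.span_base)
  from hspan_aspan[OF words_span_hspan[OF \<theta>_mem[OF assms(1) this]]] show ?case .
qed (auto simp: \<theta>_zero \<theta>_add \<theta>_scale fs.span_zero intro: fs.span_add fs.span_scale)

lemma q_mem: "w \<in> awords V \<Longrightarrow> q k w \<in> hspan W (wdeg w)"
proof (induction k arbitrary: w)
  case 0 then show ?case by (simp add: G_mem)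
next
  case (Suc k)
  have "cosum w (\<lambda>a b. \<theta> a (q k b)) \<in> hspan W (wdeg w)"
  proof (rule fs.cosum_mem[OF subspace_fspan_gen])
    fix a b assume *: "wdeg a + wdeg b = wdeg w" "set a \<union> set b = set w"
    note ab = cosum_awords[OF Suc.prems *(2)]
    from words_span_hspan[OF \<theta>_mem[OF ab(1) Suc.IH[OF ab(2)]]] *(1)
    show "\<theta> a (q k b) \<in> hspan W (wdeg w)" by simp
  qed
  then show ?case by (simp add: fs.span_scale)
qed

lemma q_ne: "w \<in> words V \<Longrightarrow> q k w \<in> fspan (gen ` words W)"
proof (cases k)
  case (Suc l)
  assume w: "w \<in> words V"
  have "cosum w (\<lambda>a b. \<theta> a (q l b)) \<in> fspan (gen ` words W)"
  proof (rule fs.cosum_mem[OF subspace_fspan_gen])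
    fix a b assume *: "set a \<union> set b = set w"
    have ab: "a \<in> awords V" "b \<in> awords V" using w cosum_awords[OF _ *] by (auto simp: words_iff)
    from \<theta>_mem[OF ab(1) q_mem[OF ab(2)]]
    show "\<theta> a (q l b) \<in> fspan (gen ` words W)" by (auto simp: mem_fspan_gen)
  qed
  then show ?thesis using Suc by (simp add: fs.span_scale)
qed (simp add: G_ne)

text \<open>Each action uses up one letter of the word.\<close>

lemma q_zero: "length w < k \<Longrightarrow> q k w = 0"
proof (induction k arbitrary: w)
  case (Suc k)
  have "cosum w (\<lambda>a b. \<theta> a (q k b)) = cosum w (\<lambda>a b. 0)"
  proof (rule cosum_cong)
    fix a b :: "'u word" assume "length a + length b = length w"
    then show "\<theta> a (q k b) = 0"
    proof (cases "length a = 1")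
      case True
      with \<open>length a + length b = length w\<close> Suc have "q k b = 0" by auto
      then show ?thesis by (simp add: \<theta>_zero)
    qed (simp add: \<theta>_def)
  qed
  then show ?case by simp
qed simp

lemma sym_mod_\<theta>:
  assumes x: "x \<in> aspan W"
  shows "sym_mod V fscale N (\<lambda>a. \<theta> a x)"
proof (rule sym_modI)
  fix xs i u u' ys assume *: "xs \<in> awords V" "ys \<in> awords V" "u \<in> gcomp V i" "u' \<in> gcomp V i"
  show "\<theta> (xs @ (i, u + u') # ys) x - \<theta> (xs @ (i, u) # ys) x - \<theta> (xs @ (i, u') # ys) x \<in> N"
    using \<rho>_add[OF *(3,4) x] by (auto simp: \<theta>_def fs.subspace_0)
next
  fix xs i c u ys assume *: "xs \<in> awords V" "ys \<in> awords V" "u \<in> gcomp V i"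
  show "\<theta> (xs @ (i, gscale V c u) # ys) x - fscale c (\<theta> (xs @ (i, u) # ys) x) \<in> N"
    using \<rho>_scale[OF *(3) x] by (auto simp: \<theta>_def fs.subspace_0)
qed (auto simp: \<theta>_def fs.subspace_0)

text \<open>Symmetry holds although the operators need not commute: the acting letter runs over all
  positions, and \<open>sym_mod_cosum\<close> needs only symmetry within each half.\<close>

lemma q_sym: "sym_mod V fscale N (q k)"
proof (induction k)
  case 0 then show ?case by (simp add: G_sym)
next
  case (Suc k)
  have "sym_mod V fscale N (\<lambda>w. cosum w (\<lambda>a b. \<theta> a (q k b)))"
  proof (rule fs.sym_mod_cosum[OF subspace_sym_null])
    show "sym_mod V fscale N (\<lambda>a. \<theta> a (q k b))" if "b \<in> awords V" for b
      by (rule sym_mod_\<theta>[OF hspan_aspan[OF q_mem[OF that]]])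
    show "sym_mod V fscale N (\<lambda>b. \<theta> a (q k b))" if "a \<in> awords V" for a
      by (rule sym_mod_comp[OF Suc \<theta>_linear \<theta>_null[OF that]])
  qed
  then show ?case by (simp add: fs.sym_mod_scale del: of_nat_Suc)
qed

definition \<theta>2 :: "'u word \<Rightarrow> ('w word \<times> 'w word \<Rightarrow>\<^sub>0 'k) \<Rightarrow> ('w word \<times> 'w word \<Rightarrow>\<^sub>0 'k)" where
  "\<theta>2 a = lder (wdeg a) (\<theta> a)"

lemma \<theta>2_add: "\<theta>2 a (x + y) = \<theta>2 a x + \<theta>2 a y"
  and \<theta>2_diff: "\<theta>2 a (x - y) = \<theta>2 a x - \<theta>2 a y"
  by (simp_all add: \<theta>2_def lder_def lin_ext_add lin_ext_diff)

lemma \<theta>2_sum: "\<theta>2 a (sum h S) = (\<Sum>i\<in>S. \<theta>2 a (h i))"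
  by (simp add: \<theta>2_def lder_def lin_ext_sum)

lemma cop_\<theta>: "cop (\<theta> a x) = \<theta>2 a (cop x)"
proof (cases "length a = 1")
  case True
  then obtain z where a: "a = [z]" by (rule length1_cases)
  have "\<theta> [z] = \<rho> z" by (simp add: \<theta>_def fun_eq_iff)
  then show ?thesis using \<rho>_coder[of z] a by (auto simp: \<theta>2_def coder_def)
next
  case False
  have "lder n (\<lambda>_. 0) y = 0" for n and y :: "'w word \<times> 'w word \<Rightarrow>\<^sub>0 'k"
  proof -
    have "(\<lambda>(a, b). 0) = (\<lambda>_ :: 'w word \<times> 'w word. 0 :: 'w word \<times> 'w word \<Rightarrow>\<^sub>0 'k)"
      by auto
    then show ?thesis by (simp add: lder_def)
  qed
  moreover have "\<theta> a = (\<lambda>_. 0)" using False by (simp add: \<theta>_def fun_eq_iff)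
  ultimately show ?thesis by (simp add: \<theta>2_def)
qed

lemma \<theta>2_anull2: "a \<in> awords V \<Longrightarrow> x \<in> anull2 W \<Longrightarrow> \<theta>2 a x \<in> anull2 W"
  unfolding \<theta>2_def by (rule lder_anull2[OF \<theta>_linear \<theta>_null \<theta>_aspan])

lemma \<theta>2_tens:
  assumes "x \<in> hspan W n"
  shows "\<theta>2 a (tens x y) = tens (\<theta> a x) y + sg (wdeg a * n) (tens x (\<theta> a y))"
  unfolding \<theta>2_def lder_tens[OF \<theta>_linear] twist_homogeneous[OF hspan_deg[OF assms]] tens_sg_left ..

lemma q_Suc: "fscale (of_nat (Suc k)) (q (Suc k) w) = cosum w (\<lambda>a b. \<theta> a (q k b))"
  by (simp del: of_nat_Suc)

text \<open>Symmetrisation as a coalgebra map, in convolution form. With \<open>\<theta> a\<close>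
  acting as a coderivation, a new letter acts on the left or the right factor; the recursion of
  \<open>q\<close> absorbs it there with weight \<open>i\<close> or \<open>Suc k - i\<close>, where
  \<open>i\<close> now counts the letters acting on the left. The weights add up to
  \<open>Suc k\<close>, the factor by which \<open>q\<close> was normalised.\<close>

lemma q_cop:
  assumes "w \<in> awords V"
  shows "cop (q k w) - (\<Sum>i\<le>k. cosum w (\<lambda>a b. tens (q i a) (q (k - i) b))) \<in> anull2 W"
  using assms
proof (induction k arbitrary: w)
  case 0 then show ?case by (simp add: G_cop)
next
  case (Suc k)
  note N2 = subspace_anull2[of W]
  let ?t = "\<lambda>i. cosum w (\<lambda>a b. tens (q i a) (q (Suc k - i) b))"
  have "cosum w (\<lambda>a b. cop (\<theta> a (q k b)))
      - cosum w (\<lambda>a b. \<theta>2 a (\<Sum>i\<le>k. cosum b (\<lambda>c d. tens (q i c) (q (k - i) d)))) \<in> anull2 W"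
  proof (rule fs.cosum_cong_mod[OF N2])
    fix a b assume *: "set a \<union> set b = set w"
    note ab = cosum_awords[OF Suc.prems *]
    show "cop (\<theta> a (q k b)) - \<theta>2 a (\<Sum>i\<le>k. cosum b (\<lambda>c d. tens (q i c) (q (k - i) d))) \<in> anull2 W"
      using \<theta>2_anull2[OF ab(1) Suc.IH[OF ab(2)]] by (simp add: cop_\<theta> \<theta>2_diff)
  qed
  also have "cosum w (\<lambda>a b. \<theta>2 a (\<Sum>i\<le>k. cosum b (\<lambda>c d. tens (q i c) (q (k - i) d)))) =
      cosum w (\<lambda>a b. \<Sum>i\<le>k. cosum b (\<lambda>c d. tens (\<theta> a (q i c)) (q (k - i) d))
        + cosum b (\<lambda>c d. sg (wdeg a * wdeg c) (tens (q i c) (\<theta> a (q (k - i) d)))))"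
  proof (rule cosum_cong)
    fix a b assume *: "set a \<union> set b = set w"
    note ab = cosum_awords[OF Suc.prems *]
    show "\<theta>2 a (\<Sum>i\<le>k. cosum b (\<lambda>c d. tens (q i c) (q (k - i) d))) =
       (\<Sum>i\<le>k. cosum b (\<lambda>c d. tens (\<theta> a (q i c)) (q (k - i) d))
        + cosum b (\<lambda>c d. sg (wdeg a * wdeg c) (tens (q i c) (\<theta> a (q (k - i) d)))))"
      unfolding \<theta>2_sum cosum_hom[where \<Phi>="\<theta>2 a", OF \<theta>2_add] cosum_add[symmetric]
    proof (intro sum.cong refl cosum_cong)
      fix i c d assume *: "set c \<union> set d = set b"
      note cd = cosum_awords[OF ab(2) *]
      show "\<theta>2 a (tens (q i c) (q (k - i) d)) =
        tens (\<theta> a (q i c)) (q (k - i) d) + sg (wdeg a * wdeg c) (tens (q i c) (\<theta> a (q (k - i) d)))"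
        by (rule \<theta>2_tens[OF q_mem[OF cd(1)]])
    qed
  qed
  also have "\<dots> = (\<Sum>i\<le>k. cosum w (\<lambda>a b. cosum b (\<lambda>c d. tens (\<theta> a (q i c)) (q (k - i) d)))
        + cosum w (\<lambda>a b. cosum b (\<lambda>c d. sg (wdeg a * wdeg c) (tens (q i c) (\<theta> a (q (k - i) d))))))"
    by (simp only: cosum_sum cosum_add)
  also have "\<dots> = (\<Sum>i\<le>k. fscale (of_nat (Suc i)) (?t (Suc i)) + fscale (of_nat (Suc k - i)) (?t i))"
  proof (intro sum.cong refl arg_cong2[where f="(+)"])
    fix i assume i: "i \<in> {..k}"
    have "cosum w (\<lambda>a b. cosum b (\<lambda>c d. tens (\<theta> a (q i c)) (q (k - i) d))) =
        cosum w (\<lambda>e d. cosum e (\<lambda>a c. tens (\<theta> a (q i c)) (q (k - i) d)))"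
      by (rule cosum_coassoc[symmetric])
    also have "\<dots> = cosum w (\<lambda>e d. fscale (of_nat (Suc i)) (tens (q (Suc i) e) (q (k - i) d)))"
      unfolding tens_scale_left[symmetric] q_Suc
      by (intro cosum_cong) (simp add: cosum_hom[where \<Phi>="\<lambda>x. tens x _", OF tens_add_left])
    also have "\<dots> = fscale (of_nat (Suc i)) (?t (Suc i))"
      by (simp add: cosum_hom[where \<Phi>="fscale _", OF fs.scale_right_distrib] del: of_nat_Suc q.simps)
    finally show "cosum w (\<lambda>a b. cosum b (\<lambda>c d. tens (\<theta> a (q i c)) (q (k - i) d))) = fscale (of_nat (Suc i)) (?t (Suc i))" .
    \<comment> \<open>For action on the right factor the acting letter first has to be moved past
      the left half; the co-Leibniz sign is exactly the one that cocommutativity removes.\<close>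
    have "cosum w (\<lambda>a b. cosum b (\<lambda>c d. sg (wdeg a * wdeg c) (tens (q i c) (\<theta> a (q (k - i) d))))) =
        cosum w (\<lambda>e d. cosum e (\<lambda>a c. sg (wdeg a * wdeg c) (tens (q i c) (\<theta> a (q (k - i) d)))))"
      by (rule cosum_coassoc[symmetric])
    also have "\<dots> = cosum w (\<lambda>e d. cosum e (\<lambda>c a. tens (q i c) (\<theta> a (q (k - i) d))))"
      unfolding cosum_cocomm[of _ "\<lambda>c a. tens (q i c) (\<theta> a (q (k - i) _))"] ..
    also have "\<dots> = cosum w (\<lambda>c b. cosum b (\<lambda>a d. tens (q i c) (\<theta> a (q (k - i) d))))"
      by (rule cosum_coassoc)
    also have "\<dots> = cosum w (\<lambda>c b. fscale (of_nat (Suc (k - i))) (tens (q i c) (q (Suc (k - i)) b)))"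
      unfolding tens_scale_right[symmetric] q_Suc
      by (intro cosum_cong) (simp add: cosum_hom[where \<Phi>="tens _", OF tens_add_right])
    also have "\<dots> = fscale (of_nat (Suc k - i)) (?t i)"
      using i by (simp add: cosum_hom[where \<Phi>="fscale _", OF fs.scale_right_distrib] Suc_diff_le del: of_nat_Suc q.simps)
    finally show "cosum w (\<lambda>a b. cosum b (\<lambda>c d. sg (wdeg a * wdeg c) (tens (q i c) (\<theta> a (q (k - i) d))))) = fscale (of_nat (Suc k - i)) (?t i)" .
  qed
  \<comment> \<open>Both sums are brought to the common range; the terms added have coefficient 0,
    at \<open>i = 0\<close> in the shifted first sum and at \<open>i = Suc k\<close> in the
    second.\<close>
  also have "\<dots> = (\<Sum>i\<le>Suc k. fscale (of_nat i) (?t i)) + (\<Sum>i\<le>Suc k. fscale (of_nat (Suc k - i)) (?t i))"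
  proof -
    have "(\<Sum>i\<le>Suc k. fscale (of_nat i) (?t i)) = (\<Sum>i\<le>k. fscale (of_nat (Suc i)) (?t (Suc i)))"
      by (simp add: sum.atMost_Suc_shift del: of_nat_Suc q.simps sum.atMost_Suc)
    moreover have "(\<Sum>i\<le>Suc k. fscale (of_nat (Suc k - i)) (?t i)) = (\<Sum>i\<le>k. fscale (of_nat (Suc k - i)) (?t i))"
      by (simp del: of_nat_Suc q.simps)
    ultimately show ?thesis by (simp only: sum.distrib)
  qed
  also have "\<dots> = (\<Sum>i\<le>Suc k. fscale (of_nat (Suc k)) (?t i))"
    unfolding sum.distrib[symmetric] fs.scale_left_distrib[symmetric] of_nat_add[symmetric]
    by (intro sum.cong refl) simp
  also have "\<dots> = fscale (of_nat (Suc k)) (\<Sum>i\<le>Suc k. ?t i)"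
    by (rule fs.scale_sum_right[symmetric])
  finally have "cop (fscale (of_nat (Suc k)) (q (Suc k) w)) - fscale (of_nat (Suc k)) (\<Sum>i\<le>Suc k. ?t i) \<in> anull2 W"
    unfolding q_Suc cop_cosum .
  then have "fscale (1 / of_nat (Suc k)) (fscale (of_nat (Suc k)) (cop (q (Suc k) w) - (\<Sum>i\<le>Suc k. ?t i))) \<in> anull2 W"
    unfolding cop_fscale fs.scale_right_diff_distrib[symmetric] by (rule fs.subspace_scale[OF N2])
  then show ?case by (simp del: of_nat_Suc q.simps sum.atMost_Suc)
qed

lemma lin_ext_\<theta>_tens:
  "lin_ext (\<lambda>(a, b). \<theta> a (q k b)) (tens x (gen b)) = lin_ext (\<lambda>a. \<theta> a (q k b)) x"
  "lin_ext (\<lambda>(a, b). \<theta> a (q k b)) (tens (gen a) y) = \<theta> a (lin_ext (q k) y)"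
proof -
  show "lin_ext (\<lambda>(a, b). \<theta> a (q k b)) (tens x (gen b)) = lin_ext (\<lambda>a. \<theta> a (q k b)) x"
    by (simp add: lin_ext_tens)
  show "lin_ext (\<lambda>(a, b). \<theta> a (q k b)) (tens (gen a) y) = \<theta> a (lin_ext (q k) y)"
    unfolding lin_ext_tens lin_ext_gen prod.case
    by (induction y rule: free_induct) (auto simp: lin_ext_add lin_ext_fscale \<theta>_add \<theta>_zero \<theta>_scale)
qed

text \<open>\<open>Suc k\<close> times \<open>q (Suc k)\<close> is the convolution of
  \<open>\<theta>\<close> with \<open>q k\<close>, and the coderivation given by \<open>D\<close>
  distributes over a convolution. The assumption on \<open>\<rho>\<close> handles the left factor
  and the induction hypothesis the right one.\<close>

lemma q_chain:
  assumes "w \<in> awords V"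
  shows "d (q k w) - lin_ext (q k) (D w) \<in> N"
  using assms
proof (induction k arbitrary: w)
  case 0 then show ?case by (simp add: G_chain)
next
  case (Suc k)
  note N = subspace_sym_null[of W]
  interpret d: module_hom fscale fscale d by (rule d_linear)
  let ?c = "1 / of_nat (Suc k) :: 'k"
  have "lin_ext (q (Suc k)) y = fscale ?c (lin_ext (\<lambda>(a, b). \<theta> a (q k b)) (cop y))" for y
    by (induction y rule: free_induct)
      (auto simp: lin_ext_add lin_ext_fscale cop_add cop_fscale fs.scale_right_distrib lin_ext_cosum mult.commute simp del: of_nat_Suc)
  moreover have "cop (D w) = lder (- 1) (lin_ext D) (cop (gen w))"
    using D_coder by (metis coder_def lin_ext_gen)
  ultimately have R: "lin_ext (q (Suc k)) (D w) = fscale ?c (cosum w (\<lambda>a b.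
      lin_ext (\<lambda>u. \<theta> u (q k b)) (D a) + sg (- wdeg a) (\<theta> a (lin_ext (q k) (D b)))))"
    by (simp add: lder_def lin_ext_cosum lin_ext_add lin_ext_sg lin_ext_\<theta>_tens del: of_nat_Suc q.simps)
  have L: "d (q (Suc k) w) = fscale ?c (cosum w (\<lambda>a b. d (\<theta> a (q k b))))"
    by (simp add: d.scale cosum_hom[where \<Phi>=d, OF d.add] del: of_nat_Suc)
  have "cosum w (\<lambda>a b. d (\<theta> a (q k b))) - cosum w (\<lambda>a b.
      lin_ext (\<lambda>u. \<theta> u (q k b)) (D a) + sg (- wdeg a) (\<theta> a (lin_ext (q k) (D b)))) \<in> N"
  proof (rule fs.cosum_cong_mod[OF N])
    fix a b assume *: "set a \<union> set b = set w"
    note ab = cosum_awords[OF Suc.prems *]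
    have 1: "d (\<theta> a (q k b)) - lin_ext (\<lambda>u. \<theta> u (q k b)) (D a) - sg (wdeg a) (\<theta> a (d (q k b))) \<in> N"
      using \<rho>_chain[OF ab(1) hspan_aspan[OF q_mem[OF ab(2)]], of k] unfolding \<theta>_def .
    have 2: "sg (wdeg a) (\<theta> a (d (q k b) - lin_ext (q k) (D b))) \<in> N"
      by (intro fs.subspace_sg N \<theta>_null ab Suc.IH)
    \<comment> \<open>The co-Leibniz sign of the degree \<open>-1\<close> map \<open>D\<close> and
      the sign in the chain condition have exponents of equal parity.\<close>
    have "sg (- wdeg a) x = sg (wdeg a) x" for x :: "'w word \<Rightarrow>\<^sub>0 'k" by (simp add: sg_def)
    then show "d (\<theta> a (q k b)) - (lin_ext (\<lambda>u. \<theta> u (q k b)) (D a) + sg (- wdeg a) (\<theta> a (lin_ext (q k) (D b)))) \<in> N"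
      using fs.subspace_add[OF N 1 2] by (simp add: \<theta>_diff sg_diff algebra_simps)
  qed
  from fs.subspace_scale[OF N this, of ?c] show ?case
    unfolding L R fs.scale_right_diff_distrib .
qed

definition P :: "'u word \<Rightarrow> ('w word \<Rightarrow>\<^sub>0 'k)" where
  "P w = (\<Sum>k\<le>length w. q k w)"

lemma P_eq: "length w \<le> n \<Longrightarrow> P w = (\<Sum>k\<le>n. q k w)"
  unfolding P_def by (rule sum.mono_neutral_left) (auto intro!: q_zero)

lemma P_Nil: "P [] = gen []"
  by (simp add: P_def G_Nil)

lemma P_mem:
  assumes "w \<in> words V"
  shows "P w \<in> fspan (gen ` {ys \<in> words W. wdeg ys = wdeg w})"
proof -
  have "P w \<in> hspan W (wdeg w)"
    unfolding P_def using assms by (intro fs.span_sum q_mem) (simp add: words_iff)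
  moreover have "P w \<in> fspan (gen ` words W)"
    unfolding P_def by (intro fs.span_sum q_ne assms)
  ultimately show ?thesis by (auto simp: mem_fspan_gen)
qed

lemma P_sym: "sym_mod V fscale N P"
proof -
  have "sym_mod V fscale N (\<lambda>w. (\<lambda>n w. \<Sum>k\<le>n. q k w) (length w) w)"
    by (rule sym_mod_by_length) (intro fs.sym_mod_sum subspace_sym_null q_sym)
  then show ?thesis by (simp add: P_def[abs_def])
qed

lemma P_cop:
  assumes w: "w \<in> awords V"
  shows "cop (P w) - cosum w (\<lambda>a b. tens (P a) (P b)) \<in> anull2 W"
proof -
  let ?n = "length w"
  let ?t = "\<lambda>i j. cosum w (\<lambda>a b. tens (q i a) (q j b))"
  have "cosum w (\<lambda>a b. tens (P a) (P b)) = cosum w (\<lambda>a b. \<Sum>i\<le>?n. \<Sum>j\<le>?n. tens (q i a) (q j b))"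
  proof (rule cosum_cong)
    fix a b :: "'u word" assume "length a + length b = ?n"
    then have P: "P a = (\<Sum>i\<le>?n. q i a)" "P b = (\<Sum>j\<le>?n. q j b)" by (auto intro!: P_eq)
    show "tens (P a) (P b) = (\<Sum>i\<le>?n. \<Sum>j\<le>?n. tens (q i a) (q j b))"
      unfolding P tens_sum_left tens_sum_right by (rule sum.swap)
  qed
  also have "\<dots> = (\<Sum>i\<le>?n. \<Sum>j\<le>?n. ?t i j)" by (simp add: cosum_sum)
  also have "\<dots> = (\<Sum>(i, j)\<in>{..?n} \<times> {..?n}. ?t i j)" by (rule sum.cartesian_product)
  \<comment> \<open>If \<open>i + j\<close> exceeds the length of \<open>w\<close>, one of the
    halves is too short for its number of acting letters, so only the triangle contributes; it is
    then summed by diagonals \<open>i + j = k\<close> to meet \<open>q_cop\<close>.\<close>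
  also have "\<dots> = (\<Sum>(i, j)\<in>{(i, j). i + j \<le> ?n}. ?t i j)"
  proof (rule sum.mono_neutral_right)
    show "\<forall>p\<in>{..?n} \<times> {..?n} - {(i, j). i + j \<le> ?n}. (case p of (i, j) \<Rightarrow> ?t i j) = 0"
    proof
      fix p assume "p \<in> {..?n} \<times> {..?n} - {(i, j). i + j \<le> ?n}"
      then obtain i j where p: "p = (i, j)" and ij: "\<not> i + j \<le> ?n" by auto
      have "?t i j = cosum w (\<lambda>a b. 0)"
      proof (rule cosum_cong)
        fix a b :: "'u word" assume "length a + length b = ?n"
        with ij have "length a < i \<or> length b < j" by linarith
        then show "tens (q i a) (q j b) = 0" by (auto simp: q_zero)
      qed
      then show "(case p of (i, j) \<Rightarrow> ?t i j) = 0" by (simp add: p)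
    qed
  qed auto
  also have "\<dots> = (\<Sum>k\<le>?n. \<Sum>i\<le>k. ?t i (k - i))" by (rule sum.triangle_reindex_eq)
  finally have "cop (P w) - cosum w (\<lambda>a b. tens (P a) (P b)) = (\<Sum>k\<le>?n. cop (q k w) - (\<Sum>i\<le>k. ?t i (k - i)))"
    by (simp add: P_def cop_sum sum_subtractf)
  also have "\<dots> \<in> anull2 W"
    by (intro fs.subspace_sum subspace_anull2 q_cop w)
  finally show ?thesis .
qed

lemma P_chain:
  assumes w: "w \<in> awords V"
  shows "lin_ext P (D w) - d (P w) \<in> N"
proof -
  let ?n = "length w"
  interpret d: module_hom fscale fscale d by (rule d_linear)
  \<comment> \<open>The words in \<open>D w\<close> may have various lengths, but none exceeds that
    of \<open>w\<close>; one upper bound of summation serves them all.\<close>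
  have "lin_ext P (D w) = lin_ext (\<lambda>u. \<Sum>k\<le>?n. q k u) (D w)"
    by (rule lin_ext_cong, rule P_eq) (use D_length[of w] in \<open>auto simp: mem_fspan_gen\<close>)
  also have "\<dots> = (\<Sum>k\<le>?n. lin_ext (q k) (D w))"
    unfolding lin_ext_def fs.scale_sum_right by (rule sum.swap)
  finally have "lin_ext P (D w) - d (P w) = (\<Sum>k\<le>?n. - (d (q k w) - lin_ext (q k) (D w)))"
    by (simp add: P_def d.sum sum_subtractf)
  also have "\<dots> \<in> N"
    by (intro fs.subspace_sum fs.subspace_neg subspace_sym_null q_chain w)
  finally show ?thesis .
qed

end

section \<open>The factorization\<close>

lemma coder_add:
  assumes "coder e \<Phi>" "coder e \<Psi>"
  shows "coder e (\<lambda>x. \<Phi> x + \<Psi> x)"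
proof -
  interpret \<Phi>: module_hom fscale fscale \<Phi> using assms by (simp add: coder_def)
  interpret \<Psi>: module_hom fscale fscale \<Psi> using assms by (simp add: coder_def)
  show ?thesis
  proof (rule coderI)
    show "module_hom fscale fscale (\<lambda>x. \<Phi> x + \<Psi> x)"
      by unfold_locales (simp_all add: \<Phi>.add \<Psi>.add \<Phi>.scale \<Psi>.scale fs.scale_right_distrib)
    show "\<Phi> (gen w) + \<Psi> (gen w) \<in> fspan (gen ` {ys. ys \<noteq> [] \<and> wdeg ys = wdeg w + e})" for w
      using assms by (auto simp: coder_def intro: fs.span_add)
    fix w
    have "cop (\<Phi> (gen w)) = lder e \<Phi> (cop (gen w))" "cop (\<Psi> (gen w)) = lder e \<Psi> (cop (gen w))"
      using assms by (simp_all add: coder_def)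
    then show "cop (\<Phi> (gen w) + \<Psi> (gen w)) = cosum w (\<lambda>a b. tens (\<Phi> (gen a) + \<Psi> (gen a)) (gen b)
        + sg (e * wdeg a) (tens (gen a) (\<Phi> (gen b) + \<Psi> (gen b))))"
      by (simp add: cop_add lder_def lin_ext_cosum tens_add_left tens_add_right sg_add
          flip: cosum_add) (simp add: algebra_simps)
  qed
qed

lemma words_awords: "w \<in> words V \<Longrightarrow> w \<in> awords V"
  by (simp add: words_iff)

lemma lmul_letter_add:
  assumes "y \<in> gcomp V i" "y' \<in> gcomp V i" "x \<in> aspan V"
  shows "lmul (i, y + y') x - lmul (i, y) x - lmul (i, y') x \<in> sym_null V"
  using assms(3)
proof (induction rule: fspan_gen_induct)
  case (gen w)
  then show ?case using sym_modD(1)[OF sym_mod_gen awords_Nil gen assms(1,2)] by simp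
next
  case (add x x')
  from fs.subspace_add[OF subspace_sym_null this] show ?case by (simp add: lmul_add algebra_simps)
next
  case (scale c x)
  from fs.subspace_scale[OF subspace_sym_null this, of c] show ?case
    by (simp add: lmul_fscale fs.scale_right_diff_distrib)
qed (simp add: fs.subspace_0)

lemma lmul_letter_scale:
  assumes "y \<in> gcomp V i" "x \<in> aspan V"
  shows "lmul (i, gscale V c y) x - fscale c (lmul (i, y) x) \<in> sym_null V"
  using assms(2)
proof (induction rule: fspan_gen_induct)
  case (gen w)
  then show ?case using sym_modD(2)[OF sym_mod_gen awords_Nil gen assms(1)] by simp
next
  case (add x x')
  from fs.subspace_add[OF subspace_sym_null this] show ?case
    by (simp add: lmul_add fs.scale_right_distrib algebra_simps)
next
  case (scale c' x)
  from fs.subspace_scale[OF subspace_sym_null this, of c'] show ?case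
    by (simp add: lmul_fscale fs.scale_right_diff_distrib mult.commute)
qed (simp add: fs.subspace_0)

lemma lmul_zero_letter:
  assumes "is_gvs V" "x \<in> aspan V"
  shows "lmul (i, 0) x \<in> sym_null V"
proof -
  interpret vector_space "gscale V" using is_gvsD[OF assms(1)] by simp
  show ?thesis using lmul_letter_scale[OF is_gvsD(2)[OF assms(1)] assms(2), of i 0] by simp
qed

lemma lmul_aspan:
  assumes "snd z \<in> gcomp V (fst z)" "x \<in> aspan V"
  shows "lmul z x \<in> aspan V"
  using assms(2)
  by (induction rule: fspan_gen_induct)
    (use assms(1) in \<open>auto simp: lmul_add lmul_fscale fs.span_zero intro: fs.span_add fs.span_scale fs.span_base\<close>)

lemma codiff_facts:
  fixes L :: "('k::field_char_0, 'v::ab_group_add) linf"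
  assumes L: "linf_algebra L"
  shows codiff_null: "x \<in> sym_null (suspL L) \<Longrightarrow> codiff L x \<in> sym_null (suspL L)"
    and codiff_aspan: "x \<in> aspan (suspL L) \<Longrightarrow> codiff L x \<in> aspan (suspL L)"
    and codiff_codiff: "x \<in> aspan (suspL L) \<Longrightarrow> codiff L (codiff L x) \<in> sym_null (suspL L)"
    and codiff_sym_free: "x \<in> sym_free (suspL L) \<Longrightarrow> codiff L x \<in> sym_free (suspL L)"
proof -
  note A = linf_algebraD[OF L]
  note C = comps_facts[OF A(1,2)]
  have co: "coderivation (- 1) (suspL L) (codiff L)" using C(4) by (simp add: induced_coderivation_def)
  then show "x \<in> sym_null (suspL L) \<Longrightarrow> codiff L x \<in> sym_null (suspL L)"
    by (simp add: coderivation_def sym_hom_def)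
  show "x \<in> sym_free (suspL L) \<Longrightarrow> codiff L x \<in> sym_free (suspL L)"
    by (rule coderivation_sym_free[OF co])
  show "x \<in> aspan (suspL L) \<Longrightarrow> codiff L (codiff L x) \<in> sym_null (suspL L)"
    by (rule codiff_square[OF A])
  show "codiff L x \<in> aspan (suspL L)" if "x \<in> aspan (suspL L)"
    using that
  proof (induction rule: fspan_gen_induct)
    case (gen a)
    have "cder (- 1) (comps L) a \<in> fspan (gen ` {ys \<in> words (suspL L). wdeg ys = wdeg a + - 1})"
      by (rule cder_mem[OF C(3) gen])
    then show ?case by (auto simp: mem_fspan_gen words_iff)
  qed (auto simp: lin_ext_add lin_ext_fscale fs.span_zero intro: fs.span_add fs.span_scale)
qed

locale linf_factorization =
  fixes L :: "('k::field_char_0, 'v::ab_group_add) linf"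
    and L' :: "('k, 'w::ab_group_add) linf"
    and f :: "'v word \<Rightarrow> 'w"
    and F :: "('v word \<Rightarrow>\<^sub>0 'k) \<Rightarrow> ('w word \<Rightarrow>\<^sub>0 'k)"
  assumes L: "linf_algebra L" and L': "linf_algebra L'"
    and F: "induced_coalgebra_hom L L' f F"
    and F_chain: "\<And>x. x \<in> sym_free (suspL L) \<Longrightarrow> F (codiff L x) - codiff L' (F x) \<in> sym_null (suspL L')"
begin

section \<open>The product of \<open>L\<close> with the cone\<close>

abbreviation "V \<equiv> suspL L"
abbreviation "W \<equiv> suspL L'"
abbreviation "d \<equiv> codiff L'"

text \<open>\<open>Epart i\<close> holds the generators \<open>e\<close>, and \<open>Bpart i\<close>
  their formal differentials, hence the shift by one in the latter. The cut-off parts are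
  \<open>{0}\<close> and not empty because they must be subspaces.\<close>

definition Epart :: "int \<Rightarrow> 'w set" where
  "Epart i = (if i \<ge> 1 then gcomp (underlying L') i else {0})"

definition Bpart :: "int \<Rightarrow> 'w set" where
  "Bpart i = (if i \<ge> 0 then gcomp (underlying L') (i + 1) else {0})"

definition U :: "('k, 'v \<times> 'w \<times> 'w) gvs" where
  "U = \<lparr>gscale = (\<lambda>c (v, e, b). (gscale (underlying L) c v, gscale (underlying L') c e, gscale (underlying L') c b)),
        gcomp = (\<lambda>i. gcomp (underlying L) i \<times> Epart i \<times> Bpart i)\<rparr>"

definition fst_letter :: "int \<times> 'v \<times> 'w \<times> 'w \<Rightarrow> int \<times> 'v" where
  "fst_letter z = (fst z, fst (snd z))"

definition incl_letter :: "int \<times> 'v \<Rightarrow> int \<times> 'v \<times> 'w \<times> 'w" where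
  "incl_letter z = (fst z, snd z, 0, 0)"

text \<open>All brackets of \<open>L\<close> see only the first slot, so the cone is abelian; its
  sole structure is the differential, which copies the \<open>e\<close> slot into the
  \<open>b\<close> slot.\<close>

definition M :: "('k, 'v \<times> 'w \<times> 'w) linf" where
  "M = \<lparr>underlying = U, bracket = (\<lambda>xs. (bracket L (map fst_letter xs), 0,
          if length xs = 1 then fst (snd (snd (hd xs))) else 0))\<rparr>"

lemma gvs: "is_gvs (underlying L)" "is_gvs (underlying L')" "is_gvs V" "is_gvs W"
  using linf_algebraD[OF L] linf_algebraD[OF L'] by (auto simp: is_gvs_susp)

sublocale VL: vector_space "gscale (underlying L)" by (rule is_gvsD(1)[OF gvs(1)])
sublocale WL: vector_space "gscale (underlying L')" by (rule is_gvsD(1)[OF gvs(2)])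

lemma M_simps [simp]: "underlying M = U"
  by (simp add: M_def)

lemma U_simps:
  "gscale U c x = (gscale (underlying L) c (fst x), gscale (underlying L') c (fst (snd x)), gscale (underlying L') c (snd (snd x)))"
  "x \<in> gcomp U i \<longleftrightarrow> fst x \<in> gcomp (underlying L) i \<and> fst (snd x) \<in> Epart i \<and> snd (snd x) \<in> Bpart i"
  by (auto simp: U_def case_prod_beta mem_Times_iff)

lemma subspace_parts:
  "WL.subspace (Epart i)" "WL.subspace (Bpart i)" "VL.subspace (gcomp (underlying L) i)"
  using is_gvsD(5)[OF gvs(1)] is_gvsD(5)[OF gvs(2)]
  by (auto simp: Epart_def Bpart_def WL.subspace_single_0)

lemma parts_subset: "Epart i \<subseteq> gcomp (underlying L') i" "Bpart i \<subseteq> gcomp (underlying L') (i + 1)"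
  using is_gvsD(2)[OF gvs(2)] by (auto simp: Epart_def Bpart_def)

lemma gvs_U: "is_gvs U"
proof -
  have vs: "vector_space (gscale U)"
    by unfold_locales
      (auto simp: U_simps prod_eq_iff VL.scale_right_distrib WL.scale_right_distrib
        VL.scale_left_distrib WL.scale_left_distrib)
  interpret U: vector_space "gscale U" by (rule vs)
  have "U.subspace (gcomp U i)" for i
    using subspace_parts[of i]
    by (auto simp: U.subspace_def VL.subspace_def WL.subspace_def U_simps)
  with vs show ?thesis by (simp add: is_gvs_def)
qed

lemma wdeg_maps [simp]:
  "wdeg (map fst_letter xs) = wdeg xs" "wdeg (map incl_letter ys) = wdeg ys"
  by (simp_all add: wdeg_def comp_def fst_letter_def incl_letter_def)

lemma awords_maps:
  "xs \<in> awords U \<Longrightarrow> map fst_letter xs \<in> awords (underlying L)"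
  "xs \<in> awords (susp U) \<Longrightarrow> map fst_letter xs \<in> awords V"
  "ys \<in> awords V \<Longrightarrow> map incl_letter ys \<in> awords (susp U)"
proof -
  show "xs \<in> awords U \<Longrightarrow> map fst_letter xs \<in> awords (underlying L)"
    by (induction xs) (auto simp: fst_letter_def U_simps)
  show "xs \<in> awords (susp U) \<Longrightarrow> map fst_letter xs \<in> awords V"
    by (induction xs) (auto simp: fst_letter_def U_simps)
  show "ys \<in> awords V \<Longrightarrow> map incl_letter ys \<in> awords (susp U)"
    using subspace_parts
    by (induction ys) (auto simp: incl_letter_def U_simps WL.subspace_0)
qed

lemma skew_M: "skew_family U U (\<lambda>k. int k - 2) (bracket M)"
proof (rule skew_familyI)
  note S = skew_familyD[OF linf_algebraD(2)[OF L]]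
  {
    fix xs assume xs: "xs \<in> words U"
    then have "map fst_letter xs \<in> words (underlying L)" using awords_maps(1) by (auto simp: words_iff)
    from S(1)[OF this] have 1: "bracket L (map fst_letter xs) \<in> gcomp (underlying L) (wdeg xs + (int (length xs) - 2))"
      by simp
    have "fst (snd (snd (hd xs))) \<in> Bpart (wdeg xs + (int (length xs) - 2))" if "length xs = 1"
    proof -
      from that obtain z where "xs = [z]" by (auto simp: length_Suc_conv)
      then show ?thesis using xs by (auto simp: words_iff U_simps Epart_def Bpart_def split: if_splits)
    qed
    with 1 show "bracket M xs \<in> gcomp U (wdeg xs + (int (length xs) - 2))"
      using subspace_parts by (auto simp: M_def U_simps WL.subspace_0)
  next
    fix xs i x y ys assume *: "xs \<in> awords U" "ys \<in> awords U" "x \<in> gcomp U i" "y \<in> gcomp U i"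
    then show "bracket M (xs @ (i, x + y) # ys) = bracket M (xs @ (i, x) # ys) + bracket M (xs @ (i, y) # ys)"
      using S(2)[OF awords_maps(1)[OF *(1)] awords_maps(1)[OF *(2)], of "fst x" i "fst y"]
      by (auto simp: M_def fst_letter_def U_simps)
  next
    fix xs i c x ys assume *: "xs \<in> awords U" "ys \<in> awords U" "x \<in> gcomp U i"
    then show "bracket M (xs @ (i, gscale U c x) # ys) = gscale U c (bracket M (xs @ (i, x) # ys))"
      using S(3)[OF awords_maps(1)[OF *(1)] awords_maps(1)[OF *(2)], of "fst x" i c]
      by (auto simp: M_def fst_letter_def U_simps)
  next
    fix xs i x j y ys assume *: "xs \<in> awords U" "ys \<in> awords U" "x \<in> gcomp U i" "y \<in> gcomp U j"
    then show "bracket M (xs @ (i, x) # (j, y) # ys) = gscale U (- sgn_pow (i * j)) (bracket M (xs @ (j, y) # (i, x) # ys))"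
      using S(4)[OF awords_maps(1)[OF *(1)] awords_maps(1)[OF *(2)], of "fst x" i "fst y" j]
      by (auto simp: M_def fst_letter_def U_simps)
  }
qed

lemma comps_M: "susp_components U (bracket M) xs = (comps L (map fst_letter xs), 0, if length xs = 1 then fst (snd (snd (hd xs))) else 0)"
proof -
  have 1: "map fst_letter (shift n ys) = shift n (map fst_letter ys)" for n ys
    by (induction ys) (auto simp: fst_letter_def)
  have 2: "susp_exp (map fst_letter xs) = susp_exp xs"
    by (induction xs) (auto simp: fst_letter_def)
  have 3: "sg n (x, 0, y) = (sg n x, 0, sg n y)" for n and x :: 'v and y :: 'w
    by (simp add: sg_def)
  show ?thesis
  proof (cases "length xs = 1")
    case True
    then obtain z where "xs = [z]" by (auto simp: length_Suc_conv)
    then show ?thesis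
      by (simp add: susp_components_eq[OF is_gvsD(1)[OF gvs_U]] susp_components_eq[OF is_gvsD(1)[OF gvs(1)]]
          M_def fst_letter_def)
  next
    case False
    then show ?thesis
      by (simp add: susp_components_eq[OF is_gvsD(1)[OF gvs_U]] susp_components_eq[OF is_gvsD(1)[OF gvs(1)]]
          M_def 1 2 3)
  qed
qed

lemma linf_M: "linf_algebra M"
proof (rule linf_algebraI)
  show "is_gvs (underlying M)" by (simp add: gvs_U)
  show "skew_family (underlying M) (underlying M) (\<lambda>k. int k - 2) (bracket M)" by (simp add: skew_M)
  fix xs assume "xs \<in> words (suspL M)"
  then have xs: "map fst_letter xs \<in> words V" using awords_maps(2) by (auto simp: words_iff)
  have gM: "is_gvs (susp U)" by (simp add: is_gvs_susp gvs_U)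
  let ?h = "\<lambda>a b. if a = [] then 0 else comps L ((wdeg a + - 1, comps L a) # b)"
  have "comp_ext (suspL M) (comps M) (cder (- 1) (comps M) xs) =
      cosum xs (\<lambda>a b. if a = [] then 0 else comps M ((wdeg a + - 1, comps M a) # b))"
    unfolding cder_def M_simps cosum_hom[where \<Phi>="comp_ext (susp U) _", OF comp_ext_add[OF gM]]
    by (intro cosum_cong) (auto simp: comp_ext_zero[OF gM] comp_ext_gen[OF gM])
  \<comment> \<open>The \<open>e\<close> slot of every value of the bracket is 0, and a second
    application can put only that slot into the cone; hence the cone slots of the square vanish and
    the identities for \<open>L\<close> remain.\<close>
  also have "\<dots> = cosum xs (\<lambda>a b. (?h (map fst_letter a) (map fst_letter b), 0, 0))"
    by (intro cosum_cong) (auto simp: comps_M fst_letter_def zero_prod_def)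
  also have "\<dots> = (cosum xs (\<lambda>a b. ?h (map fst_letter a) (map fst_letter b)), 0, 0)"
    by (rule cosum_hom[where \<Phi>="\<lambda>x. (x, 0, 0)", symmetric]) simp
  also have "cosum xs (\<lambda>a b. ?h (map fst_letter a) (map fst_letter b)) = cosum (map fst_letter xs) ?h"
    by (rule cosum_map[symmetric]) (simp add: fst_letter_def)
  also have "\<dots> = comp_ext V (comps L) (cder (- 1) (comps L) (map fst_letter xs))"
    unfolding cder_def cosum_hom[where \<Phi>="comp_ext V (comps L)", OF comp_ext_add[OF gvs(3)]]
    by (intro cosum_cong) (auto simp: comp_ext_zero[OF gvs(3)] comp_ext_gen[OF gvs(3)])
  also have "\<dots> = 0" by (rule linf_algebraD(3)[OF L xs])
  finally show "comp_ext (suspL M) (comps M) (cder (- 1) (comps M) xs) = 0"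
    by (simp add: zero_prod_def)
qed

section \<open>The strict inclusion of \<open>L\<close>\<close>

definition j :: "'v word \<Rightarrow> 'v \<times> 'w \<times> 'w" where
  "j w = (if length w = 1 then (snd (hd w), 0, 0) else 0)"

definition J :: "('v word \<Rightarrow>\<^sub>0 'k) \<Rightarrow> ((int \<times> 'v \<times> 'w \<times> 'w) list \<Rightarrow>\<^sub>0 'k)" where
  "J = lin_ext (\<lambda>w. gen (map incl_letter w))"

lemma sym_mod_incl:
  assumes "sym_mod (susp U) s N g"
  shows "sym_mod V s N (\<lambda>w. g (map incl_letter w))"
  by (rule sym_mod_map[OF assms gvs(3)])
    (use subspace_parts in \<open>auto simp: incl_letter_def U_simps WL.subspace_0 split: prod.splits\<close>)

lemma skew_j: "skew_family (underlying L) U (\<lambda>k. int k - 1) j"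
proof (rule skew_familyI)
  fix xs assume xs: "xs \<in> words (underlying L)"
  show "j xs \<in> gcomp U (wdeg xs + (int (length xs) - 1))"
  proof (cases "length xs = 1")
    case True
    then obtain z where "xs = [z]" by (auto simp: length_Suc_conv)
    then show ?thesis using xs subspace_parts by (auto simp: j_def words_iff U_simps WL.subspace_0)
  next
    case False
    then show ?thesis using is_gvsD(2)[OF gvs_U] by (simp add: j_def)
  qed
qed (auto simp: j_def U_simps zero_prod_def)

lemma induced_J: "induced_coalgebra_hom L M j J"
  unfolding induced_coalgebra_hom_def
proof
  have sym: "sym_mod V fscale (sym_null (susp U)) (\<lambda>w. gen (map incl_letter w))"
    by (rule sym_mod_incl[OF sym_mod_gen])
  show "coalgebra_hom V (suspL M) J"
    unfolding J_def
  proof (rule coalgebra_homI)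
    show "gen (map incl_letter w) \<in> fspan (gen ` {ys \<in> words (suspL M). wdeg ys = wdeg w})"
      if "w \<in> words V" for w
      using that awords_maps(3) by (intro fs.span_base) (auto simp: words_iff)
    show "cop (gen (map incl_letter w)) -
        cosum w (\<lambda>a b. tens (gen (map incl_letter a)) (gen (map incl_letter b))) \<in> anull2 (suspL M)" for w
      by (simp add: cosum_map incl_letter_def fs.subspace_0)
  qed (simp_all add: sym)
  show "has_components 0 V (suspL M) J (susp_components (underlying M) j)"
    unfolding has_components_def
  proof (intro ballI allI)
    fix xs i assume "xs \<in> words V"
    have gM: "is_gvs (suspL M)" by (simp add: is_gvs_susp gvs_U)
    show "sym_proj (suspL M) i (J (gen xs)) = (if i = wdeg xs + 0 then susp_components (underlying M) j xs else 0)"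
    proof (cases "length xs = 1")
      case True
      then obtain z where "xs = [z]" by (auto simp: length_Suc_conv)
      then show ?thesis
        using sym_proj_gen[OF gM, of i "[incl_letter z]"]
        by (auto simp: J_def susp_components_eq[OF is_gvsD(1)[OF gvs_U]] j_def incl_letter_def)
    next
      case False
      then show ?thesis
        using sym_proj_gen[OF gM, of i "map incl_letter xs"]
        by (simp add: J_def susp_components_eq[OF is_gvsD(1)[OF gvs_U]] j_def)
    qed
  qed
qed

text \<open>Included letters have zero cone slots, so both sides are the same sum over unshuffles
  and agree even before passing to the quotient.\<close>

lemma J_chain: "J (codiff L x) = codiff M (J x)"
proof (induction x rule: free_induct)
  case (gen w)
  have "susp_components U (bracket M) (map incl_letter a) = (comps L a, 0, 0)" for a
  proof -
    have "map fst_letter (map incl_letter a) = a" by (simp add: comp_def fst_letter_def incl_letter_def)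
    moreover have "fst (snd (snd (hd (map incl_letter a)))) = 0" if "length a = 1"
      using that by (auto simp: length_Suc_conv incl_letter_def)
    ultimately show ?thesis by (simp add: comps_M)
  qed
  then have "cder (- 1) (susp_components U (bracket M)) (map incl_letter w) = cosum w (\<lambda>a b. J (if a = [] then 0 else gen ((wdeg a + - 1, comps L a) # b)))"
    unfolding cder_def
    by (subst cosum_map) (auto simp: incl_letter_def J_def intro!: cosum_cong)
  moreover have "J (cder (- 1) (comps L) w) = cosum w (\<lambda>a b. J (if a = [] then 0 else gen ((wdeg a + - 1, comps L a) # b)))"
    unfolding cder_def by (rule cosum_hom) (simp add: J_def lin_ext_add)
  ultimately show ?case by (simp add: J_def)
qed (auto simp: J_def lin_ext_add lin_ext_fscale)

lemma morphism_j: "linf_morphism L M j"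
  by (rule linf_morphismI[OF L linf_M _ induced_J])
    (simp_all add: skew_j J_chain fs.subspace_0)

section \<open>The action of the cone on the coalgebra of \<open>L'\<close>\<close>

definition comm :: "int \<times> 'w \<Rightarrow> ('w word \<Rightarrow>\<^sub>0 'k) \<Rightarrow> ('w word \<Rightarrow>\<^sub>0 'k)" where
  "comm z x = d (lmul z x) - sg (- 1 * fst z) (lmul z (d x))"

text \<open>An element \<open>b\<close> of degree \<open>i\<close> in the cone is an element of
  degree \<open>i + 1\<close> in \<open>L'\<close>, so it is multiplied in as a letter of one degree
  more; the commutator with \<open>d\<close> brings the degree back. The slot from \<open>L\<close>
  does not act; it enters through \<open>G\<close>.\<close>

definition \<rho> :: "int \<times> 'v \<times> 'w \<times> 'w \<Rightarrow> ('w word \<Rightarrow>\<^sub>0 'k) \<Rightarrow> ('w word \<Rightarrow>\<^sub>0 'k)" where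
  "\<rho> z x = lmul (fst z, fst (snd (snd z))) x + comm (fst z + 1, snd (snd (snd z))) x"

lemma comm_coder: "coder (fst z - 1) (comm z)"
proof -
  have "coder (- 1) d" by (rule coder_cder)
  from coder_commutator[OF this coder_lmul[of z]] show ?thesis
    by (simp add: comm_def[abs_def])
qed

lemma \<rho>_coder: "coder (fst z) (\<rho> z)"
proof -
  have "coder (fst z) (comm (fst z + 1, snd (snd (snd z))))"
    using comm_coder[of "(fst z + 1, snd (snd (snd z)))"] by simp
  from coder_add[OF _ this] coder_lmul[of "(fst z, fst (snd (snd z)))"] show ?thesis
    by (simp add: \<rho>_def[abs_def])
qed

lemma comm_facts:
  assumes z: "snd z \<in> gcomp W (fst z)"
  shows comm_null: "x \<in> sym_null W \<Longrightarrow> comm z x \<in> sym_null W"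
    and comm_aspan: "x \<in> aspan W \<Longrightarrow> comm z x \<in> aspan W"
  unfolding comm_def
  using codiff_facts[OF L'] lmul_null[OF _ z] lmul_aspan[OF z]
  by (auto intro!: fs.subspace_diff fs.subspace_sg subspace_sym_null fs.subspace_span)

lemma comm_letter_add:
  assumes "y \<in> gcomp W i" "y' \<in> gcomp W i" "x \<in> aspan W"
  shows "comm (i, y + y') x - comm (i, y) x - comm (i, y') x \<in> sym_null W"
proof -
  note N = subspace_sym_null[of W]
  have 1: "d (lmul (i, y + y') x - lmul (i, y) x - lmul (i, y') x) \<in> sym_null W"
    by (intro codiff_null[OF L'] lmul_letter_add assms)
  have 2: "sg (- 1 * i) (lmul (i, y + y') (d x) - lmul (i, y) (d x) - lmul (i, y') (d x)) \<in> sym_null W"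
    by (intro fs.subspace_sg N lmul_letter_add assms codiff_aspan[OF L'])
  show ?thesis
    unfolding comm_def using fs.subspace_diff[OF N 1 2]
    by (simp only: lin_ext_diff sg_diff fst_conv) (simp add: algebra_simps)
qed

lemma comm_letter_scale:
  assumes "y \<in> gcomp W i" "x \<in> aspan W"
  shows "comm (i, gscale W c y) x - fscale c (comm (i, y) x) \<in> sym_null W"
proof -
  note N = subspace_sym_null[of W]
  have 1: "d (lmul (i, gscale W c y) x - fscale c (lmul (i, y) x)) \<in> sym_null W"
    by (intro codiff_null[OF L'] lmul_letter_scale assms)
  have 2: "sg (- 1 * i) (lmul (i, gscale W c y) (d x) - fscale c (lmul (i, y) (d x))) \<in> sym_null W"
    by (intro fs.subspace_sg N lmul_letter_scale assms codiff_aspan[OF L'])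
  show ?thesis
    using fs.subspace_diff[OF N 1 2]
    by (simp add: comm_def lin_ext_diff lin_ext_fscale sg_diff fs.scale_right_diff_distrib fs.scale_sg algebra_simps)
qed

lemma letter_parts:
  assumes "snd z \<in> gcomp (susp U) (fst z)"
  shows "fst (snd (snd z)) \<in> gcomp W (fst z)" "snd (snd (snd z)) \<in> gcomp W (fst z + 1)"
  using assms parts_subset[of "fst z - 1"] by (auto simp: U_simps)

lemma part_mem:
  assumes "u \<in> gcomp (susp U) i"
  shows "fst (snd u) \<in> gcomp W i" "snd (snd u) \<in> gcomp W (i + 1)"
  using letter_parts[of "(i, u)"] assms by simp_all

lemma comm_zero:
  assumes "x \<in> aspan W"
  shows "comm (i, 0) x \<in> sym_null W"
  unfolding comm_def using lmul_zero_letter[OF gvs(4)] codiff_facts[OF L'] assms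
  by (auto intro!: fs.subspace_diff fs.subspace_sg subspace_sym_null)

lemma \<rho>_zero:
  assumes "fst (snd (snd z)) = 0" "snd (snd (snd z)) = 0" "x \<in> aspan W"
  shows "\<rho> z x \<in> sym_null W"
  using assms lmul_zero_letter[OF gvs(4)] comm_zero by (simp add: \<rho>_def fs.subspace_add)

abbreviation G :: "(int \<times> 'v \<times> 'w \<times> 'w) list \<Rightarrow> ('w word \<Rightarrow>\<^sub>0 'k)" where
  "G w \<equiv> unital F (map fst_letter w)"

lemma F_hom: "coalgebra_hom V W F"
  using F by (simp add: induced_coalgebra_hom_def)

lemma lin_ext_unital:
  assumes "x \<in> sym_free V"
  shows "lin_ext (unital F) x = F x"
proof -
  interpret F: module_hom fscale fscale F using F_hom by (simp add: coalgebra_hom_def sym_hom_def)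
  from assms show ?thesis
    unfolding sym_free_def
    by (induction rule: fspan_gen_induct)
      (auto simp: F.zero F.add F.scale lin_ext_add lin_ext_fscale unital_def words_iff)
qed

text \<open>For a single letter, commuting \<open>d\<close> with \<open>m_e + [d, m_b]\<close> gives
  \<open>[d, m_e]\<close>, since \<open>[d, [d, m_b]]\<close> vanishes by \<open>d d = 0\<close>;
  and \<open>[d, m_e]\<close> is how the differential of \<open>e\<close> acts. For longer words the
  cone slots of the bracket are 0, so the operator is null.\<close>

lemma \<rho>_chain:
  assumes w: "w \<in> awords (susp U)" and x: "x \<in> aspan W"
  shows "d (if length w = 1 then \<rho> (hd w) x else 0)
          - lin_ext (\<lambda>u. if length u = 1 then \<rho> (hd u) x else 0) (cder (- 1) (comps M) w)
          - sg (wdeg w) (if length w = 1 then \<rho> (hd w) (d x) else 0) \<in> sym_null W"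
proof -
  note N = subspace_sym_null[of W]
  note L'f = codiff_facts[OF L']
  have "lin_ext (\<lambda>u. if length u = 1 then \<rho> (hd u) x else 0) (cder (- 1) (comps M) w)
     = cosum w (\<lambda>a b. if b = [] then if a = [] then 0 else \<rho> (wdeg a + - 1, comps M a) x else 0)"
    unfolding cder_def lin_ext_cosum by (intro cosum_cong) auto
  then have R: "lin_ext (\<lambda>u. if length u = 1 then \<rho> (hd u) x else 0) (cder (- 1) (comps M) w)
     = (if w = [] then 0 else \<rho> (wdeg w + - 1, comps M w) x)"
    by (simp only: cosum_counit_right)
  show ?thesis
  proof (cases "length w = 1")
    case False
    then show ?thesis
      unfolding R using \<rho>_zero[of "(wdeg w + - 1, comps M w)" x] x
      by (auto simp: comps_M fs.subspace_0 fs.subspace_neg)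
  next
    case True
    then obtain i v e b where wz: "w = [(i, v, e, b)]" by (auto simp: length_Suc_conv)
    have e: "e \<in> gcomp W i" and b: "b \<in> gcomp W (i + 1)"
      using letter_parts[of "(i, v, e, b)"] w by (auto simp: wz)
    have 1: "lmul (i - 1, 0) x \<in> sym_null W" by (rule lmul_zero_letter[OF gvs(4) x])
    have 2: "d (d (lmul (i + 1, b) x)) \<in> sym_null W"
      by (intro L'f(3) lmul_aspan x) (use b in simp)
    have 3: "lmul (i + 1, b) (d (d x)) \<in> sym_null W"
      by (rule lmul_null[OF L'f(3)[OF x]]) (use b in simp)
    have "d (\<rho> (i, v, e, b) x) - \<rho> (i + - 1, comps M w) x - sg i (\<rho> (i, v, e, b) (d x)) =
      d (d (lmul (i + 1, b) x)) - lmul (i + 1, b) (d (d x)) - lmul (i - 1, 0) x"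
      by (simp add: \<rho>_def comm_def comps_M wz lin_ext_add lin_ext_diff lin_ext_sg)
        (simp add: sg_def)
    also have "\<dots> \<in> sym_null W" by (intro fs.subspace_diff N 1 2 3)
    finally show ?thesis unfolding R by (simp add: wz)
  qed
qed

sublocale act: coalgebra_action "susp U" W "cder (- 1) (comps M)" d G \<rho>
proof (rule coalgebra_action.intro)
  have gU: "is_gvs (susp U)" by (simp add: is_gvs_susp gvs_U)
  note N = subspace_sym_null[of W]
  show "coder (- 1) (lin_ext (cder (- 1) (comps M)) :: ((int \<times> 'v \<times> 'w \<times> 'w) list \<Rightarrow>\<^sub>0 'k) \<Rightarrow> _)" by (rule coder_cder)
  show "cder (- 1) (comps M) w \<in> fspan (gen ` {ys. length ys \<le> length w})" for w
    by (rule cder_length)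
  show "module_hom fscale fscale d" by (rule module_hom_lin_ext)
  show "d x \<in> sym_null W" if "x \<in> sym_null W" for x by (rule codiff_null[OF L' that])
  show "G [] = gen []" by (simp add: unital_def)
  show "G w \<in> hspan W (wdeg w)" if "w \<in> awords (susp U)" for w
    using coalgebra_homD(1)[OF F_hom awords_maps(2)[OF that]] by simp
  show "G w \<in> fspan (gen ` words W)" if "w \<in> words (susp U)" for w
    using coalgebra_homD(2)[OF F_hom awords_maps(2), of w] that by (auto simp: words_iff mem_fspan_gen)
  show "sym_mod (susp U) fscale (sym_null W) (\<lambda>w. G w)"
    by (rule sym_mod_map[OF sym_mod_unital[OF F_hom] gU]) (auto simp: fst_letter_def U_simps)
  show "cop (G w) - cosum w (\<lambda>a b. tens (G a) (G b)) \<in> anull2 W" if "w \<in> awords (susp U)" for w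
    using coalgebra_homD(3)[OF F_hom awords_maps(2)[OF that]] by (simp add: cosum_map fst_letter_def)
  show "d (G w) - lin_ext (\<lambda>w. G w) (cder (- 1) (comps M) w) \<in> sym_null W" if w: "w \<in> awords (susp U)" for w
  proof (cases "w = []")
    case True then show ?thesis by (simp add: unital_def fs.subspace_0)
  next
    case False
    let ?w = "map fst_letter w"
    have x: "gen ?w \<in> sym_free V"
      using awords_maps(2)[OF w] False by (auto simp: sym_free_def words_iff intro!: fs.span_base)
    have "lin_ext (\<lambda>w. G w) (cder (- 1) (comps M) w) = lin_ext (unital F) (cder (- 1) (comps L) ?w)"
      unfolding cder_def
      by (subst cosum_map) (auto simp: lin_ext_cosum comps_M fst_letter_def intro!: cosum_cong)
    also have "\<dots> = F (codiff L (gen ?w))"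
      using codiff_sym_free[OF L x] by (simp add: lin_ext_unital)
    finally show ?thesis
      using fs.subspace_neg[OF N F_chain[OF x]] False by (simp add: unital_def)
  qed
  show "coder (fst z) (\<rho> z)" for z by (rule \<rho>_coder)
  show "\<rho> z (gen w) \<in> aspan W" if "snd z \<in> gcomp (susp U) (fst z)" "w \<in> awords W" for z w
    unfolding \<rho>_def using letter_parts[OF that(1)] that(2)
    by (intro fs.span_add lmul_aspan comm_aspan) (auto intro: fs.span_base)
  show "\<rho> z x \<in> sym_null W" if "snd z \<in> gcomp (susp U) (fst z)" "x \<in> sym_null W" for z x
    unfolding \<rho>_def using letter_parts[OF that(1)] that(2)
    by (intro fs.subspace_add N lmul_null comm_null) auto
  show "\<rho> (i, u + u') x - \<rho> (i, u) x - \<rho> (i, u') x \<in> sym_null W"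
    if "u \<in> gcomp (susp U) i" "u' \<in> gcomp (susp U) i" "x \<in> aspan W" for i u u' x
    using fs.subspace_add[OF N lmul_letter_add[OF part_mem(1)[OF that(1)] part_mem(1)[OF that(2)] that(3)]
        comm_letter_add[OF part_mem(2)[OF that(1)] part_mem(2)[OF that(2)] that(3)]]
    by (simp add: \<rho>_def algebra_simps)
  show "\<rho> (i, gscale (susp U) c u) x - fscale c (\<rho> (i, u) x) \<in> sym_null W"
    if "u \<in> gcomp (susp U) i" "x \<in> aspan W" for i c u x
    using fs.subspace_add[OF N lmul_letter_scale[OF part_mem(1)[OF that(1)] that(2), of c]
        comm_letter_scale[OF part_mem(2)[OF that(1)] that(2), of c]]
    by (simp add: \<rho>_def U_simps fs.scale_right_distrib algebra_simps)
qed (rule \<rho>_chain)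

section \<open>The extended morphism and the composite\<close>

definition cp :: "(int \<times> 'v \<times> 'w \<times> 'w) list \<Rightarrow> 'w" where
  "cp w = sym_proj W (wdeg w) (act.P w)"

definition p :: "(int \<times> 'v \<times> 'w \<times> 'w) list \<Rightarrow> 'w" where
  "p = desusp cp"

lemma P_aspan: "w \<in> words (susp U) \<Longrightarrow> act.P w \<in> aspan W"
  using act.P_mem[of w] by (auto simp: mem_fspan_gen words_iff)

lemma cp_mem: "w \<in> words (susp U) \<Longrightarrow> cp w \<in> gcomp W (wdeg w)"
  unfolding cp_def by (rule sym_proj_mem[OF gvs(4) P_aspan])

lemma skew_p: "skew_family U (underlying L') (\<lambda>k. int k - 1) p"
  unfolding p_def
proof (rule skew_family_desusp[OF gvs(2)])
  have "sym_mod (susp U) (gscale W) {0} (\<lambda>w. sym_proj W n (act.P w))" for n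
    by (rule sym_mod_comp[OF act.P_sym module_hom_sym_proj[OF gvs(4)]]) (simp add: sym_proj_null[OF gvs(4)])
  from sym_mod_by_wdeg[of "susp U" "gscale W" "{0}", OF this]
  show "sym_mod (susp U) (gscale (underlying L')) {0} cp" by (simp add: cp_def[abs_def])
  show "cp xs \<in> gcomp (underlying L') (wdeg xs - int (length xs) + (int (length xs) - 1))"
    if "xs \<in> words (susp U)" for xs
    using cp_mem[OF that] by simp
qed

lemma induced_P: "induced_coalgebra_hom M L' p (lin_ext act.P)"
  unfolding induced_coalgebra_hom_def
proof
  show "coalgebra_hom (suspL M) W (lin_ext act.P)"
    by (rule coalgebra_homI) (simp_all add: act.P_Nil act.P_mem act.P_sym act.P_cop words_awords)
  show "has_components 0 (suspL M) W (lin_ext act.P) (susp_components (underlying L') p)"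
    unfolding has_components_def p_def susp_components_desusp[OF is_gvsD(1)[OF gvs(2)]]
  proof (intro ballI allI)
    fix xs i assume xs: "xs \<in> words (suspL M)"
    have "act.P xs \<in> fspan (gen ` {ys. wdeg ys = wdeg xs})"
      using act.P_mem[of xs] xs by (auto simp: mem_fspan_gen)
    from sym_proj_deg[OF gvs(4) this, of i]
    show "sym_proj W i (lin_ext act.P (gen xs)) = (if i = wdeg xs + 0 then cp xs else 0)"
      by (simp add: cp_def)
  qed
qed

lemma morphism_p: "linf_morphism M L' p"
proof (rule linf_morphismI[OF linf_M L' _ induced_P])
  show "skew_family (underlying M) (underlying L') (\<lambda>k. int k - 1) p" by (simp add: skew_p)
  fix x assume "x \<in> sym_free (suspL M)"
  then show "lin_ext act.P (codiff M x) - d (lin_ext act.P x) \<in> sym_null W"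
    unfolding sym_free_def
  proof (induction rule: fspan_gen_induct)
    case (gen w) then show ?case using act.P_chain[of w] by (simp add: words_awords)
  next
    case (add x y)
    from fs.subspace_add[OF subspace_sym_null this] show ?case by (simp add: lin_ext_add algebra_simps)
  next
    case (scale c x)
    from fs.subspace_scale[OF subspace_sym_null this, of c] show ?case
      by (simp add: lin_ext_fscale fs.scale_right_diff_distrib)
  qed (simp add: fs.subspace_0)
qed

text \<open>On included words every acting letter has zero cone slots and so acts by a null
  operator; what survives is the part \<open>q 0\<close>, in which no letter acts.\<close>

lemma P_incl:
  assumes w: "w \<in> awords V"
  shows "act.P (map incl_letter w) - unital F w \<in> sym_null W"
proof -
  note N = subspace_sym_null[of W]
  have id: "map fst_letter (map incl_letter w) = w" by (simp add: comp_def fst_letter_def incl_letter_def)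
  have "act.q (Suc k) (map incl_letter w) \<in> sym_null W" for k
  proof -
    have "cosum (map incl_letter w) (\<lambda>a b. act.\<theta> a (act.q k b)) \<in> sym_null W"
    proof (subst cosum_map)
      show "fst (incl_letter z) = fst z" for z by (simp add: incl_letter_def)
      show "cosum w (\<lambda>a b. act.\<theta> (map incl_letter a) (act.q k (map incl_letter b))) \<in> sym_null W"
      proof (rule fs.cosum_mem[OF N])
        fix a b assume *: "set a \<union> set b = set w"
        have "act.q k (map incl_letter b) \<in> aspan W"
          by (rule hspan_aspan[OF act.q_mem[OF awords_maps(3)[OF cosum_awords(2)[OF w *]]]])
        then show "act.\<theta> (map incl_letter a) (act.q k (map incl_letter b)) \<in> sym_null W"
          unfolding act.\<theta>_def
          by (auto simp: length_Suc_conv incl_letter_def fs.subspace_0 intro!: \<rho>_zero)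
      qed
    qed
    then show ?thesis by (simp add: fs.subspace_scale del: of_nat_Suc)
  qed
  then have "(\<Sum>k<length w. act.q (Suc k) (map incl_letter w)) \<in> sym_null W"
    by (intro fs.subspace_sum N)
  moreover have "act.P (map incl_letter w) = unital F w + (\<Sum>k<length w. act.q (Suc k) (map incl_letter w))"
    unfolding act.P_def length_map lessThan_Suc_atMost[symmetric] sum.lessThan_Suc_shift
    by (simp add: id[simplified] del: act.q.simps(2))
  ultimately show ?thesis by simp
qed

text \<open>The composite of the coalgebra morphisms agrees with \<open>F\<close> only modulo the
  relations. This suffices because the projection to the generators kills the relations, so the
  components are those of \<open>f\<close>.\<close>

lemma comp_pj: "linf_comp L M L' p j f"
  unfolding linf_comp_def
proof (intro exI conjI)
  show "induced_coalgebra_hom L M j J" by (rule induced_J)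
  show "induced_coalgebra_hom M L' p (lin_ext act.P)" by (rule induced_P)
  have eq: "lin_ext act.P \<circ> J = lin_ext (\<lambda>w. act.P (map incl_letter w))"
    by (simp add: fun_eq_iff J_def lin_ext_comp)
  show "induced_coalgebra_hom L L' f (lin_ext act.P \<circ> J)"
    unfolding induced_coalgebra_hom_def eq
  proof
    show "coalgebra_hom V W (lin_ext (\<lambda>w. act.P (map incl_letter w)))"
    proof (rule coalgebra_homI)
      fix w assume w: "w \<in> words V"
      then have iw: "map incl_letter w \<in> words (susp U)" using awords_maps(3) by (auto simp: words_iff)
      show "act.P (map incl_letter w) \<in> fspan (gen ` {ys \<in> words W. wdeg ys = wdeg w})"
        using act.P_mem[OF iw] by simp
      show "cop (act.P (map incl_letter w)) -
          cosum w (\<lambda>a b. tens (act.P (map incl_letter a)) (act.P (map incl_letter b))) \<in> anull2 W"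
        using act.P_cop[of "map incl_letter w"] iw by (simp add: cosum_map incl_letter_def words_iff)
    qed (simp_all add: act.P_Nil sym_mod_incl act.P_sym)
    show "has_components 0 V W (lin_ext (\<lambda>w. act.P (map incl_letter w))) (susp_components (underlying L') f)"
      unfolding has_components_def
    proof (intro ballI allI)
      fix xs i assume xs: "xs \<in> words V"
      have "sym_proj W i (act.P (map incl_letter xs) - F (gen xs)) = 0"
        using P_incl[of xs] xs by (intro sym_proj_null[OF gvs(4)]) (auto simp: unital_def words_iff)
      then show "sym_proj W i (lin_ext (\<lambda>w. act.P (map incl_letter w)) (gen xs)) =
          (if i = wdeg xs + 0 then susp_components (underlying L') f xs else 0)"
        using F xs by (simp add: sym_proj_diff[OF gvs(4)] induced_coalgebra_hom_def has_components_def)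
    qed
  qed
qed

lemma unital_zero_letter: "unital F [(i, 0)] \<in> sym_null W"
proof -
  have "gen [(i, 0)] \<in> sym_null V" using gen_zero_letter[OF gvs(3), of "[]" "[]" i] by simp
  then show ?thesis using F_hom by (simp add: unital_def coalgebra_hom_def sym_hom_def)
qed

text \<open>On a single letter the action is evaluated at the unit, and multiplying the unit by
  \<open>e\<close> gives the letter \<open>e\<close>. The contributions of the zero slots, through
  \<open>F\<close> and through the commutator, are relations and project to 0.\<close>

lemma p_section:
  assumes e: "e \<in> Epart i"
  shows "p [(i, 0, e, 0)] = e"
proof -
  let ?z = "(i + 1, 0, e, 0) :: int \<times> 'v \<times> 'w \<times> 'w"
  have one: "gen [] \<in> aspan W" by (rule fs.span_base) simp
  note comm0 = comm_zero[OF one, of "i + 2"]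
  have "act.P [?z] = unital F [(i + 1, 0)] + \<rho> ?z (gen [])"
    by (simp add: act.P_def act.\<theta>_def fst_letter_def) (simp add: unital_def)
  also have "\<dots> = gen [(i + 1, e)] + (unital F [(i + 1, 0)] + comm (i + 2, 0) (gen []))"
    by (simp add: \<rho>_def add.commute)
  finally have "cp [?z] = sym_proj W (i + 1) (gen [(i + 1, e)]) + sym_proj W (i + 1) (unital F [(i + 1, 0)] + comm (i + 2, 0) (gen []))"
    by (simp add: cp_def sym_proj_add[OF gvs(4)])
  also have "sym_proj W (i + 1) (unital F [(i + 1, 0)] + comm (i + 2, 0) (gen [])) = 0"
    by (intro sym_proj_null[OF gvs(4)] fs.subspace_add subspace_sym_null comm0 unital_zero_letter)
  also have "sym_proj W (i + 1) (gen [(i + 1, e)]) = e" by (simp add: sym_proj_gen[OF gvs(4)])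
  finally show ?thesis by (simp add: p_def desusp_def)
qed

lemma fibration_p: "fibration M L' p"
  unfolding fibration_def
proof (intro allI impI equalityI subsetI)
  fix i :: int and y assume i: "i > 0"
  {
    assume "y \<in> (\<lambda>x. p [(i, x)]) ` gcomp (underlying M) i"
    then obtain x where "y = p [(i, x)]" "[(i, x)] \<in> words U" by (auto simp: words_iff)
    then show "y \<in> gcomp (underlying L') i"
      using skew_familyD(1)[OF skew_p, of "[(i, x)]"] by simp
  next
    assume y: "y \<in> gcomp (underlying L') i"
    then have "y \<in> Epart i" using i by (simp add: Epart_def)
    then have "(0, y, 0) \<in> gcomp U i"
      using subspace_parts[of i] by (simp add: U_simps VL.subspace_0 WL.subspace_0)
    with p_section[OF \<open>y \<in> Epart i\<close>]
    show "y \<in> (\<lambda>x. p [(i, x)]) ` gcomp (underlying M) i" by (auto intro!: image_eqI)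
  }
qed

section \<open>Homology of the product\<close>

lemma cycles_M: "cycles M i = {(v, e, b). v \<in> cycles L i \<and> e = 0 \<and> b \<in> Bpart i}"
  using subspace_parts(1)[of i]
  by (auto simp: cycles_def U_simps M_def fst_letter_def WL.subspace_0 zero_prod_def)

lemma boundaries_M: "boundaries M i = {(v, e, b). v \<in> boundaries L i \<and> e = 0 \<and> b \<in> Bpart i}"
proof -
  \<comment> \<open>This equality is the acyclicity of the cone: its differential maps the
    \<open>e\<close> slot in degree \<open>i + 1\<close> identically onto the \<open>b\<close> slot
    in degree \<open>i\<close>.\<close>
  have EB: "Epart (i + 1) = Bpart i" by (simp add: Epart_def Bpart_def)
  show ?thesis
  proof (intro equalityI subsetI)
    fix x assume "x \<in> boundaries M i"
    then show "x \<in> {(v, e, b). v \<in> boundaries L i \<and> e = 0 \<and> b \<in> Bpart i}"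
      by (auto simp: boundaries_def U_simps M_def fst_letter_def EB)
  next
    fix x :: "'v \<times> 'w \<times> 'w" assume "x \<in> {(v, e, b). v \<in> boundaries L i \<and> e = 0 \<and> b \<in> Bpart i}"
    then obtain u b where "x = (bracket L [(i + 1, u)], 0, b)" "u \<in> gcomp (underlying L) (i + 1)" "b \<in> Bpart i"
      by (auto simp: boundaries_def)
    then show "x \<in> boundaries M i"
      using WL.subspace_0[OF subspace_parts(2)]
      by (auto simp: boundaries_def U_simps M_def fst_letter_def EB intro!: image_eqI[of _ _ "(u, b, 0)"])
  qed
qed

lemma homologous_M:
  "(x, y) \<in> homologous M i \<longleftrightarrow> (fst x, fst y) \<in> homologous L i \<and>
     fst (snd x) = 0 \<and> fst (snd y) = 0 \<and> snd (snd x) \<in> Bpart i \<and> snd (snd y) \<in> Bpart i"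
  using WL.subspace_diff[OF subspace_parts(2)[of i]]
  by (auto simp: homologous_def cycles_M boundaries_M case_prod_beta mem_Times_iff)

lemma boundaries_add:
  assumes "x \<in> boundaries L i" "y \<in> boundaries L i"
  shows "x + y \<in> boundaries L i"
proof -
  from assms obtain u v where uv: "u \<in> gcomp (underlying L) (i + 1)" "v \<in> gcomp (underlying L) (i + 1)"
    "x = bracket L [(i + 1, u)]" "y = bracket L [(i + 1, v)]" by (auto simp: boundaries_def)
  then have "x + y = bracket L [(i + 1, u + v)]"
    using skew_familyD(2)[OF linf_algebraD(2)[OF L], of "[]" "[]" u "i + 1" v] by simp
  then show ?thesis using uv is_gvsD(3)[OF gvs(1)] by (auto simp: boundaries_def)
qed

lemma boundaries_zero: "0 \<in> boundaries L i"
proof -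
  have "bracket L [(i + 1, 0)] = 0"
    using skew_familyD(3)[OF linf_algebraD(2)[OF L], of "[]" "[]" 0 "i + 1" 0] is_gvsD(2)[OF gvs(1)] by simp
  then show ?thesis using is_gvsD(2)[OF gvs(1)] by (force simp: boundaries_def image_iff)
qed

lemma weak_equivalence_j: "weak_equivalence L M j"
  unfolding weak_equivalence_def
proof
  fix i
  let ?F = "\<lambda>X. homologous M i `` ((\<lambda>x. j [(i, x)]) ` X)"
  \<comment> \<open>A homology class of \<open>M\<close> is a class of \<open>L\<close> times the
    whole of \<open>{0} \<times> Bpart i\<close>, because every element of \<open>Bpart i\<close> is
    a boundary.\<close>
  let ?G = "\<lambda>X. {(v, e :: 'w, b). v \<in> X \<and> e = 0 \<and> b \<in> Bpart i}"
  have B0: "0 \<in> Bpart i" using subspace_parts(2) by (rule WL.subspace_0)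
  have refl: "(x, x) \<in> homologous L i" if "x \<in> cycles L i" for x
    using that by (simp add: homologous_def boundaries_zero)
  have trans: "(x, z) \<in> homologous L i" if "(x, y) \<in> homologous L i" "(y, z) \<in> homologous L i" for x y z
    using that boundaries_add[of "x - y" i "y - z"] by (simp add: homologous_def)
  have cyc: "x \<in> cycles L i \<and> y \<in> cycles L i" if "(x, y) \<in> homologous L i" for x y
    using that by (simp add: homologous_def)
  have FG: "?F X = ?G X" if "X \<in> homology L i" for X
  proof -
    from that obtain x where X: "X = homologous L i `` {x}" by (auto simp: homology_def quotient_def)
    show ?thesis
    proof (intro equalityI subsetI)
      fix u assume "u \<in> ?F X"
      then obtain y where "y \<in> X" "((y, 0, 0), u) \<in> homologous M i" by (auto simp: j_def)
      then show "u \<in> ?G X" using trans by (auto simp: homologous_M X case_prod_beta mem_Times_iff)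
    next
      fix u :: "'v \<times> 'w \<times> 'w" assume "u \<in> ?G X"
      then have "fst u \<in> X" "((fst u, 0, 0), u) \<in> homologous M i"
        using refl cyc B0 by (auto simp: homologous_M X)
      then show "u \<in> ?F X" by (auto simp: j_def)
    qed
  qed
  have cls: "homologous M i `` {(v, 0, b)} = ?G (homologous L i `` {v})" if "b \<in> Bpart i" for v b
    using that by (auto simp: homologous_M case_prod_beta)
  have "bij_betw ?G (homology L i) (homology M i)"
  proof (rule bij_betw_imageI)
    show "inj_on ?G (homology L i)"
    proof (rule inj_onI)
      fix X Y assume "?G X = ?G Y"
      then have "(v, 0, 0) \<in> ?G X \<longleftrightarrow> (v, 0, 0) \<in> ?G Y" for v by simp
      then show "X = Y" using B0 by auto
    qed
    show "?G ` homology L i = homology M i"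
    proof (intro equalityI subsetI)
      fix Y assume "Y \<in> ?G ` homology L i"
      then obtain v where "v \<in> cycles L i" "Y = ?G (homologous L i `` {v})"
        by (auto simp: homology_def quotient_def)
      then show "Y \<in> homology M i"
        using cls[OF B0, of v] B0 by (auto simp: homology_def quotient_def cycles_M intro!: bexI[of _ "(v, 0, 0)"])
    next
      fix Y assume "Y \<in> homology M i"
      then obtain v b where "v \<in> cycles L i" "b \<in> Bpart i" "Y = homologous M i `` {(v, 0, b)}"
        by (auto simp: homology_def quotient_def cycles_M)
      then show "Y \<in> ?G ` homology L i"
        using cls[of b v] by (auto simp: homology_def quotient_def)
    qed
  qed
  then show "bij_betw ?F (homology L i) (homology M i)"
    using FG by (subst bij_betw_cong[of _ _ ?G]) auto
qed

section \<open>Finite type and the range of degrees\<close>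

lemma finite_type_M:
  assumes "finite_type L" "finite_type L'"
  shows "finite_type M"
  unfolding finite_type_def
proof
  fix i
  interpret U: vector_space "gscale U" by (rule is_gvsD(1)[OF gvs_U])
  obtain A where A: "finite A" "gcomp (underlying L) i = VL.span A"
    using assms(1) by (auto simp: finite_type_def)
  have fin: "\<exists>B. finite B \<and> gcomp (underlying L') k = WL.span B" for k
    using assms(2) by (auto simp: finite_type_def)
  have "\<exists>B. finite B \<and> {0} = WL.span B" using WL.span_empty by blast
  then obtain B C where B: "finite B" "Epart i = WL.span B" and C: "finite C" "Bpart i = WL.span C"
    using fin by (metis Epart_def Bpart_def)
  interpret a: module_hom "gscale (underlying L)" "gscale U" "\<lambda>v. (v, 0, 0)"
    by unfold_locales (simp_all add: U_simps)
  interpret b: module_hom "gscale (underlying L')" "gscale U" "\<lambda>e. (0, e, 0)"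
    by unfold_locales (simp_all add: U_simps)
  interpret c: module_hom "gscale (underlying L')" "gscale U" "\<lambda>b. (0, 0, b)"
    by unfold_locales (simp_all add: U_simps)
  let ?S = "(\<lambda>v. (v, 0, 0)) ` A \<union> (\<lambda>e. (0, e, 0)) ` B \<union> (\<lambda>b. (0, 0, b)) ` C"
  have "gcomp U i = U.span ?S"
  proof (intro equalityI subsetI)
    fix x assume "x \<in> gcomp U i"
    then have x: "fst x \<in> VL.span A" "fst (snd x) \<in> WL.span B" "snd (snd x) \<in> WL.span C"
      by (simp_all add: U_simps A B C)
    have "(fst x, 0, 0) \<in> U.span ((\<lambda>v. (v, 0, 0)) ` A)" using x(1) unfolding a.span_image by (rule imageI)
    moreover have "(0, fst (snd x), 0) \<in> U.span ((\<lambda>e. (0, e, 0)) ` B)" using x(2) unfolding b.span_image by (rule imageI)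
    moreover have "(0, 0, snd (snd x)) \<in> U.span ((\<lambda>b. (0, 0, b)) ` C)" using x(3) unfolding c.span_image by (rule imageI)
    moreover have "U.span ((\<lambda>v. (v, 0, 0)) ` A) \<subseteq> U.span ?S" "U.span ((\<lambda>e. (0, e, 0)) ` B) \<subseteq> U.span ?S"
      "U.span ((\<lambda>b. (0, 0, b)) ` C) \<subseteq> U.span ?S" by (rule U.span_mono; blast)+
    ultimately have "(fst x, 0, 0) + (0, fst (snd x), 0) + (0, 0, snd (snd x)) \<in> U.span ?S"
      by (intro U.span_add) auto
    then show "x \<in> U.span ?S" by simp
  next
    fix x assume "x \<in> U.span ?S"
    moreover have "?S \<subseteq> gcomp U i"
      using A B C VL.span_superset[of A] WL.span_superset[of B] WL.span_superset[of C] subspace_parts[of i]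
      by (auto simp: U_simps VL.subspace_0 WL.subspace_0)
    ultimately show "x \<in> gcomp U i"
      using U.span_minimal[OF _ is_gvsD(5)[OF gvs_U, of i], of ?S] by blast
  qed
  then show "\<exists>S. finite S \<and> gcomp (underlying M) i = module.span (gscale (underlying M)) S"
    using A(1) B(1) C(1) by (intro exI[of _ ?S]) simp
qed

lemma lie_n_M:
  assumes "lie_n_algebra n L" "lie_n_algebra n L'"
  shows "lie_n_algebra n M"
  unfolding lie_n_algebra_def
proof (intro conjI allI impI)
  show "linf_algebra M" by (rule linf_M)
  fix i assume i: "\<not> (0 \<le> i \<and> enat (nat i) < n)"
  have zL: "gcomp (underlying L) i = {0}"
    using assms(1) i by (auto simp: lie_n_algebra_def)
  have zL': "gcomp (underlying L') k = {0}" if "\<not> (0 \<le> k \<and> enat (nat k) < n)" for k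
    using assms(2) that by (auto simp: lie_n_algebra_def)
  have "Epart i = {0}" using zL'[OF i] by (simp add: Epart_def)
  moreover have "Bpart i = {0}"
  proof (cases "i \<ge> 0")
    case True
    \<comment> \<open>At the top, \<open>Bpart i\<close> is taken from degree \<open>i + 1\<close>
      of \<open>L'\<close>, which lies beyond \<open>n\<close> as soon as \<open>i\<close> does. At
      the bottom the truncation works: without it, degree 0 of \<open>L'\<close> would appear at
      \<open>i = -1\<close>.\<close>
    have "enat (nat i) \<le> enat (nat (i + 1))" by simp
    then have "\<not> enat (nat (i + 1)) < n" using i True by (metis le_less_trans)
    then show ?thesis using True zL'[of "i + 1"] by (simp add: Bpart_def)
  qed (simp add: Bpart_def)
  ultimately show "gcomp (underlying M) i = {0}"
    by (auto simp: U_simps zL zero_prod_def prod_eq_iff)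
qed

end

theorem corollary5p5:
  fixes n :: enat
    and L :: "('k::field_char_0, 'v::ab_group_add) linf"
    and L' :: "('k, 'w::ab_group_add) linf"
    and f :: "(int \<times> 'v) list \<Rightarrow> 'w"
  assumes "lie_n_algebra n L" and "finite_type L"
    and "lie_n_algebra n L'" and "finite_type L'"
    and "linf_morphism L L' f"
  shows "\<exists>(M :: ('k, 'v \<times> 'w \<times> 'w) linf) j p.
           lie_n_algebra n M \<and> finite_type M \<and>
           linf_morphism L M j \<and> linf_morphism M L' p \<and>
           linf_comp L M L' p j f \<and>
           weak_equivalence L M j \<and> fibration M L' p"
proof -
  have LL': "linf_algebra L" "linf_algebra L'" using assms by (simp_all add: lie_n_algebra_def)
  obtain F where "induced_coalgebra_hom L L' f F"
    "\<And>x. x \<in> sym_free (suspL L) \<Longrightarrow> F (codiff L x) - codiff L' (F x) \<in> sym_null (suspL L')"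
    using linf_morphismD[OF LL' assms(5)] by blast
  then interpret fac: linf_factorization L L' f F
    using LL' by (intro linf_factorization.intro)
  show ?thesis
    using fac.lie_n_M[OF assms(1,3)] fac.finite_type_M[OF assms(2,4)] fac.morphism_j fac.morphism_p
      fac.comp_pj fac.weak_equivalence_j fac.fibration_p by blast
qed

end
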